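(* Let $(X,\rho,\mu)$ be a space of homogeneous type (with the standing assumptions listed in the context), $q\in(1,\infty)$, and $\omega$ be a weight. Then the following statements are equivalent. (i) There exists a $\gamma\in(0,1)$ such that $\omega\in A^+_q(\gamma)$. (ii) For any $\gamma\in(0,1)$, $\omega\in A^+_q(\gamma)$. (iii) There exists a $\gamma\in(0,1)$ such that $\mathcal M^{\gamma+}$ is bounded from $L^q(X\times\mathbb R,\omega)$ to $L^{q,\infty}(X\times\mathbb R,\omega)$. (iv) For any $\gamma\in(0,1)$, $\mathcal M^{\gamma+}$ is bounded from $L^q(X\times\mathbb R,\omega)$ to $L^{q,\infty}(X\times\mathbb R,\omega)$.
   Context: Setting. $(X,\rho)$ is a quasi-metric space: $\rho:X\times X\to[0,\infty)$, $\rho(x,y)=0$ iff $x=y$, $\rho(x,y)=\rho(y,x)$, and $\rho(x,y)\le K_0[\rho(x,z)+\rho(z,y)]$ for all $x,y,z\in X$, with a constant $K_0\in[1,\infty)$. Balls are $B(x,r)=\{y\in X:\rho(x,y)<r\}$. $\mu$ is a nonnegative measure on a $\sigma$-algebra containing the balls which is doubling: $\mu(B(x,2r))\le C_\mu\mu(B(x,r))$ for all $x\in X$, $r\in(0,\infty)$; then $(X,\rho,\mu)$ is called a space of homogeneous type. Standing assumptions: (a) for each $x$ the balls $\{B(x,r)\}_{r>0}$ form a basis of open neighborhoods of $x$; (b) $\mu$ is Borel regular (open sets are measurable and every $A\subset X$ lies in a Borel set $E$ with $\mu(A)=\mu(E)$); (c) $0<\mu(B(x,r))<\infty$ for all balls;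 (d) $\operatorname{diam}(X)=\infty$ and $\mu(\{x\})=0$ for all $x$; (e) monotone geodesic property: there is a constant $\widetilde K>0$ such that for all $s\in(0,\infty)$ and $x,y\in X$ with $\rho(x,y)\ge s$ there are $m\in\mathbb N$ and points $x_0=x,x_1,\dots,x_m=y$ with $\rho(x_i,x_{i+1})\le\widetilde K s$ and $\rho(x_{i+1},x_m)\le\rho(x_i,x_m)-s$ for $i=0,\dots,m-1$. Fix $p\in(1,\infty)$. $X\times\mathbb R$ carries the quasi-metric $d((x,t),(y,s))=\max\{\rho(x,y),|t-s|^{1/p}\}$ and the product measure $\lambda=\mu\times m$, $m$ being Lebesgue measure on $\mathbb R$; the same basic assumptions (a)-(d) are made for $(X\times\mathbb R,d,\lambda)$. All integrals are with respect to $\lambda$, and $⨍_E f:=\frac1{\lambda(E)}\int_E f$ denotes the average. Parabolic cylinders. For $x\in X$, $t\in\mathbb R$, $l\in(0,\infty)$, $\gamma\in[0,1)$ put $R=R(x,t,l)=B(x,l)\times(t-l^p,t+l^p)$, $R^-(\gamma)=B(x,l)\times(t-l^p,t-\gamma l^p)$, $R^+(\gamma)=B(x,l)\times(t+\gamma l^p,t+l^p)$. Weights. A weight is a real-valued, $\lambda$-almost everywhere positive, locally integrable function on $X\times\mathbb R$ (integrable on some cylinder $R(x,t,r)$ around each point). For $q\in(1,\infty)$, with $1/q+1/q'=1$, and $\gamma\in[0,1)$, a weight $\omega$ belongs to $A^+_q(\gamma)$ if $\sup_{R}\left[⨍_{R^-(\gamma)}\omega\right]\left[⨍_{R^+(\gamma)}\omega^{1-q'}\right]^{q-1}<\infty$,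 the supremum being over all parabolic cylinders $R(x,t,l)$. Adjacent dyadic systems and parabolic rectangles. Fix $\delta\in(0,1)$ with $96K_0^6\delta\le1$ and constants $0<c_0\le C_0<\infty$ with $12K_0^3C_0\delta\le c_0$; let $c_1=(3K_0^2)^{-1}c_0$, $C_1=2K_0C_0$. Fix (they exist by a theorem of Hytönen and Kairema) $K\in\mathbb N$ and, for $\tau\in\{1,\dots,K\}$, points $\{z^{k,\tau}_\alpha\}$ and families $\mathfrak D^\tau=\{Q^{k,\tau}_\alpha: k\in\mathbb Z,\alpha\in I_{k,\tau}\}$ of subsets of $X$ (dyadic cubes) such that for each $\tau$: $\rho(z^{k,\tau}_\alpha,z^{k,\tau}_\beta)\ge c_0\delta^k$ for $\alpha\ne\beta$ and $\min_\alpha\rho(x,z^{k,\tau}_\alpha)<C_0\delta^k$ for all $x\in X$; if $l\ge k$, then either $Q^{l,\tau}_\beta\subset Q^{k,\tau}_\alpha$ or they are disjoint; for each $k$, $X$ is the disjoint union of $Q^{k,\tau}_\alpha$, $\alpha\in I_{k,\tau}$; $B(z^{k,\tau}_\alpha,c_1\delta^k)\subset Q^{k,\tau}_\alpha\subset B(z^{k,\tau}_\alpha,C_1\delta^k)$; if $l\ge k$ and $Q^{l,\tau}_\beta\subset Q^{k,\tau}_\alpha$, then $B(z^{l,\tau}_\beta,C_1\delta^l)\subset B(z^{k,\tau}_\alpha,C_1\delta^k)$; moreover there is a constant $C_*>0$ such that every ball $B(x,r)$ is contained in some $Q^{k,\tau}_\alpha$ (for some $\tau$) with $\operatorname{diam}(Q^{k,\tau}_\alpha)\le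 C_*r$. A parabolic rectangle is $P=P(\tau,k,\alpha,t)=Q^{k,\tau}_\alpha\times(t-\delta^{kp},t+\delta^{kp})$, with $P^+(\gamma)=Q^{k,\tau}_\alpha\times(t+\gamma\delta^{kp},t+\delta^{kp})$. Maximal function. For $f\in L^1_{\rm loc}(X\times\mathbb R)$, $\mathcal M^{\gamma+}f(x,t)=\sup ⨍_{P^+(\gamma)}|f|$, the supremum being over all $\tau,k,\alpha$ with $(x,t)\in P=P(\tau,k,\alpha,t)$ (i.e. $x\in Q^{k,\tau}_\alpha$; the same $t$). Spaces. $\|f\|_{L^q(X\times\mathbb R,\omega)}=(\int|f|^q\omega)^{1/q}$ and $\|f\|_{L^{q,\infty}(X\times\mathbb R,\omega)}=\sup_{\xi>0}\xi\,[\omega(\{|f|>\xi\})]^{1/q}$, where $\omega(E)=\int_E\omega$. *)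

theory Defs
  imports "HOL-Analysis.Analysis"
begin

text \<open>
  The underlying set of the space \<open>X\<close> is a whole type, so the measure \<open>\<mu>\<close> has
  \<open>space \<mu> = UNIV\<close>, but carries an arbitrary sigma-algebra.
\<close>

definition quasi_metric :: "('a \<Rightarrow> 'a \<Rightarrow> real) \<Rightarrow> real \<Rightarrow> bool" where
  "quasi_metric \<rho> K0 \<longleftrightarrow> 1 \<le> K0 \<and>
     (\<forall>x y. 0 \<le> \<rho> x y) \<and>
     (\<forall>x y. \<rho> x y = 0 \<longleftrightarrow> x = y) \<and>
     (\<forall>x y. \<rho> x y = \<rho> y x) \<and>
     (\<forall>x y z. \<rho> x y \<le> K0 * (\<rho> x z + \<rho> z y))"

definition qball :: "('a \<Rightarrow> 'a \<Rightarrow> real) \<Rightarrow> 'a \<Rightarrow> real \<Rightarrow> 'a set" where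
  "qball \<rho> x r = {y. \<rho> x y < r}"

text \<open>
  The topology of a quasi-metric space. Without further assumptions the balls of a
  quasi-metric need not themselves be open.
\<close>

definition qopen :: "('a \<Rightarrow> 'a \<Rightarrow> real) \<Rightarrow> 'a set \<Rightarrow> bool" where
  "qopen \<rho> U \<longleftrightarrow> (\<forall>x\<in>U. \<exists>r>0. qball \<rho> x r \<subseteq> U)"

definition qborel_sets :: "('a \<Rightarrow> 'a \<Rightarrow> real) \<Rightarrow> 'a set set" where
  "qborel_sets \<rho> = sigma_sets UNIV {U. qopen \<rho> U}"

definition qdiam :: "('a \<Rightarrow> 'a \<Rightarrow> real) \<Rightarrow> 'a set \<Rightarrow> ennreal" where
  "qdiam \<rho> E = (SUP x\<in>E. SUP y\<in>E. ennreal (\<rho> x y))"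

definition homogeneous_type :: "('a \<Rightarrow> 'a \<Rightarrow> real) \<Rightarrow> real \<Rightarrow> 'a measure \<Rightarrow> bool" where
  "homogeneous_type \<rho> K0 \<mu> \<longleftrightarrow> quasi_metric \<rho> K0 \<and> space \<mu> = UNIV \<and>
     (\<forall>x r. 0 < r \<longrightarrow> qball \<rho> x r \<in> sets \<mu>) \<and>
     (\<exists>C::real. \<forall>x r. 0 < r \<longrightarrow>
        emeasure \<mu> (qball \<rho> x (2 * r)) \<le> ennreal C * emeasure \<mu> (qball \<rho> x r))"

definition balls_nbhd_basis :: "('a \<Rightarrow> 'a \<Rightarrow> real) \<Rightarrow> bool" where
  "balls_nbhd_basis \<rho> \<longleftrightarrow>
     (\<forall>x. (\<forall>r>0. qopen \<rho> (qball \<rho> x r)) \<and>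
          (\<forall>U. qopen \<rho> U \<and> x \<in> U \<longrightarrow> (\<exists>r>0. qball \<rho> x r \<subseteq> U)))"

text \<open>
  The set \<open>A\<close> below is arbitrary; its measure is understood as the outer measure induced
  by \<open>\<mu>\<close>, which is \<open>\<mu> A\<close> when \<open>A\<close> is measurable.
\<close>

definition borel_regular :: "('a \<Rightarrow> 'a \<Rightarrow> real) \<Rightarrow> 'a measure \<Rightarrow> bool" where
  "borel_regular \<rho> \<mu> \<longleftrightarrow> (\<forall>U. qopen \<rho> U \<longrightarrow> U \<in> sets \<mu>) \<and>
     (\<forall>A. \<exists>E\<in>qborel_sets \<rho>. A \<subseteq> E \<and> outer_measure_of \<mu> A = emeasure \<mu> E)"

definition basic_assumptions :: "('a \<Rightarrow> 'a \<Rightarrow> real) \<Rightarrow> 'a measure \<Rightarrow> bool" where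
  "basic_assumptions \<rho> \<mu> \<longleftrightarrow> balls_nbhd_basis \<rho> \<and> borel_regular \<rho> \<mu> \<and>
     (\<forall>x r. 0 < r \<longrightarrow> 0 < emeasure \<mu> (qball \<rho> x r) \<and> emeasure \<mu> (qball \<rho> x r) < \<infinity>) \<and>
     qdiam \<rho> UNIV = \<infinity> \<and> (\<forall>x. emeasure \<mu> {x} = 0)"

definition monotone_geodesic :: "('a \<Rightarrow> 'a \<Rightarrow> real) \<Rightarrow> bool" where
  "monotone_geodesic \<rho> \<longleftrightarrow> (\<exists>Kt>0. \<forall>s>0. \<forall>x y. s \<le> \<rho> x y \<longrightarrow>
     (\<exists>(m::nat) xs. xs 0 = x \<and> xs m = y \<and>
        (\<forall>i<m. \<rho> (xs i) (xs (Suc i)) \<le> Kt * s \<and>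
               \<rho> (xs (Suc i)) (xs m) \<le> \<rho> (xs i) (xs m) - s)))"

definition par_dist :: "('a \<Rightarrow> 'a \<Rightarrow> real) \<Rightarrow> real \<Rightarrow> 'a \<times> real \<Rightarrow> 'a \<times> real \<Rightarrow> real" where
  "par_dist \<rho> p = (\<lambda>(x, t) (y, s). max (\<rho> x y) (\<bar>t - s\<bar> powr (1 / p)))"

definition par_measure :: "'a measure \<Rightarrow> ('a \<times> real) measure" where
  "par_measure \<mu> = \<mu> \<Otimes>\<^sub>M lebesgue"

definition cyl :: "('a \<Rightarrow> 'a \<Rightarrow> real) \<Rightarrow> real \<Rightarrow> 'a \<Rightarrow> real \<Rightarrow> real \<Rightarrow> ('a \<times> real) set" where
  "cyl \<rho> p x t l = qball \<rho> x l \<times> {t - l powr p <..< t + l powr p}"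

definition cyl_minus ::
  "('a \<Rightarrow> 'a \<Rightarrow> real) \<Rightarrow> real \<Rightarrow> real \<Rightarrow> 'a \<Rightarrow> real \<Rightarrow> real \<Rightarrow> ('a \<times> real) set" where
  "cyl_minus \<rho> p \<gamma> x t l = qball \<rho> x l \<times> {t - l powr p <..< t - \<gamma> * l powr p}"

definition cyl_plus ::
  "('a \<Rightarrow> 'a \<Rightarrow> real) \<Rightarrow> real \<Rightarrow> real \<Rightarrow> 'a \<Rightarrow> real \<Rightarrow> real \<Rightarrow> ('a \<times> real) set" where
  "cyl_plus \<rho> p \<gamma> x t l = qball \<rho> x l \<times> {t + \<gamma> * l powr p <..< t + l powr p}"

text \<open>Power of an extended nonnegative real, used only with exponent \<open>a > 0\<close>.\<close>

definition ennpowr :: "ennreal \<Rightarrow> real \<Rightarrow> ennreal" where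
  "ennpowr x a = (if x = \<infinity> then \<infinity> else ennreal (enn2real x powr a))"

definition avg :: "'b measure \<Rightarrow> 'b set \<Rightarrow> ('b \<Rightarrow> ennreal) \<Rightarrow> ennreal" where
  "avg N E g = (\<integral>\<^sup>+z\<in>E. g z \<partial>N) / emeasure N E"

definition weight ::
  "('a \<Rightarrow> 'a \<Rightarrow> real) \<Rightarrow> 'a measure \<Rightarrow> real \<Rightarrow> ('a \<times> real \<Rightarrow> real) \<Rightarrow> bool" where
  "weight \<rho> \<mu> p \<omega> \<longleftrightarrow> \<omega> \<in> borel_measurable (par_measure \<mu>) \<and>
     (AE z in par_measure \<mu>. 0 < \<omega> z) \<and>
     (\<forall>x t. \<exists>r>0. set_integrable (par_measure \<mu>) (cyl \<rho> p x t r) \<omega>)"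

definition conj_exponent :: "real \<Rightarrow> real" where
  "conj_exponent q = q / (q - 1)"

lemma conj_exponent_eq: "1 < q \<Longrightarrow> 1 / q + 1 / conj_exponent q = 1"
  by (simp add: conj_exponent_def field_simps)

text \<open>
  The product never has the form \<open>0 * \<infinity>\<close>: since a weight is positive almost everywhere,
  both averages are positive.
\<close>

definition A_plus ::
  "('a \<Rightarrow> 'a \<Rightarrow> real) \<Rightarrow> 'a measure \<Rightarrow> real \<Rightarrow> real \<Rightarrow> real \<Rightarrow> ('a \<times> real \<Rightarrow> real) set" where
  "A_plus \<rho> \<mu> p q \<gamma> = {\<omega>. weight \<rho> \<mu> p \<omega> \<and>
     (SUP (x, t, l) \<in> {(x, t, l). 0 < l}.
        avg (par_measure \<mu>) (cyl_minus \<rho> p \<gamma> x t l) (\<lambda>z. ennreal (\<omega> z)) *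
        ennpowr (avg (par_measure \<mu>) (cyl_plus \<rho> p \<gamma> x t l)
                   (\<lambda>z. ennreal (\<omega> z powr (1 - conj_exponent q)))) (q - 1)) < \<infinity>}"

text \<open>
  The cubes are required to be measurable, as they are in the construction of Hytonen and
  Kairema; otherwise averages over the associated rectangles would not make sense.
  The system number \<open>\<tau>\<close> ranges over \<open>{1..K}\<close>, the generation \<open>k\<close> over all integers.
\<close>

definition adjacent_dyadic_systems ::
  "('a \<Rightarrow> 'a \<Rightarrow> real) \<Rightarrow> real \<Rightarrow> 'a measure \<Rightarrow> real \<Rightarrow> real \<Rightarrow> real \<Rightarrow> nat \<Rightarrow>
   (nat \<Rightarrow> int \<Rightarrow> 'i set) \<Rightarrow> (nat \<Rightarrow> int \<Rightarrow> 'i \<Rightarrow> 'a) \<Rightarrow> (nat \<Rightarrow> int \<Rightarrow> 'i \<Rightarrow> 'a set) \<Rightarrow> bool" where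
  "adjacent_dyadic_systems \<rho> K0 \<mu> \<delta> c0 C0 K I z Q \<longleftrightarrow>
     (let c1 = c0 / (3 * K0\<^sup>2); C1 = 2 * K0 * C0 in
       (\<forall>\<tau>\<in>{1..K}.
         (\<forall>k. \<forall>\<alpha>\<in>I \<tau> k. Q \<tau> k \<alpha> \<in> sets \<mu>) \<and>
         (\<forall>k. \<forall>\<alpha>\<in>I \<tau> k. \<forall>\<beta>\<in>I \<tau> k. \<alpha> \<noteq> \<beta> \<longrightarrow> c0 * \<delta> powi k \<le> \<rho> (z \<tau> k \<alpha>) (z \<tau> k \<beta>)) \<and>
         (\<forall>k x. \<exists>\<alpha>\<in>I \<tau> k. (\<forall>\<beta>\<in>I \<tau> k. \<rho> x (z \<tau> k \<alpha>) \<le> \<rho> x (z \<tau> k \<beta>)) \<and>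
                          \<rho> x (z \<tau> k \<alpha>) < C0 * \<delta> powi k) \<and>
         (\<forall>k l. k \<le> l \<longrightarrow> (\<forall>\<alpha>\<in>I \<tau> k. \<forall>\<beta>\<in>I \<tau> l.
                 Q \<tau> l \<beta> \<subseteq> Q \<tau> k \<alpha> \<or> Q \<tau> l \<beta> \<inter> Q \<tau> k \<alpha> = {})) \<and>
         (\<forall>k. disjoint_family_on (Q \<tau> k) (I \<tau> k) \<and> (\<Union>\<alpha>\<in>I \<tau> k. Q \<tau> k \<alpha>) = UNIV) \<and>
         (\<forall>k. \<forall>\<alpha>\<in>I \<tau> k. qball \<rho> (z \<tau> k \<alpha>) (c1 * \<delta> powi k) \<subseteq> Q \<tau> k \<alpha> \<and>
                        Q \<tau> k \<alpha> \<subseteq> qball \<rho> (z \<tau> k \<alpha>) (C1 * \<delta> powi k)) \<and>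
         (\<forall>k l. k \<le> l \<longrightarrow> (\<forall>\<alpha>\<in>I \<tau> k. \<forall>\<beta>\<in>I \<tau> l. Q \<tau> l \<beta> \<subseteq> Q \<tau> k \<alpha> \<longrightarrow>
                 qball \<rho> (z \<tau> l \<beta>) (C1 * \<delta> powi l) \<subseteq> qball \<rho> (z \<tau> k \<alpha>) (C1 * \<delta> powi k)))) \<and>
       (\<exists>Cs>0. \<forall>x r. 0 < r \<longrightarrow> (\<exists>\<tau>\<in>{1..K}. \<exists>k. \<exists>\<alpha>\<in>I \<tau> k.
          qball \<rho> x r \<subseteq> Q \<tau> k \<alpha> \<and> qdiam \<rho> (Q \<tau> k \<alpha>) \<le> ennreal (Cs * r))))"

definition rect_plus ::
  "real \<Rightarrow> real \<Rightarrow> (nat \<Rightarrow> int \<Rightarrow> 'i \<Rightarrow> 'a set) \<Rightarrow> real \<Rightarrow> nat \<Rightarrow> int \<Rightarrow> 'i \<Rightarrow> real \<Rightarrow> ('a \<times> real) set" where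
  "rect_plus p \<delta> Q \<gamma> \<tau> k \<alpha> t =
     Q \<tau> k \<alpha> \<times> {t + \<gamma> * \<delta> powr (of_int k * p) <..< t + \<delta> powr (of_int k * p)}"

text \<open>
  The averages are extended nonnegative integrals, so the formula makes sense (with possible
  value \<open>\<infinity>\<close>) for every measurable \<open>f\<close>, in particular for all of \<open>L\<^sup>q(\<omega>)\<close>; for locally
  integrable \<open>f\<close> it is the usual maximal function.
\<close>

definition max_fun ::
  "'a measure \<Rightarrow> real \<Rightarrow> real \<Rightarrow> nat \<Rightarrow> (nat \<Rightarrow> int \<Rightarrow> 'i set) \<Rightarrow> (nat \<Rightarrow> int \<Rightarrow> 'i \<Rightarrow> 'a set) \<Rightarrow>
   real \<Rightarrow> ('a \<times> real \<Rightarrow> real) \<Rightarrow> 'a \<times> real \<Rightarrow> ennreal" where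
  "max_fun \<mu> p \<delta> K I Q \<gamma> f = (\<lambda>(x, t).
     (SUP (\<tau>, k, \<alpha>) \<in> {(\<tau>, k, \<alpha>). \<tau> \<in> {1..K} \<and> \<alpha> \<in> I \<tau> k \<and> x \<in> Q \<tau> k \<alpha>}.
        avg (par_measure \<mu>) (rect_plus p \<delta> Q \<gamma> \<tau> k \<alpha> t) (\<lambda>z. ennreal \<bar>f z\<bar>)))"

definition Lq_norm ::
  "'a measure \<Rightarrow> real \<Rightarrow> ('a \<times> real \<Rightarrow> real) \<Rightarrow> ('a \<times> real \<Rightarrow> real) \<Rightarrow> ennreal" where
  "Lq_norm \<mu> q \<omega> f = ennpowr (\<integral>\<^sup>+z. ennreal (\<bar>f z\<bar> powr q * \<omega> z) \<partial>par_measure \<mu>) (1 / q)"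

definition Lq_space ::
  "'a measure \<Rightarrow> real \<Rightarrow> ('a \<times> real \<Rightarrow> real) \<Rightarrow> ('a \<times> real \<Rightarrow> real) set" where
  "Lq_space \<mu> q \<omega> = {f. f \<in> borel_measurable (par_measure \<mu>) \<and> Lq_norm \<mu> q \<omega> f < \<infinity>}"

definition weighted_measure :: "'a measure \<Rightarrow> ('a \<times> real \<Rightarrow> real) \<Rightarrow> ('a \<times> real) set \<Rightarrow> ennreal" where
  "weighted_measure \<mu> \<omega> E = (\<integral>\<^sup>+z\<in>E. ennreal (\<omega> z) \<partial>par_measure \<mu>)"

definition weak_Lq_norm ::
  "'a measure \<Rightarrow> real \<Rightarrow> ('a \<times> real \<Rightarrow> real) \<Rightarrow> ('a \<times> real \<Rightarrow> ennreal) \<Rightarrow> ennreal" where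
  "weak_Lq_norm \<mu> q \<omega> g =
     (SUP \<xi>\<in>{0<..}. ennreal \<xi> * ennpowr (weighted_measure \<mu> \<omega> {z. g z > ennreal \<xi>}) (1 / q))"

definition bounded_Lq_weak_Lq ::
  "'a measure \<Rightarrow> real \<Rightarrow> ('a \<times> real \<Rightarrow> real) \<Rightarrow>
   (('a \<times> real \<Rightarrow> real) \<Rightarrow> 'a \<times> real \<Rightarrow> ennreal) \<Rightarrow> bool" where
  "bounded_Lq_weak_Lq \<mu> q \<omega> T \<longleftrightarrow>
     (\<exists>C::real. \<forall>f\<in>Lq_space \<mu> q \<omega>. weak_Lq_norm \<mu> q \<omega> (T f) \<le> ennreal C * Lq_norm \<mu> q \<omega> f)"

end

theory Submission
  imports Defs
begin

text \<open>
  Write \<open>\<sigma> = \<omega>\<^sup>1\<^sup>-\<^sup>q'\<close>. The \<open>A\<^sub>q\<^sup>+\<close> condition for one fixed time lag already gives a forward in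
  time doubling property of \<open>\<omega>\<close>, which can be iterated along chains of cylinders. As \<open>p > 1\<close>,
  a chain of many small cylinders following a monotone geodesic needs arbitrarily little time
  compared with the \<open>p\<close>-th power of the distance it covers, so any two small cylinders inside
  \<open>R\<^sup>-(\<gamma>)\<close> and \<open>R\<^sup>+(\<gamma>)\<close> can be joined; covering by small cylinders makes the condition
  independent of \<open>\<gamma>\<close>. Testing the weak type inequality on truncations of \<open>\<sigma>\<close> gives the
  fixed lag condition.

  Conversely, split the level set of the maximal function according to the average lying in
  \<open>(2\<^sup>n \<xi>, 2\<^sup>n\<^sup>+\<^sup>1 \<xi>]\<close> and treat each dyadic system on its own. A Vitali selection makes the
  rectangles disjoint around their centres, and the two-sided bound on the averages controls
  the overlap of their forward parts in \<open>L\<^sup>1(f)\<close>. The condition \<open>A\<^sub>q\<^sup>+\<close> and Hoelder's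
  inequality on the low-overlap cores, summed over \<open>n\<close>, give the weak type inequality.
\<close>

text \<open>The condition compares \<open>\<omega>\<close> only with later times, so every transfer
  of mass must move \<open>\<omega>\<close> forward; no comparison backward in time is available.
  This one-sidedness also breaks the usual Vitali argument for the maximal function: a point lies
  before the front of its rectangle, so disjoint slabs around the centres say nothing about the
  overlap of the fronts. A lower bound on the averages alone would not control the mass of small
  fronts by their volume. With the averages confined between \<open>\<xi>\<close> and
  \<open>2 * \<xi>\<close>, mass and volume of a front are interchangeable, and volume can be
  counted on the disjoint slabs.

  The level sets of the maximal function are not shown to be measurable. Only monotonicity of the
  integral is used for them: measurable subsets when the inequality is tested, measurable supersets
  when it is proved.

  The two averages are treated throughout as masses of the measures \<open>wm\<close> and
  \<open>sm\<close>, bounded by a power of a volume. Chaining and covering then become statements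
  about measures of sets.\<close>

lemma sigma_finite_lebesgue: "sigma_finite_measure (lebesgue :: real measure)"
proof
  let ?A = "(\<lambda>n::nat. {- real n .. real n}) ` UNIV"
  have U: "(\<Union>n::nat. {- real n .. real n}) = UNIV"
  proof (rule UNIV_eq_I[symmetric])
    fix x :: real
    obtain n :: nat where "\<bar>x\<bar> \<le> real n" using real_arch_simple by blast
    then show "x \<in> (\<Union>n::nat. {- real n .. real n})" by (intro UN_I[of n]) auto
  qed
  show "\<exists>A. countable A \<and> A \<subseteq> sets (lebesgue :: real measure) \<and>
      \<Union>A = space lebesgue \<and> (\<forall>a\<in>A. emeasure lebesgue a \<noteq> \<infinity>)"
    using U by (intro exI[of _ ?A]) auto
qed

text \<open>Continuity from below along an exhaustion of \<open>D\<close> by finite sets. It allows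
  the selection argument to be run on finite families only.\<close>

lemma emeasure_countable_UN_le:
  assumes D: "countable D" and A: "\<And>i. i \<in> D \<Longrightarrow> A i \<in> sets M"
    and le: "\<And>F. finite F \<Longrightarrow> F \<subseteq> D \<Longrightarrow> emeasure M (\<Union>i\<in>F. A i) \<le> B"
  shows "emeasure M (\<Union>i\<in>D. A i) \<le> B"
proof (cases "D = {}")
  case False
  define G where "G n = from_nat_into D ` {..n}" for n
  have G: "finite (G n)" "G n \<subseteq> D" for n
    using from_nat_into[OF False] by (auto simp: G_def)
  have DG: "D = (\<Union>n. G n)"
  proof
    show "D \<subseteq> (\<Union>n. G n)"
    proof
      fix i assume "i \<in> D"
      then have "i = from_nat_into D (to_nat_on D i)"
        using from_nat_into_to_nat_on[OF D] by simp
      then have "i \<in> G (to_nat_on D i)" unfolding G_def by (intro image_eqI) auto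
      then show "i \<in> (\<Union>n. G n)" by blast
    qed
  qed (use G(2) in auto)
  have inc: "incseq (\<lambda>n. \<Union>i\<in>G n. A i)"
    unfolding incseq_def G_def by (intro allI impI UN_mono image_mono) auto
  have "(\<Union>i\<in>D. A i) = (\<Union>n. \<Union>i\<in>G n. A i)"
    by (subst DG) blast
  also have "emeasure M \<dots> = (SUP n. emeasure M (\<Union>i\<in>G n. A i))"
    using G A by (intro SUP_emeasure_incseq[symmetric] inc)
      (auto intro!: sets.finite_UN)
  also have "\<dots> \<le> B"
    using G by (intro SUP_least le)
  finally show ?thesis .
qed auto

text \<open>Greedy choice: keep an element of least \<open>size\<close>, discard everything that
  meets it, recurse on the rest. \<open>size\<close> will be the dyadic generation, so least size
  means largest cube. Empty sets are exempt because they meet nothing.\<close>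

lemma finite_vitali_selection:
  fixes size :: "'b \<Rightarrow> int"
  assumes "finite F"
  shows "\<exists>G\<subseteq>F. (\<forall>i\<in>G. \<forall>j\<in>G. i \<noteq> j \<longrightarrow> S i \<inter> S j = {}) \<and>
           (\<forall>i\<in>F. S i \<noteq> {} \<longrightarrow> (\<exists>j\<in>G. S i \<inter> S j \<noteq> {} \<and> size j \<le> size i))"
  using assms
proof (induction "card F" arbitrary: F rule: less_induct)
  case less
  show ?case
  proof (cases "F = {}")
    case False
    then obtain m where m: "m \<in> F" "\<And>i. i \<in> F \<Longrightarrow> size m \<le> size i"
      using less.prems ex_min_if_finite[of "size ` F"]
      by (metis arg_min_if_finite(1) arg_min_least)
    define F' where "F' = {i \<in> F. i \<noteq> m \<and> S i \<inter> S m = {}}"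
    have "F' \<subseteq> F - {m}" by (auto simp: F'_def)
    then have "card F' < card F" "finite F'"
      using less.prems m(1) by (auto intro!: psubset_card_mono finite_subset[OF _ less.prems])
    from less.hyps[OF this] obtain G where G: "G \<subseteq> F'"
      "\<forall>i\<in>G. \<forall>j\<in>G. i \<noteq> j \<longrightarrow> S i \<inter> S j = {}"
      "\<forall>i\<in>F'. S i \<noteq> {} \<longrightarrow> (\<exists>j\<in>G. S i \<inter> S j \<noteq> {} \<and> size j \<le> size i)" by blast
    show ?thesis
    proof (intro exI[of _ "insert m G"] conjI)
      show "insert m G \<subseteq> F" using G(1) m(1) by (auto simp: F'_def)
      show "\<forall>i\<in>insert m G. \<forall>j\<in>insert m G. i \<noteq> j \<longrightarrow> S i \<inter> S j = {}"
        using G(1,2) by (auto simp: F'_def)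
      show "\<forall>i\<in>F. S i \<noteq> {} \<longrightarrow> (\<exists>j\<in>insert m G. S i \<inter> S j \<noteq> {} \<and> size j \<le> size i)"
      proof (intro ballI impI)
        fix i assume i: "i \<in> F" "S i \<noteq> {}"
        show "\<exists>j\<in>insert m G. S i \<inter> S j \<noteq> {} \<and> size j \<le> size i"
        proof (cases "i \<in> F'")
          case True
          then show ?thesis using G(3) i(2) by blast
        next
          case False
          then have "S i \<inter> S m \<noteq> {}" using i by (auto simp: F'_def)
          then show ?thesis using m(2)[OF i(1)] by auto
        qed
      qed
    qed
  qed auto
qed

section \<open>Powers, quotients and the pointwise duality inequality\<close>

lemma ennpowr_ennreal: "0 \<le> x \<Longrightarrow> ennpowr (ennreal x) a = ennreal (x powr a)"
  by (simp add: ennpowr_def)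

lemma ennpowr_mono: "x \<le> y \<Longrightarrow> 0 \<le> a \<Longrightarrow> ennpowr x a \<le> ennpowr y a"
  unfolding ennpowr_def
  by (auto simp: top_unique less_top intro!: ennreal_leI powr_mono2 enn2real_mono)

text \<open>
  Wherever \<open>g > T \<sigma>\<close> one has \<open>g \<le> T\<^sup>1\<^sup>-\<^sup>q g\<^sup>q \<omega>\<close>; splitting there and optimising \<open>T\<close> gives
  Hoelder's inequality up to a factor.
\<close>

lemma weighted_split:
  fixes g w T q :: real
  assumes "0 \<le> g" "0 < w" "0 < T" "1 < q"
  shows "g \<le> T * w powr (1 - conj_exponent q) + T powr (1 - q) * (g powr q * w)"
proof (cases "g \<le> T * w powr (1 - conj_exponent q)")
  case True
  then show ?thesis using assms by (simp add: add_increasing2)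
next
  case False
  let ?s = "w powr (1 - conj_exponent q)"
  have s: "?s > 0" using assms by simp
  \<comment> \<open>The duality behind everything: the \<open>(q - 1)\<close>-th power of
    \<open>\<sigma>\<close> is \<open>1 / \<omega>\<close>.\<close>
  have e: "(1 - conj_exponent q) * (q - 1) = -1"
    using assms by (simp add: conj_exponent_def field_simps)
  have g: "g > 0" using False s assms by (smt (verit) mult_pos_pos)
  have "(T * ?s) powr (q - 1) \<le> g powr (q - 1)"
    using False s assms by (intro powr_mono2) auto
  moreover have "(T * ?s) powr (q - 1) = T powr (q - 1) * w powr (-1)"
    using assms by (simp add: powr_mult powr_powr e)
  ultimately have "T powr (q - 1) \<le> g powr (q - 1) * w"
    using assms by (simp add: powr_minus field_simps)
  then have "T powr (1 - q) * T powr (q - 1) \<le> T powr (1 - q) * (g powr (q - 1) * w)"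
    by (intro mult_left_mono) auto
  moreover have "T powr (1 - q) * T powr (q - 1) = 1"
    using assms by (simp flip: powr_add)
  ultimately have "g * 1 \<le> g * (T powr (1 - q) * (g powr (q - 1) * w))"
    using g by (intro mult_left_mono) auto
  also have "\<dots> = T powr (1 - q) * (g powr q * w)"
    using g by (simp add: powr_diff field_simps)
  finally show ?thesis using s assms by (simp add: add_increasing)
qed

text \<open>Positivity of \<open>A\<close> and \<open>S\<close> excludes
  \<open>0 * \<infinity>\<close>, so a finite product forces both factors to be finite. What remains
  is counting powers of \<open>m\<close>: one from the first average, \<open>q - 1\<close> from the
  second.\<close>

lemma avg_product_le_iff:
  assumes "0 < m" "0 < A" "0 < S" "0 \<le> C" "1 < q"
  shows "(A / ennreal m) * ennpowr (S / ennreal m) (q - 1) \<le> ennreal C \<longleftrightarrow>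
    A < \<infinity> \<and> S < \<infinity> \<and> enn2real A * enn2real S powr (q - 1) \<le> C * m powr q"
proof (cases A)
  case A: (real a)
  then have a: "0 < a" using assms by auto
  show ?thesis
  proof (cases S)
    case S: (real s)
    then have s: "0 < s" using assms by auto
    have "(A / ennreal m) * ennpowr (S / ennreal m) (q - 1) = ennreal (a / m * (s / m) powr (q - 1))"
      using a s assms by (simp add: A S divide_ennreal ennpowr_ennreal flip: ennreal_mult')
    moreover have "a / m * (s / m) powr (q - 1) = a * s powr (q - 1) / m powr q"
      using a s assms by (simp add: powr_divide powr_diff)
    ultimately have "(A / ennreal m) * ennpowr (S / ennreal m) (q - 1) = ennreal (a * s powr (q - 1) / m powr q)"
      by (simp only:)
    then show ?thesis using a s assms by (simp add: A S pos_divide_le_eq)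
  next
    case top
    have "S / ennreal m = \<infinity>" using assms top by (simp add: ennreal_top_divide)
    moreover have "A / ennreal m \<noteq> 0" using a assms by (simp add: A divide_ennreal)
    ultimately show ?thesis using top by (simp add: ennpowr_def ennreal_mult_top top_unique)
  qed
next
  case top
  have "A / ennreal m = \<infinity>" using assms top by (simp add: ennreal_top_divide)
  moreover have "ennpowr (S / ennreal m) (q - 1) \<noteq> 0"
  proof (cases S)
    case (real s)
    then show ?thesis using assms by (simp add: divide_ennreal ennpowr_ennreal)
  next
    case top
    then show ?thesis using assms by (simp add: ennreal_top_divide ennpowr_def)
  qed
  ultimately show ?thesis using top by (simp add: ennreal_top_mult top_unique)
qed

lemma divide_left_mono_ennreal: "b \<le> a \<Longrightarrow> c / a \<le> c / b" for a b c :: ennreal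
proof -
  assume "b \<le> a"
  then have "inverse a \<le> inverse b"
  proof (cases a; cases b)
    fix r s assume "a = ennreal r" "0 \<le> r" "b = ennreal s" "0 \<le> s"
    with \<open>b \<le> a\<close> show ?thesis by (cases "s = 0") (auto simp: inverse_ennreal intro!: ennreal_leI)
  qed (auto simp: top_unique)
  then show ?thesis by (simp add: divide_ennreal_def mult_left_mono)
qed

subsection \<open>Doubling and coverings by boxes\<close>

locale parabolic_weight =
  fixes \<rho> :: "'a \<Rightarrow> 'a \<Rightarrow> real" and K0 :: real and \<mu> :: "'a measure"
    and p q :: real and \<omega> :: "'a \<times> real \<Rightarrow> real"
  assumes homogeneous: "homogeneous_type \<rho> K0 \<mu>"
    and basic: "basic_assumptions \<rho> \<mu>"
    and geodesic: "monotone_geodesic \<rho>"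
    and p_gt_1: "1 < p" and q_gt_1: "1 < q"
    and weight: "weight \<rho> \<mu> p \<omega>"
begin

abbreviation "\<B> \<equiv> qball \<rho>"
abbreviation "lam \<equiv> par_measure \<mu>"

definition sig :: "'a \<times> real \<Rightarrow> real" where
  "sig z = \<omega> z powr (1 - conj_exponent q)"

definition wm :: "('a \<times> real) measure" where
  "wm = density lam (\<lambda>z. ennreal (\<omega> z))"

definition sm :: "('a \<times> real) measure" where
  "sm = density lam (\<lambda>z. ennreal (sig z))"

definition box :: "'a \<Rightarrow> real \<Rightarrow> real \<Rightarrow> real \<Rightarrow> ('a \<times> real) set" where
  "box x r a h = \<B> x r \<times> {a - h<..<a + h}"

text \<open>Half the measure of a cylinder of radius \<open>l\<close>; the factor is absorbed in
  constants.\<close>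

definition vol :: "'a \<Rightarrow> real \<Rightarrow> real" where
  "vol x l = measure \<mu> (\<B> x l) * l powr p"

lemma K0: "1 \<le> K0"
  and rho_refl [simp]: "\<rho> x x = 0"
  and rho_sym: "\<rho> x y = \<rho> y x"
  and rho_tri: "\<rho> x y \<le> K0 * (\<rho> x z + \<rho> z y)"
  using homogeneous unfolding homogeneous_type_def quasi_metric_def by auto

lemma space_mu [simp]: "space \<mu> = UNIV"
  and ball_sets [measurable]: "0 < r \<Longrightarrow> \<B> x r \<in> sets \<mu>"
  using homogeneous unfolding homogeneous_type_def by auto

lemma emeasure_ball_pos: "0 < r \<Longrightarrow> 0 < emeasure \<mu> (\<B> x r)"
  and emeasure_ball_finite: "0 < r \<Longrightarrow> emeasure \<mu> (\<B> x r) < \<infinity>"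
  and qdiam_UNIV: "qdiam \<rho> UNIV = \<infinity>"
  using basic unfolding basic_assumptions_def by auto

lemma emeasure_ball: "0 < r \<Longrightarrow> emeasure \<mu> (\<B> x r) = ennreal (measure \<mu> (\<B> x r))"
  using emeasure_ball_finite[of r x] by (intro emeasure_eq_ennreal_measure) auto

lemma measure_ball_pos: "0 < r \<Longrightarrow> 0 < measure \<mu> (\<B> x r)"
  using emeasure_ball_pos[of r x] emeasure_ball[of r x] by auto

lemma vol_pos: "0 < l \<Longrightarrow> 0 < vol x l"
  unfolding vol_def using measure_ball_pos by simp

lemma mem_ball: "y \<in> \<B> x r \<longleftrightarrow> \<rho> x y < r"
  by (simp add: qball_def)

lemma ball_subset: "K0 * (\<rho> x y + s) \<le> r \<Longrightarrow> \<B> y s \<subseteq> \<B> x r"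
proof
  fix z assume r: "K0 * (\<rho> x y + s) \<le> r" and z: "z \<in> \<B> y s"
  have "\<rho> x z \<le> K0 * (\<rho> x y + \<rho> y z)" by (rule rho_tri)
  also have "\<dots> < K0 * (\<rho> x y + s)" using z K0 by (simp add: mem_ball)
  finally show "z \<in> \<B> x r" using r by (simp add: mem_ball)
qed

lemma rho_in_ball: "y \<in> \<B> x l \<Longrightarrow> z \<in> \<B> x l \<Longrightarrow> \<rho> y z < 2 * K0 * l"
proof -
  assume "y \<in> \<B> x l" "z \<in> \<B> x l"
  then have "K0 * (\<rho> y x + \<rho> x z) < K0 * (l + l)"
    using K0 rho_sym[of x y] by (auto simp: mem_ball)
  then show ?thesis using rho_tri[of y z x] by (simp add: algebra_simps)
qed

lemma ball_mono: "r \<le> s \<Longrightarrow> \<B> x r \<subseteq> \<B> x s"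
  by (auto simp: mem_ball)

lemma measure_ball_mono:
  "\<B> x r \<subseteq> \<B> y s \<Longrightarrow> 0 < r \<Longrightarrow> 0 < s \<Longrightarrow> measure \<mu> (\<B> x r) \<le> measure \<mu> (\<B> y s)"
  using emeasure_ball_finite by (intro measure_mono_fmeasurable) (auto simp: fmeasurable_def)

text \<open>The ball around \<open>y\<close> lies in the ball of radius
  \<open>2 * K0 * \<kappa> * r\<close> around \<open>x\<close>, and finitely many doublings reach
  that radius.\<close>

lemma doubling_general:
  "\<exists>C>0. \<forall>x y r s. 0 < r \<longrightarrow> 0 < s \<longrightarrow> s \<le> \<kappa> * r \<longrightarrow> \<rho> x y \<le> \<kappa> * r \<longrightarrow>
     measure \<mu> (\<B> y s) \<le> C * measure \<mu> (\<B> x r)"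
proof -
  obtain C :: real where
    C: "\<And>x r. 0 < r \<Longrightarrow> emeasure \<mu> (\<B> x (2 * r)) \<le> ennreal C * emeasure \<mu> (\<B> x r)"
    using homogeneous unfolding homogeneous_type_def by auto
  define D where "D = max C 1"
  have D: "measure \<mu> (\<B> x (2 * r)) \<le> D * measure \<mu> (\<B> x r)" if "0 < r" for x r
  proof -
    have "ennreal (measure \<mu> (\<B> x (2 * r))) \<le> ennreal C * ennreal (measure \<mu> (\<B> x r))"
      using C[OF that, of x] emeasure_ball that by simp
    also have "\<dots> \<le> ennreal (D * measure \<mu> (\<B> x r))"
      by (auto simp: D_def ennreal_mult' intro!: mult_right_mono ennreal_leI)
    finally show ?thesis
      by (subst (asm) ennreal_le_iff) (simp_all add: D_def)
  qed
  have Dn: "measure \<mu> (\<B> x (2 ^ n * r)) \<le> D ^ n * measure \<mu> (\<B> x r)" if "0 < r" for x r n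
  proof (induction n)
    case (Suc n)
    have "measure \<mu> (\<B> x (2 * (2 ^ n * r))) \<le> D * measure \<mu> (\<B> x (2 ^ n * r))"
      using that by (intro D) auto
    also have "\<dots> \<le> D * (D ^ n * measure \<mu> (\<B> x r))"
      using Suc by (intro mult_left_mono) (auto simp: D_def)
    finally show ?case by (simp add: mult.assoc)
  qed auto
  obtain n :: nat where n: "2 * K0 * \<kappa> < 2 ^ n"
    using real_arch_pow[of 2 "2 * K0 * \<kappa>"] by auto
  show ?thesis
  proof (intro exI[of _ "D ^ n"] conjI allI impI)
    show "0 < D ^ n" by (simp add: D_def)
    fix x y r s assume a: "0 < r" "0 < s" "s \<le> \<kappa> * r" "\<rho> x y \<le> \<kappa> * r"
    have "K0 * (\<rho> x y + s) \<le> K0 * (\<kappa> * r + \<kappa> * r)"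
      using a K0 by (intro mult_left_mono) auto
    also have "\<dots> = (2 * K0 * \<kappa>) * r" by (simp add: algebra_simps)
    also have "\<dots> \<le> 2 ^ n * r" using n a by (intro mult_right_mono) auto
    finally have "measure \<mu> (\<B> y s) \<le> measure \<mu> (\<B> x (2 ^ n * r))"
      using a by (intro measure_ball_mono ball_subset) auto
    also have "\<dots> \<le> D ^ n * measure \<mu> (\<B> x r)" using Dn a by blast
    finally show "measure \<mu> (\<B> y s) \<le> D ^ n * measure \<mu> (\<B> x r)" .
  qed
qed

text \<open>Volume count: small balls around the separated points are disjoint, lie in one ball
  comparable to \<open>\<B> x l\<close>, and by doubling each carries a fixed fraction of its
  measure.\<close>

lemma packing:
  assumes "0 < \<kappa>"
  shows "\<exists>M::nat. \<forall>x l F. 0 < l \<longrightarrow> finite F \<longrightarrow> F \<subseteq> \<B> x l \<longrightarrow>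
     (\<forall>y\<in>F. \<forall>z\<in>F. y \<noteq> z \<longrightarrow> \<kappa> * l \<le> \<rho> y z) \<longrightarrow> card F \<le> M"
proof -
  \<comment> \<open>A common point of two balls of radius \<open>e * l\<close> would put their
    centres closer than \<open>2 * K0 * e * l = \<kappa> * l\<close>.\<close>
  define e where "e = \<kappa> / (2 * K0)"
  define R where "R = K0 * (1 + e)"
  have e: "e > 0" using assms K0 by (simp add: e_def)
  have R: "R > 0" using K0 e by (simp add: R_def)
  obtain C where C: "C > 0" "\<And>x y r s. 0 < r \<Longrightarrow> 0 < s \<Longrightarrow> s \<le> max (R / e) (1 / e) * r \<Longrightarrow>
      \<rho> x y \<le> max (R / e) (1 / e) * r \<Longrightarrow> measure \<mu> (\<B> y s) \<le> C * measure \<mu> (\<B> x r)"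
    using doubling_general[of "max (R / e) (1 / e)"] by blast
  show ?thesis
  proof (intro exI[of _ "nat \<lceil>C\<rceil>"] allI impI)
    fix x l F
    assume l: "0 < l" and F: "finite F" "F \<subseteq> \<B> x l"
      and sep: "\<forall>y\<in>F. \<forall>z\<in>F. y \<noteq> z \<longrightarrow> \<kappa> * l \<le> \<rho> y z"
    have disj: "disjoint_family_on (\<lambda>y. \<B> y (e * l)) F"
      unfolding disjoint_family_on_def
    proof (intro ballI impI equals0I)
      fix y z w assume yz: "y \<in> F" "z \<in> F" "y \<noteq> z" and w: "w \<in> \<B> y (e * l) \<inter> \<B> z (e * l)"
      have "\<rho> y z < K0 * (e * l + e * l)"
        using rho_tri[of y z w] w K0 rho_sym[of z w] mem_ball
        by (smt (verit) IntE mult_less_cancel_left_pos)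
      also have "\<dots> = \<kappa> * l" using K0 by (simp add: e_def field_simps)
      finally show False using sep yz by force
    qed
    have sub: "\<B> y (e * l) \<subseteq> \<B> x (R * l)" if "y \<in> F" for y
    proof (rule ball_subset)
      have "K0 * (\<rho> x y + e * l) \<le> K0 * (l + e * l)"
        using that F K0 by (intro mult_left_mono) (auto simp: mem_ball subset_iff less_imp_le)
      then show "K0 * (\<rho> x y + e * l) \<le> R * l" by (simp add: R_def algebra_simps)
    qed
    have lower: "measure \<mu> (\<B> x (R * l)) \<le> C * measure \<mu> (\<B> y (e * l))" if "y \<in> F" for y
    proof (rule C(2))
      have "\<rho> y x \<le> 1 / e * (e * l)"
        using that F e rho_sym[of x y] by (auto simp: mem_ball subset_iff less_imp_le)
      also have "\<dots> \<le> max (R / e) (1 / e) * (e * l)"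
        using e l by (intro mult_right_mono) auto
      finally show "\<rho> y x \<le> max (R / e) (1 / e) * (e * l)" .
      have "R * l = R / e * (e * l)" using e by simp
      also have "\<dots> \<le> max (R / e) (1 / e) * (e * l)"
        using e l by (intro mult_right_mono) auto
      finally show "R * l \<le> max (R / e) (1 / e) * (e * l)" .
    qed (use e l R in auto)
    have pos: "0 < measure \<mu> (\<B> x (R * l))" using R l by (intro measure_ball_pos) auto
    have "real (card F) * measure \<mu> (\<B> x (R * l)) = (\<Sum>y\<in>F. measure \<mu> (\<B> x (R * l)))" by simp
    also have "\<dots> \<le> (\<Sum>y\<in>F. C * measure \<mu> (\<B> y (e * l)))" by (intro sum_mono lower)
    also have "\<dots> = C * (\<Sum>y\<in>F. measure \<mu> (\<B> y (e * l)))" by (simp add: sum_distrib_left)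
    also have "(\<Sum>y\<in>F. measure \<mu> (\<B> y (e * l))) = measure \<mu> (\<Union>y\<in>F. \<B> y (e * l))"
      using F disj e l emeasure_ball_finite
      by (intro measure_finite_Union[symmetric]) (auto simp: less_top[symmetric])
    also have "C * \<dots> \<le> C * measure \<mu> (\<B> x (R * l))"
      using C(1) sub F e l R emeasure_ball_finite
      by (intro mult_left_mono measure_mono_fmeasurable)
        (auto simp: fmeasurable_def intro!: sets.finite_UN)
    finally have "real (card F) \<le> C" using pos by simp
    then show "card F \<le> nat \<lceil>C\<rceil>" by linarith
  qed
qed

text \<open>A separated set of greatest cardinality, which exists by \<open>packing\<close>, is a
  net: an uncovered point could be added to it.\<close>

lemma ball_cover:
  assumes "0 < \<kappa>"
  shows "\<exists>M::nat. \<forall>x l. 0 < l \<longrightarrow> (\<exists>F. finite F \<and> card F \<le> M \<and> F \<subseteq> \<B> x l \<and>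
           \<B> x l \<subseteq> (\<Union>y\<in>F. \<B> y (\<kappa> * l)))"
proof -
  from packing[OF assms] obtain M :: nat where "\<forall>x l F. 0 < l \<longrightarrow> finite F \<longrightarrow> F \<subseteq> \<B> x l \<longrightarrow>
     (\<forall>y\<in>F. \<forall>z\<in>F. y \<noteq> z \<longrightarrow> \<kappa> * l \<le> \<rho> y z) \<longrightarrow> card F \<le> M" ..
  note M = this[rule_format]
  show ?thesis
  proof (intro exI[of _ M] allI impI)
    fix x l assume l: "(0::real) < l"
    define P where "P F \<longleftrightarrow> finite F \<and> F \<subseteq> \<B> x l \<and> (\<forall>y\<in>F. \<forall>z\<in>F. y \<noteq> z \<longrightarrow> \<kappa> * l \<le> \<rho> y z)"
      for F
    have le_M: "card F \<le> M" if "P F" for F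
      using that unfolding P_def by (intro M[OF l]) auto
    have "P {}" by (simp add: P_def)
    then have "\<exists>F. P F \<and> (\<forall>G. P G \<longrightarrow> card G \<le> card F)"
      using le_M by (intro ex_has_greatest_nat[of P "{}" card "Suc M"]) (auto simp: less_Suc_eq_le)
    then obtain F where P: "P F" and max: "\<And>G. P G \<Longrightarrow> card G \<le> card F" by auto
    note F = P[unfolded P_def]
    have "\<B> x l \<subseteq> (\<Union>y\<in>F. \<B> y (\<kappa> * l))"
    proof (rule ccontr)
      assume "\<not> ?thesis"
      then obtain w where w: "w \<in> \<B> x l" "\<And>y. y \<in> F \<Longrightarrow> \<kappa> * l \<le> \<rho> y w"
        by (auto simp: mem_ball not_less subset_iff Bex_def)
      have "w \<notin> F" using w(2)[of w] mult_pos_pos[OF assms l] by auto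
      moreover have "P (insert w F)"
        using F w rho_sym by (auto simp: P_def)
      then have "card (insert w F) \<le> card F" by (rule max)
      ultimately show False using F by simp
    qed
    then show "\<exists>F. finite F \<and> card F \<le> M \<and> F \<subseteq> \<B> x l \<and> \<B> x l \<subseteq> (\<Union>y\<in>F. \<B> y (\<kappa> * l))"
      using F le_M[OF P] by (intro exI[of _ F] conjI) auto
  qed
qed

section \<open>Boxes in space-time\<close>

lemma space_lam [simp]: "space lam = UNIV"
  by (simp add: par_measure_def space_pair_measure)

lemma times_sets [measurable]: "A \<in> sets \<mu> \<Longrightarrow> A \<times> {a<..<b::real} \<in> sets lam"
  unfolding par_measure_def by (intro pair_measureI) auto

lemma emeasure_times:
  assumes "A \<in> sets \<mu>" "a \<le> b"
  shows "emeasure lam (A \<times> {a<..<b}) = emeasure \<mu> A * ennreal (b - a)"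
proof -
  interpret sigma_finite_measure "lebesgue :: real measure" by (rule sigma_finite_lebesgue)
  show ?thesis
    unfolding par_measure_def using assms by (subst emeasure_pair_measure_Times) auto
qed

lemma measure_times:
  assumes "A \<in> sets \<mu>" "a \<le> b"
  shows "measure lam (A \<times> {a<..<b}) = measure \<mu> A * (b - a)"
  using emeasure_times[OF assms] assms by (simp add: measure_def enn2real_mult)

lemma box_sets [measurable]: "0 < r \<Longrightarrow> box x r a h \<in> sets lam"
  unfolding box_def by measurable

lemma measure_box: "0 < r \<Longrightarrow> 0 < h \<Longrightarrow> measure lam (box x r a h) = measure \<mu> (\<B> x r) * (2 * h)"
  unfolding box_def by (subst measure_times) auto

lemma emeasure_box:
  "0 < r \<Longrightarrow> 0 < h \<Longrightarrow> emeasure lam (box x r a h) = ennreal (measure \<mu> (\<B> x r) * (2 * h))"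
  unfolding box_def by (subst emeasure_times) (auto simp: emeasure_ball ennreal_mult')

lemma box_mono: "\<B> x r \<subseteq> \<B> y s \<Longrightarrow> b - k \<le> a - h \<Longrightarrow> a + h \<le> b + k \<Longrightarrow> box x r a h \<subseteq> box y s b k"
  unfolding box_def by (intro Sigma_mono) auto

text \<open>A bounded number of small boxes covers the given box, so one of them carries a fixed
  fraction of its mass. \<open>\<nu>\<close> is arbitrary because this is needed for
  \<open>wm\<close> and for \<open>sm\<close>; the position of the new centre is recorded in order
  to control time lags later.\<close>

lemma box_pigeonhole:
  assumes "0 < \<kappa>" "0 < \<eta>"
  shows "\<exists>M>0. \<forall>\<nu> x l a h. sets \<nu> = sets lam \<longrightarrow> 0 < l \<longrightarrow> 0 < h \<longrightarrow> h \<le> l powr p \<longrightarrow>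
     (\<exists>y b. y \<in> \<B> x l \<and> \<bar>b - a\<bar> < h \<and>
        emeasure \<nu> (box x l a h) \<le> ennreal M * emeasure \<nu> (box y (\<kappa> * l) b (\<eta> * l powr p)))"
proof -
  from ball_cover[OF assms(1)] obtain M :: nat where "\<forall>x l. 0 < l \<longrightarrow>
     (\<exists>F. finite F \<and> card F \<le> M \<and> F \<subseteq> \<B> x l \<and> \<B> x l \<subseteq> (\<Union>y\<in>F. \<B> y (\<kappa> * l)))" ..
  note M = this[rule_format]
  \<comment> \<open>The time interval is cut into \<open>n\<close> cells of half-length
    \<open>h / n\<close>, which this choice makes smaller than
    \<open>\<eta> * l powr p\<close>.\<close>
  obtain n :: nat where n: "1 / \<eta> < real n" using reals_Archimedean2 by blast
  have n0: "n > 0" using n assms by (metis divide_pos_pos gr0I less_trans of_nat_0 zero_less_one order_less_irrefl)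
  show ?thesis
  proof (intro exI[of _ "real (Suc M * n)"] conjI allI impI)
    show "0 < real (Suc M * n)" using n0 by (simp only: of_nat_0_less_iff) simp
    fix \<nu> :: "('a \<times> real) measure" and x l a h
    assume sets: "sets \<nu> = sets lam" and l: "0 < l" and h: "0 < h" "h \<le> l powr p"
    obtain F where F: "finite F" "card F \<le> M" "F \<subseteq> \<B> x l" "\<B> x l \<subseteq> (\<Union>y\<in>F. \<B> y (\<kappa> * l))"
      using M[OF l, of x] by (elim exE conjE) (rule that)
    \<comment> \<open>The midpoint of the \<open>i\<close>-th time cell, counted from 0.\<close>
    define c where "c i = a - h + (2 * real i + 1) * (h / real n)" for i :: nat
    let ?b = "\<lambda>u. box (fst u) (\<kappa> * l) (c (snd u)) (\<eta> * l powr p)"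
    have hn: "h / real n < \<eta> * l powr p"
    proof -
      have "h / real n \<le> l powr p / real n" using h by (simp add: divide_right_mono)
      also have "\<dots> < \<eta> * l powr p" using n n0 l assms by (simp add: field_simps)
      finally show ?thesis .
    qed
    have cov: "box x l a h \<subseteq> (\<Union>u\<in>F \<times> {..<n}. ?b u)"
    proof
      fix z assume z: "z \<in> box x l a h"
      obtain w s where ws: "z = (w, s)" by (cases z)
      have w: "w \<in> \<B> x l" and s: "a - h < s" "s < a + h" using z ws by (auto simp: box_def)
      obtain y where y: "y \<in> F" "w \<in> \<B> y (\<kappa> * l)" using F w by auto
      define v where "v = (s - (a - h)) / (2 * (h / real n))"
      have v: "0 \<le> v" "v < real n" using s h n0
        by (auto simp: v_def pos_divide_less_eq zero_le_divide_iff)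
      define i where "i = nat \<lfloor>v\<rfloor>"
      have i: "real i \<le> v" "v < real i + 1" using v unfolding i_def by linarith+
      have "i < n" using i v by linarith
      have sv: "s = a - h + v * (2 * (h / real n))" using h n0 by (simp add: v_def)
      have "\<bar>v * 2 - (2 * real i + 1)\<bar> \<le> 1" using i by linarith
      then have "\<bar>v * 2 - (2 * real i + 1)\<bar> * (h / real n) \<le> 1 * (h / real n)"
        using h by (intro mult_right_mono) auto
      moreover have "\<bar>s - c i\<bar> = \<bar>(v * 2 - (2 * real i + 1)) * (h / real n)\<bar>"
        unfolding sv c_def by (rule arg_cong[of _ _ abs]) (simp add: algebra_simps)
      ultimately have "\<bar>s - c i\<bar> \<le> h / real n" using h by (simp add: abs_mult)
      then have "\<bar>s - c i\<bar> < \<eta> * l powr p" using hn by linarith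
      then have "z \<in> ?b (y, i)" using y unfolding ws by (auto simp: box_def)
      then show "z \<in> (\<Union>u\<in>F \<times> {..<n}. ?b u)" using y \<open>i < n\<close> by blast
    qed
    have bs: "?b u \<in> sets \<nu>" for u using assms l by (simp add: sets box_sets)
    have ne: "F \<times> {..<n} \<noteq> {}"
    proof -
      have "x \<in> \<B> x l" using l by (simp add: mem_ball)
      then show ?thesis using F n0 by auto
    qed
    obtain u where u: "u \<in> F \<times> {..<n}"
      "\<And>v. v \<in> F \<times> {..<n} \<Longrightarrow> emeasure \<nu> (?b v) \<le> emeasure \<nu> (?b u)"
    proof -
      have fin: "finite ((\<lambda>u. emeasure \<nu> (?b u)) ` (F \<times> {..<n}))" using F by auto
      have "Max ((\<lambda>u. emeasure \<nu> (?b u)) ` (F \<times> {..<n})) \<in> (\<lambda>u. emeasure \<nu> (?b u)) ` (F \<times> {..<n})"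
        using fin ne by (intro Max_in) auto
      then show ?thesis using that Max_ge[OF fin] by (smt (verit) imageE imageI)
    qed
    have "emeasure \<nu> (box x l a h) \<le> emeasure \<nu> (\<Union>u\<in>F \<times> {..<n}. ?b u)"
      using cov bs F by (intro emeasure_mono sets.finite_UN) auto
    also have "\<dots> \<le> (\<Sum>u\<in>F \<times> {..<n}. emeasure \<nu> (?b u))"
      using F bs by (intro emeasure_subadditive_finite) auto
    also have "\<dots> \<le> (\<Sum>v\<in>F \<times> {..<n}. emeasure \<nu> (?b u))" by (intro sum_mono u)
    also have "\<dots> = of_nat (card F * n) * emeasure \<nu> (?b u)" by (simp add: card_cartesian_product)
    also have "\<dots> \<le> of_nat (Suc M * n) * emeasure \<nu> (?b u)"
      using F by (intro mult_right_mono of_nat_mono mult_le_mono1) auto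
    also have "(of_nat (Suc M * n) :: ennreal) = ennreal (real (Suc M * n))"
      by (rule ennreal_of_nat_eq_real_of_nat)
    finally have *: "emeasure \<nu> (box x l a h) \<le> ennreal (real (Suc M * n)) * emeasure \<nu> (?b u)" .
    have "\<bar>c (snd u) - a\<bar> < h"
    proof -
      have i: "real (snd u) + 1 \<le> real n" using u(1) by (cases u) auto
      have "\<bar>2 * real (snd u) + 1 - real n\<bar> < real n" using i n0 by auto
      then have "\<bar>2 * real (snd u) + 1 - real n\<bar> * (h / real n) < real n * (h / real n)"
        using h n0 by (intro mult_strict_right_mono) auto
      moreover have "\<bar>c (snd u) - a\<bar> = \<bar>(2 * real (snd u) + 1 - real n) * (h / real n)\<bar>"
        unfolding c_def using n0 by (intro arg_cong[of _ _ abs]) (simp add: field_simps)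
      ultimately show ?thesis using h n0 by (simp add: abs_mult)
    qed
    then show "\<exists>y b. y \<in> \<B> x l \<and> \<bar>b - a\<bar> < h \<and> emeasure \<nu> (box x l a h)
        \<le> ennreal (real (Suc M * n)) * emeasure \<nu> (box y (\<kappa> * l) b (\<eta> * l powr p))"
      using * u(1) F by (intro exI[of _ "fst u"] exI[of _ "c (snd u)"]) auto
  qed
qed

subsection \<open>The Muckenhoupt condition\<close>

lemma omega_measurable [measurable]: "\<omega> \<in> borel_measurable lam"
  and omega_pos: "AE z in lam. 0 < \<omega> z"
  using weight by (auto simp: weight_def)

lemma sig_measurable [measurable]: "sig \<in> borel_measurable lam"
  unfolding sig_def by measurable

lemma sig_nonneg: "0 \<le> sig z"
  by (simp add: sig_def)

lemma sig_pos: "AE z in lam. 0 < sig z"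
  using omega_pos by eventually_elim (simp add: sig_def)

lemma sets_wm [simp, measurable_cong]: "sets wm = sets lam"
  and sets_sm [simp, measurable_cong]: "sets sm = sets lam"
  by (simp_all add: wm_def sm_def)

lemma density_pos:
  assumes f: "f \<in> borel_measurable lam" "AE z in lam. 0 < f z"
    and E: "E \<in> sets lam" "0 < emeasure lam E"
  shows "0 < emeasure (density lam (\<lambda>z. ennreal (f z))) E"
proof (rule ccontr)
  assume "\<not> ?thesis"
  then have "E \<in> null_sets (density lam (\<lambda>z. ennreal (f z)))" using E by (auto simp: null_sets_def)
  then have "AE z in lam. z \<in> E \<longrightarrow> ennreal (f z) = 0"
    using f by (subst (asm) null_sets_density_iff) auto
  with f(2) have "AE z in lam. z \<notin> E" by eventually_elim auto
  then have "emeasure lam E = 0"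
    using E by (subst (asm) AE_iff_measurable[OF E(1)]) auto
  then show False using E by simp
qed

lemmas wm_pos = density_pos[OF omega_measurable omega_pos, folded wm_def]
lemmas sm_pos = density_pos[OF sig_measurable sig_pos, folded sm_def]

lemma emeasure_wm: "E \<in> sets lam \<Longrightarrow> emeasure wm E = (\<integral>\<^sup>+z\<in>E. ennreal (\<omega> z) \<partial>lam)"
  and emeasure_sm: "E \<in> sets lam \<Longrightarrow> emeasure sm E = (\<integral>\<^sup>+z\<in>E. ennreal (sig z) \<partial>lam)"
  by (simp_all add: wm_def sm_def emeasure_density)

text \<open>Integrating \<open>weighted_split\<close> over \<open>F\<close> leaves a free parameter
  \<open>T\<close>. Choosing it well gives Hoelder's inequality, with the harmless factor
  \<open>2 powr q\<close> as the price.\<close>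

lemma hoelder:
  fixes g :: "'a \<times> real \<Rightarrow> real"
  assumes g [measurable]: "g \<in> borel_measurable lam" and F [measurable]: "F \<in> sets lam"
    and S: "emeasure sm F < \<infinity>"
  defines "gm \<equiv> density lam (\<lambda>z. ennreal \<bar>g z\<bar>)"
    and "ym \<equiv> density lam (\<lambda>z. ennreal (\<bar>g z\<bar> powr q * \<omega> z))"
  assumes Y: "emeasure ym F < \<infinity>"
  shows "emeasure gm F < \<infinity>"
    and "measure gm F powr q \<le> 2 powr q * measure sm F powr (q - 1) * measure ym F"
proof -
  have le: "emeasure gm F \<le> ennreal T * emeasure sm F + ennreal (T powr (1 - q)) * emeasure ym F"
    if T: "0 < T" for T
  proof -
    have "emeasure gm F = (\<integral>\<^sup>+z. ennreal \<bar>g z\<bar> * indicator F z \<partial>lam)"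
      by (simp add: gm_def emeasure_density)
    also have "\<dots> \<le> (\<integral>\<^sup>+z. (ennreal T * (ennreal (sig z) * indicator F z)
        + ennreal (T powr (1 - q)) * (ennreal (\<bar>g z\<bar> powr q * \<omega> z) * indicator F z)) \<partial>lam)"
    proof (rule nn_integral_mono_AE, use omega_pos in eventually_elim)
      case (elim z)
      have "ennreal \<bar>g z\<bar> \<le> ennreal (T * sig z + T powr (1 - q) * (\<bar>g z\<bar> powr q * \<omega> z))"
        unfolding sig_def using elim T q_gt_1 by (intro ennreal_leI weighted_split) auto
      also have "\<dots> = ennreal T * ennreal (sig z) + ennreal (T powr (1 - q)) * ennreal (\<bar>g z\<bar> powr q * \<omega> z)"
        using elim T sig_nonneg[of z] by (simp add: ennreal_plus ennreal_mult')
      finally show ?case by (auto simp: indicator_def)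
    qed
    also have "\<dots> = ennreal T * emeasure sm F + ennreal (T powr (1 - q)) * emeasure ym F"
      by (simp add: sm_def ym_def emeasure_density nn_integral_add nn_integral_cmult)
    finally show ?thesis .
  qed
  show fin: "emeasure gm F < \<infinity>"
    using le[of 1] S Y by (simp add: less_top[symmetric]) (metis ennreal_add_eq_top neq_top_trans)
  define I where "I = measure gm F"
  define s where "s = measure sm F"
  define y where "y = measure ym F"
  have e: "emeasure gm F = ennreal I" "emeasure sm F = ennreal s" "emeasure ym F = ennreal y"
    using fin S Y by (auto simp: I_def s_def y_def intro!: emeasure_eq_ennreal_measure)
  have nn: "0 \<le> I" "0 \<le> s" "0 \<le> y" by (auto simp: I_def s_def y_def)
  have le': "I \<le> T * s + T powr (1 - q) * y" if "0 < T" for T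
    using le[OF that] that nn unfolding e
    by (simp flip: ennreal_mult' ennreal_plus)
  have "I powr q \<le> 2 powr q * s powr (q - 1) * y"
  proof (cases "I = 0")
    case False
    then have I: "I > 0" using nn by simp
    \<comment> \<open>\<open>\<sigma>\<close> is positive almost everywhere, so \<open>s = 0\<close>
      would make \<open>F\<close> a null set and \<open>I\<close> zero.\<close>
    have s: "s > 0"
    proof (rule ccontr)
      assume "\<not> 0 < s"
      then have "emeasure sm F = 0" using nn e by simp
      then have "emeasure lam F = 0" using sm_pos[OF F] by (auto simp: zero_less_iff_neq_zero)
      then have "emeasure gm F = 0"
        unfolding gm_def by (simp add: emeasure_density nn_integral_null_set null_setsI)
      then show False using e I by simp
    qed
    \<comment> \<open>With this \<open>T\<close> the first term equals half of \<open>I\<close> and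
      can be absorbed on the left.\<close>
    define T where "T = I / (2 * s)"
    have T: "T > 0" using I s by (simp add: T_def)
    have "T * s = I / 2" using s by (simp add: T_def)
    then have "I / 2 \<le> T powr (1 - q) * y" using le'[OF T] by simp
    then have "T powr (q - 1) * (I / 2) \<le> T powr (q - 1) * (T powr (1 - q) * y)"
      by (intro mult_left_mono) auto
    also have "\<dots> = y" using T by (simp flip: mult.assoc powr_add)
    finally have *: "T powr (q - 1) * (I / 2) \<le> y" .
    have "T powr (q - 1) * (I / 2) * (2 powr q * s powr (q - 1)) = I powr q"
    proof -
      have "T powr (q - 1) = (I powr q / I) / ((2 powr q / 2) * s powr (q - 1))"
        using I s unfolding T_def by (subst powr_divide) (auto simp: powr_mult powr_diff)
      then show ?thesis using I s by (simp add: field_simps)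
    qed
    then have "I powr q \<le> y * (2 powr q * s powr (q - 1))"
      using mult_right_mono[OF *, of "2 powr q * s powr (q - 1)"] by simp
    then show ?thesis by (simp add: mult_ac)
  qed (use nn in auto)
  then show "measure gm F powr q \<le> 2 powr q * measure sm F powr (q - 1) * measure ym F"
    by (simp add: I_def s_def y_def)
qed

lemma hoelder_one:
  assumes "V \<in> sets lam" "emeasure sm V < \<infinity>" "emeasure wm V < \<infinity>"
  shows "measure lam V powr q \<le> 2 powr q * measure sm V powr (q - 1) * measure wm V"
  using hoelder(2)[of "\<lambda>_. 1" V] assms by (simp add: density_1 wm_def)

text \<open>The product of the Muckenhoupt condition before division by volumes, for two unrelated
  sets. Finiteness is demanded separately because \<open>measure\<close> returns 0 on sets of
  infinite measure.\<close>

definition Aq :: "('a \<times> real) set \<Rightarrow> ('a \<times> real) set \<Rightarrow> real \<Rightarrow> bool" where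
  "Aq U V C \<longleftrightarrow> emeasure wm U < \<infinity> \<and> emeasure sm V < \<infinity> \<and>
     measure wm U * measure sm V powr (q - 1) \<le> C"

lemma Aq_mono:
  assumes "Aq U V C" "U \<in> sets lam" "V \<in> sets lam" "U' \<in> sets lam" "V' \<in> sets lam"
    "U' \<subseteq> U" "V' \<subseteq> V" "C \<le> C'"
  shows "Aq U' V' C'"
proof -
  have "emeasure wm U' \<le> emeasure wm U" "emeasure sm V' \<le> emeasure sm V"
    using assms by (auto intro!: emeasure_mono)
  moreover have "measure wm U' \<le> measure wm U" "measure sm V' \<le> measure sm V"
    using assms by (auto intro!: measure_mono_fmeasurable simp: Aq_def fmeasurable_def)
  then have "measure wm U' * measure sm V' powr (q - 1) \<le> measure wm U * measure sm V powr (q - 1)"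
    using q_gt_1 by (intro mult_mono powr_mono2) auto
  ultimately show ?thesis using assms by (auto simp: Aq_def)
qed

text \<open>\<open>hoelder_one\<close> on \<open>V'\<close> bounds \<open>m powr q\<close> by
  \<open>\<sigma>\<close>-mass to the power \<open>q - 1\<close> times the
  \<open>\<omega>\<close>-mass of \<open>V'\<close>. Inserted into the condition for
  \<open>U\<close> and \<open>V\<close>, it lets the \<open>\<sigma>\<close>-mass cancel, leaving a
  comparison of \<open>\<omega>\<close> with itself at a later place: the forward doubling
  property.\<close>

lemma Aq_absorb:
  assumes A: "Aq U V (C * m powr q)" and V: "V \<in> sets lam" "V' \<in> sets lam" "V' \<subseteq> V"
    and fin: "emeasure wm V' < \<infinity>" and pos: "0 < measure lam V'"
    and m: "0 \<le> m" "m \<le> c * measure lam V'" and C: "0 \<le> C"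
  shows "measure wm U \<le> C * (2 * c) powr q * measure wm V'"
proof -
  have finS: "emeasure sm V < \<infinity>" using A by (simp add: Aq_def)
  have "emeasure sm V' \<le> emeasure sm V" using V by (intro emeasure_mono) auto
  then have finS': "emeasure sm V' < \<infinity>" using finS by simp
  have c: "0 \<le> c" using m pos by (metis mult_neg_pos not_le order_trans)
  have S': "measure sm V' \<le> measure sm V"
    using V finS by (intro measure_mono_fmeasurable) (auto simp: fmeasurable_def)
  have "0 < emeasure lam V'"
    using pos by (metis enn2real_0 measure_def not_gr_zero order_less_irrefl)
  then have "0 < emeasure sm V'" using V sm_pos by blast
  then have "0 < measure sm V'" using finS' by (simp add: measure_def enn2real_positive_iff)
  then have S: "0 < measure sm V" using S' by simp
  have "measure wm U * measure sm V powr (q - 1) \<le> C * m powr q"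
    using A by (simp add: Aq_def)
  also have "\<dots> \<le> C * (c * measure lam V') powr q"
    using m C q_gt_1 by (intro mult_left_mono powr_mono2) auto
  also have "\<dots> = C * c powr q * measure lam V' powr q" using c by (simp add: powr_mult)
  also have "\<dots> \<le> C * c powr q * (2 powr q * measure sm V' powr (q - 1) * measure wm V')"
    using C V finS' fin by (intro mult_left_mono hoelder_one) auto
  also have "\<dots> \<le> C * c powr q * (2 powr q * measure sm V powr (q - 1) * measure wm V')"
    using C S' q_gt_1 by (intro mult_left_mono mult_right_mono powr_mono2) auto
  also have "\<dots> = (C * (2 * c) powr q * measure wm V') * measure sm V powr (q - 1)"
    using c by (simp add: powr_mult)
  finally show ?thesis using S by simp
qed

lemma cyl_minus_box:
  "cyl_minus \<rho> p \<gamma> x t l = box x l (t - (1 + \<gamma>) / 2 * l powr p) ((1 - \<gamma>) / 2 * l powr p)"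
  unfolding cyl_minus_def box_def by (rule arg_cong2[where f="\<lambda>a b. _ \<times> {a<..<b}"]) (simp_all add: field_simps)

lemma cyl_plus_box:
  "cyl_plus \<rho> p \<gamma> x t l = box x l (t + (1 + \<gamma>) / 2 * l powr p) ((1 - \<gamma>) / 2 * l powr p)"
  unfolding cyl_plus_def box_def by (rule arg_cong2[where f="\<lambda>a b. _ \<times> {a<..<b}"]) (simp_all add: field_simps)

lemma measure_box_pos: "0 < r \<Longrightarrow> 0 < h \<Longrightarrow> 0 < measure lam (box x r a h)"
  using measure_ball_pos[of r x] by (simp add: measure_box)

lemma emeasure_box_pos: "0 < r \<Longrightarrow> 0 < h \<Longrightarrow> 0 < emeasure lam (box x r a h)"
  using measure_ball_pos[of r x] by (simp add: emeasure_box)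

text \<open>Both halves of a cylinder have measure \<open>(1 - \<gamma>) * vol x l\<close>, so the
  normalisations on the two sides differ by the constant factor
  \<open>(1 - \<gamma>) powr q\<close>.\<close>

lemma A_plus_iff:
  assumes \<gamma>: "0 \<le> \<gamma>" "\<gamma> < 1"
  shows "\<omega> \<in> A_plus \<rho> \<mu> p q \<gamma> \<longleftrightarrow>
    (\<exists>C\<ge>0. \<forall>x t l. 0 < l \<longrightarrow> Aq (cyl_minus \<rho> p \<gamma> x t l) (cyl_plus \<rho> p \<gamma> x t l) (C * vol x l powr q))"
proof -
  define f where "f x t l = avg lam (cyl_minus \<rho> p \<gamma> x t l) (\<lambda>z. ennreal (\<omega> z)) *
        ennpowr (avg lam (cyl_plus \<rho> p \<gamma> x t l) (\<lambda>z. ennreal (\<omega> z powr (1 - conj_exponent q)))) (q - 1)"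
    for x t l
  have key: "f x t l \<le> ennreal C \<longleftrightarrow>
      Aq (cyl_minus \<rho> p \<gamma> x t l) (cyl_plus \<rho> p \<gamma> x t l) (C * (1 - \<gamma>) powr q * vol x l powr q)"
    if l: "0 < l" and C: "0 \<le> C" for x t l C
  proof -
    let ?h = "(1 - \<gamma>) / 2 * l powr p"
    have h: "0 < ?h" using l \<gamma> by simp
    let ?U = "cyl_minus \<rho> p \<gamma> x t l" and ?V = "cyl_plus \<rho> p \<gamma> x t l"
    have sets: "?U \<in> sets lam" "?V \<in> sets lam"
      using l by (auto simp: cyl_minus_box cyl_plus_box)
    have meas: "emeasure lam ?U = ennreal ((1 - \<gamma>) * vol x l)" "emeasure lam ?V = ennreal ((1 - \<gamma>) * vol x l)"
      using emeasure_box[OF l h] by (auto simp: cyl_minus_box cyl_plus_box vol_def mult_ac)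
    have m: "0 < (1 - \<gamma>) * vol x l" using vol_pos[OF l] \<gamma> by simp
    have "f x t l = (emeasure wm ?U / ennreal ((1 - \<gamma>) * vol x l)) *
        ennpowr (emeasure sm ?V / ennreal ((1 - \<gamma>) * vol x l)) (q - 1)"
      unfolding f_def avg_def using sets by (simp add: meas emeasure_wm emeasure_sm sig_def)
    moreover have "0 < emeasure wm ?U" "0 < emeasure sm ?V"
      using sets m by (auto intro!: wm_pos sm_pos simp: meas)
    ultimately show ?thesis
      using m C q_gt_1 \<gamma> vol_pos[OF l, of x]
      by (simp add: avg_product_le_iff Aq_def measure_def powr_mult mult_ac)
  qed
  have eq: "\<omega> \<in> A_plus \<rho> \<mu> p q \<gamma> \<longleftrightarrow> (SUP (x, t, l) \<in> {(x, t, l). 0 < l}. f x t l) < \<infinity>"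
    using weight unfolding A_plus_def f_def by simp
  show ?thesis
  proof
    assume "\<omega> \<in> A_plus \<rho> \<mu> p q \<gamma>"
    then have "(SUP (x, t, l) \<in> {(x, t, l). 0 < l}. f x t l) < \<infinity>" by (simp add: eq)
    then obtain C where C: "0 \<le> C" "(SUP (x, t, l) \<in> {(x, t, l). 0 < l}. f x t l) = ennreal C"
      by (cases "SUP (x, t, l) \<in> {(x, t, l). 0 < l}. f x t l") auto
    show "\<exists>C\<ge>0. \<forall>x t l. 0 < l \<longrightarrow>
        Aq (cyl_minus \<rho> p \<gamma> x t l) (cyl_plus \<rho> p \<gamma> x t l) (C * vol x l powr q)"
    proof (intro exI[of _ "C * (1 - \<gamma>) powr q"] conjI allI impI)
      fix x t l assume l: "(0::real) < l"
      have "f x t l \<le> ennreal C"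
        unfolding C(2)[symmetric] using l by (intro SUP_upper2[of "(x, t, l)"]) auto
      then show "Aq (cyl_minus \<rho> p \<gamma> x t l) (cyl_plus \<rho> p \<gamma> x t l) (C * (1 - \<gamma>) powr q * vol x l powr q)"
        using key l C by blast
    qed (use C in auto)
  next
    assume "\<exists>C\<ge>0. \<forall>x t l. 0 < l \<longrightarrow>
        Aq (cyl_minus \<rho> p \<gamma> x t l) (cyl_plus \<rho> p \<gamma> x t l) (C * vol x l powr q)"
    then obtain C where C: "0 \<le> C" "\<And>x t l. 0 < l \<Longrightarrow>
        Aq (cyl_minus \<rho> p \<gamma> x t l) (cyl_plus \<rho> p \<gamma> x t l) (C * vol x l powr q)" by blast
    have "f x t l \<le> ennreal (C / (1 - \<gamma>) powr q)" if l: "0 < l" for x t l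
      using C(2)[OF l, of x t] C(1) \<gamma> by (subst key[OF l]) auto
    then have "(SUP (x, t, l) \<in> {(x, t, l). 0 < l}. f x t l) \<le> ennreal (C / (1 - \<gamma>) powr q)"
      by (intro SUP_least) auto
    then show "\<omega> \<in> A_plus \<rho> \<mu> p q \<gamma>" unfolding eq by (simp add: le_less_trans)
  qed
qed

subsection \<open>Independence of the lag\<close>

text \<open>
  The \<open>A\<^sub>q\<^sup>+\<close> condition for a box and its translate by the single lag \<open>\<theta> l\<^sup>p\<close>. Unlike the
  condition on whole cylinders it can be iterated along chains.
\<close>

definition lagged :: "real \<Rightarrow> real \<Rightarrow> bool" where
  "lagged \<theta> \<eta> \<longleftrightarrow> (\<exists>C\<ge>0. \<forall>x a l. 0 < l \<longrightarrow>
     Aq (box x l a (\<eta> * l powr p)) (box x l (a + \<theta> * l powr p) (\<eta> * l powr p)) (C * vol x l powr q))"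

text \<open>The halves of a cylinder are boxes of half-height
  \<open>(1 - \<gamma>) / 2 * l powr p\<close> whose centres are
  \<open>(1 + \<gamma>) * l powr p\<close> apart in time.\<close>

lemma A_plus_imp_lagged:
  assumes "0 \<le> \<gamma>" "\<gamma> < 1" "\<omega> \<in> A_plus \<rho> \<mu> p q \<gamma>"
  shows "lagged (1 + \<gamma>) ((1 - \<gamma>) / 2)"
proof -
  obtain C where C: "C \<ge> 0" "\<And>x t l. 0 < l \<Longrightarrow>
      Aq (cyl_minus \<rho> p \<gamma> x t l) (cyl_plus \<rho> p \<gamma> x t l) (C * vol x l powr q)"
    using A_plus_iff assms by auto
  show ?thesis
    unfolding lagged_def
  proof (intro exI[of _ C] conjI allI impI C(1))
    fix x a l assume l: "(0::real) < l"
    have "a + (1 + \<gamma>) / 2 * l powr p + (1 + \<gamma>) / 2 * l powr p = a + (1 + \<gamma>) * l powr p"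
      by (simp add: field_simps)
    then show "Aq (box x l a ((1 - \<gamma>) / 2 * l powr p))
        (box x l (a + (1 + \<gamma>) * l powr p) ((1 - \<gamma>) / 2 * l powr p)) (C * vol x l powr q)"
      using C(2)[OF l, of x "a + (1 + \<gamma>) / 2 * l powr p"]
      unfolding cyl_minus_box cyl_plus_box by (simp add: add_ac)
  qed
qed

text \<open>Each step of a monotone geodesic brings the endpoint nearer by at least
  \<open>s\<close>, so at most \<open>\<rho> y z / s\<close> steps occur. The chain is padded to
  exactly \<open>n\<close> steps by repeating the endpoint. Points closer than \<open>s\<close> are
  joined by one jump, which is why \<open>K1\<close> is at least 1.\<close>

lemma geodesic_chain:
  obtains K1 where "0 < K1"
    "\<And>y z s n. 1 \<le> n \<Longrightarrow> 0 < s \<Longrightarrow> \<rho> y z \<le> real n * s \<Longrightarrow>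
      \<exists>xs. xs 0 = y \<and> xs n = z \<and> (\<forall>i<n. \<rho> (xs i) (xs (Suc i)) \<le> K1 * s)"
proof -
  from geodesic[unfolded monotone_geodesic_def] obtain Kt where Kt: "0 < Kt \<and>
      (\<forall>s>0. \<forall>x y. s \<le> \<rho> x y \<longrightarrow> (\<exists>(m::nat) xs. xs 0 = x \<and> xs m = y \<and>
        (\<forall>i<m. \<rho> (xs i) (xs (Suc i)) \<le> Kt * s \<and> \<rho> (xs (Suc i)) (xs m) \<le> \<rho> (xs i) (xs m) - s)))" ..
  note Kt_chain = conjunct2[OF Kt, rule_format]
  define K1 where "K1 = max Kt 1"
  have K1: "K1 > 0" "Kt \<le> K1" "1 \<le> K1" by (auto simp: K1_def)
  show thesis
  proof (rule that[OF K1(1)])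
    fix y z s and n :: nat assume n: "1 \<le> n" and s: "0 < s" and yz: "\<rho> y z \<le> real n * s"
    show "\<exists>xs. xs 0 = y \<and> xs n = z \<and> (\<forall>i<n. \<rho> (xs i) (xs (Suc i)) \<le> K1 * s)"
    proof (cases "s \<le> \<rho> y z")
      case False
      define xs where "xs i = (if i = 0 then y else z)" for i :: nat
      have "\<rho> (xs i) (xs (Suc i)) \<le> K1 * s" for i
      proof -
        have "\<rho> (xs i) (xs (Suc i)) \<le> s" using False s by (auto simp: xs_def)
        also have "s \<le> K1 * s" using K1 s by simp
        finally show ?thesis .
      qed
      then show ?thesis using n by (intro exI[of _ xs]) (auto simp: xs_def)
    next
      case True
      from Kt_chain[OF s True] obtain m :: nat and xs where *: "xs 0 = y \<and> xs m = z \<and>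
        (\<forall>i<m. \<rho> (xs i) (xs (Suc i)) \<le> Kt * s \<and> \<rho> (xs (Suc i)) (xs m) \<le> \<rho> (xs i) (xs m) - s)"
        by (elim exE) (rule that)
      then have xs: "xs 0 = y" "xs m = z"
        "\<And>i. i < m \<Longrightarrow> \<rho> (xs i) (xs (Suc i)) \<le> Kt * s"
        "\<And>i. i < m \<Longrightarrow> \<rho> (xs (Suc i)) (xs m) \<le> \<rho> (xs i) (xs m) - s" by auto
      have "\<rho> (xs i) z \<le> \<rho> y z - real i * s" if "i \<le> m" for i
        using that
      proof (induction i)
        case (Suc i)
        then show ?case using xs(4)[of i] xs(2) by (simp add: algebra_simps)
      qed (simp add: xs)
      from this[of m] have "real m * s \<le> \<rho> y z" by (simp add: xs)
      also note yz
      finally have mn: "m \<le> n" using s by simp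
      have "\<rho> (xs (min i m)) (xs (min (Suc i) m)) \<le> K1 * s" for i
      proof (cases "i < m")
        case True
        then show ?thesis using xs(3)[OF True] K1(2) s
          by (simp add: min_def) (meson mult_right_mono less_imp_le order_trans)
      next
        case False
        then show ?thesis using K1 s by (simp add: min_def)
      qed
      then show ?thesis using mn xs by (intro exI[of _ "\<lambda>i. xs (min i m)"]) (auto simp: min_def)
    qed
  qed
qed

section \<open>Transport of the weight along chains of small cylinders\<close>

context
  fixes \<theta> \<eta> :: real
  assumes lagged: "lagged \<theta> \<eta>" and \<eta>: "0 < \<eta>"
begin

lemma lagged_finite:
  assumes "0 < l"
  shows "emeasure wm (box x l a (\<eta> * l powr p)) < \<infinity>"
  using lagged assms by (auto simp: lagged_def Aq_def)

text \<open>The ball of radius \<open>l / (2 * K0)\<close> around \<open>y\<close> lies in both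
  \<open>\<B> x l\<close> and \<open>\<B> y l\<close>. \<open>Aq_absorb\<close> passes from the box
  at \<open>x\<close> to the box over this smaller ball one lag later, hence to the box at
  \<open>y\<close>.\<close>

lemma lagged_step:
  "\<exists>C\<ge>0. \<forall>x y a l. 0 < l \<longrightarrow> \<rho> x y \<le> l / (2 * K0) \<longrightarrow>
     measure wm (box x l a (\<eta> * l powr p)) \<le> C * measure wm (box y l (a + \<theta> * l powr p) (\<eta> * l powr p))"
proof -
  obtain C where C: "C \<ge> 0" "\<And>x a l. 0 < l \<Longrightarrow>
     Aq (box x l a (\<eta> * l powr p)) (box x l (a + \<theta> * l powr p) (\<eta> * l powr p)) (C * vol x l powr q)"
    using lagged by (auto simp: lagged_def)
  obtain D where D: "D > 0" "\<And>x y r s. 0 < r \<Longrightarrow> 0 < s \<Longrightarrow> s \<le> (2 * K0) * r \<Longrightarrow>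
      \<rho> x y \<le> (2 * K0) * r \<Longrightarrow> measure \<mu> (\<B> y s) \<le> D * measure \<mu> (\<B> x r)"
    using doubling_general[of "2 * K0"] by blast
  \<comment> \<open>The small box has measure \<open>2 * \<eta> * l powr p\<close> times that of its
    ball; \<open>D\<close> compares this ball with \<open>\<B> x l\<close>.\<close>
  define c where "c = D / (2 * \<eta>)"
  show ?thesis
  proof (intro exI[of _ "C * (2 * c) powr q"] conjI allI impI)
    show "0 \<le> C * (2 * c) powr q" using C by simp
    fix x y a l assume l: "0 < l" and xy: "\<rho> x y \<le> l / (2 * K0)"
    let ?r = "l / (2 * K0)" and ?b = "a + \<theta> * l powr p" and ?h = "\<eta> * l powr p"
    have r: "0 < ?r" "?r \<le> l" using l K0 by (auto simp: field_simps)
    have h: "0 < ?h" using l \<eta> by simp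
    have sub: "box y ?r ?b ?h \<subseteq> box x l ?b ?h"
    proof (intro box_mono ball_subset)
      have "K0 * (\<rho> x y + ?r) \<le> K0 * (?r + ?r)" using xy K0 by (intro mult_left_mono) auto
      also have "\<dots> = l" using K0 by simp
      finally show "K0 * (\<rho> x y + ?r) \<le> l" .
    qed auto
    have sub': "box y ?r ?b ?h \<subseteq> box y l ?b ?h"
      using r by (intro box_mono ball_mono) auto
    have le': "emeasure wm (box y ?r ?b ?h) \<le> emeasure wm (box y l ?b ?h)"
      using sub' l by (intro emeasure_mono) (auto simp: box_sets)
    have dbl: "measure \<mu> (\<B> x l) \<le> D * measure \<mu> (\<B> y ?r)"
    proof (rule D(2))
      show "l \<le> 2 * K0 * ?r" using K0 by simp
      have "\<rho> y x \<le> l" using xy r rho_sym[of x y] by simp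
      then show "\<rho> y x \<le> 2 * K0 * ?r" using K0 by simp
    qed (use r l in auto)
    have "vol x l \<le> c * measure lam (box y ?r ?b ?h)"
    proof -
      have "c * measure lam (box y ?r ?b ?h) = D * measure \<mu> (\<B> y ?r) * l powr p"
        using r h \<eta> by (simp add: measure_box c_def)
      then show ?thesis using dbl by (simp add: vol_def mult_right_mono)
    qed
    then have "measure wm (box x l a ?h) \<le> C * (2 * c) powr q * measure wm (box y ?r ?b ?h)"
      using C l r h sub le' lagged_finite[OF l] vol_pos[OF l, of x]
      by (intro Aq_absorb[where m="vol x l" and V="box x l ?b ?h"] measure_box_pos)
        (auto simp: box_sets intro: le_less_trans)
    also have "\<dots> \<le> C * (2 * c) powr q * measure wm (box y l ?b ?h)"
      using C sub' l r lagged_finite[OF l]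
      by (intro mult_left_mono measure_mono_fmeasurable) (auto simp: fmeasurable_def box_sets)
    finally show "measure wm (box x l a ?h) \<le> C * (2 * c) powr q * measure wm (box y l ?b ?h)" .
  qed
qed

text \<open>
  Since \<open>p > 1\<close>, moving a fixed time distance \<open>T\<close> in \<open>N\<close> equal steps uses cylinders of radius
  comparable to \<open>(T/N)\<^sup>1\<^sup>/\<^sup>p\<close>, much larger than the \<open>1/N\<close> needed to bridge the space distance.
\<close>

lemma lagged_two_points:
  assumes \<theta>: "0 < \<theta>" and \<gamma>: "0 < \<gamma>"
  shows "\<exists>\<kappa>>0. \<exists>C\<ge>0. \<forall>x l y z a b. 0 < l \<longrightarrow> y \<in> \<B> x l \<longrightarrow> z \<in> \<B> x l \<longrightarrow>
     2 * \<gamma> * l powr p \<le> b - a \<longrightarrow> b - a \<le> 2 * l powr p \<longrightarrow>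
     Aq (box y (\<kappa> * l) a (\<eta> * (\<kappa> * l) powr p)) (box z (\<kappa> * l) b (\<eta> * (\<kappa> * l) powr p))
       (C * vol x l powr q)"
proof -
  obtain C where C: "C \<ge> 0" "\<And>x a l. 0 < l \<Longrightarrow>
     Aq (box x l a (\<eta> * l powr p)) (box x l (a + \<theta> * l powr p) (\<eta> * l powr p)) (C * vol x l powr q)"
    using lagged by (auto simp: lagged_def)
  obtain E where E: "E \<ge> 0" "\<And>x y a l. 0 < l \<Longrightarrow> \<rho> x y \<le> l / (2 * K0) \<Longrightarrow>
     measure wm (box x l a (\<eta> * l powr p)) \<le> E * measure wm (box y l (a + \<theta> * l powr p) (\<eta> * l powr p))"
    using lagged_step by blast
  obtain K1 where K1: "0 < K1" "\<And>y z s n. 1 \<le> n \<Longrightarrow> 0 < s \<Longrightarrow> \<rho> y z \<le> real n * s \<Longrightarrow>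
     \<exists>xs. xs 0 = y \<and> xs n = z \<and> (\<forall>i<n. \<rho> (xs i) (xs (Suc i)) \<le> K1 * s)"
    by (fact geodesic_chain)
  have chain: "measure wm (box (xs 0) l a (\<eta> * l powr p))
      \<le> E ^ n * measure wm (box (xs n) l (a + real n * (\<theta> * l powr p)) (\<eta> * l powr p))"
    if l: "0 < l" and "\<And>i. i < n \<Longrightarrow> \<rho> (xs i) (xs (Suc i)) \<le> l / (2 * K0)" for xs n a l
    using that(2)
  proof (induction n)
    case (Suc n)
    have "measure wm (box (xs 0) l a (\<eta> * l powr p))
      \<le> E ^ n * measure wm (box (xs n) l (a + real n * (\<theta> * l powr p)) (\<eta> * l powr p))"
      using Suc by auto
    also have "\<dots> \<le> E ^ n * (E * measure wm (box (xs (Suc n)) l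
        (a + real n * (\<theta> * l powr p) + \<theta> * l powr p) (\<eta> * l powr p)))"
      using l Suc.prems E(1) by (intro mult_left_mono E(2)) auto
    finally show ?case by (simp add: algebra_simps)
  qed auto
  \<comment> \<open>Points of \<open>\<B> x l\<close> are at most \<open>2 * K0 * l\<close> apart,
    and \<open>n\<close> steps of length \<open>s = \<kappa> * l / (2 * K0 * K1)\<close> must cover
    this. That is the requirement \<open>A \<le> n * \<kappa>\<close>.\<close>
  define A where "A = 4 * K0\<^sup>2 * K1"
  define c where "c = 2 * \<gamma> / \<theta>"
  have c: "c > 0" using \<theta> \<gamma> by (simp add: c_def)
  have A: "A > 0" using K1 K0 by (simp add: A_def)
  obtain n :: nat where n: "1 \<le> n" "A \<le> real n * (c / real (n + 1)) powr (1 / p)"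
  proof -
    \<comment> \<open>\<open>n * \<kappa>\<close> grows like \<open>n powr (1 - 1 / p)\<close>, an
      increasing power since \<open>p > 1\<close>. The factor 2 pays for replacing
      \<open>n + 1\<close> by \<open>2 * n\<close>.\<close>
    define X where "X = (2 * A / c powr (1 / p)) powr (1 / (1 - 1 / p))"
    obtain n :: nat where n: "max 1 X \<le> real n" using real_arch_simple by blast
    have e: "1 - 1 / p > 0" using p_gt_1 by simp
    have n1: "1 \<le> n" using n by linarith
    have "2 * A / c powr (1 / p) = X powr (1 - 1 / p)"
      using e A c p_gt_1 by (simp add: X_def powr_powr)
    also have "\<dots> \<le> real (n + 1) powr (1 - 1 / p)"
      using n e by (intro powr_mono2) (auto simp: X_def)
    also have "\<dots> = real (n + 1) / real (n + 1) powr (1 / p)"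
      by (simp add: powr_diff)
    finally have "A \<le> real (n + 1) / 2 * (c powr (1 / p) / real (n + 1) powr (1 / p))"
      using c by (simp add: field_simps)
    also have "\<dots> \<le> real n * (c powr (1 / p) / real (n + 1) powr (1 / p))"
      using n1 by (intro mult_right_mono) auto
    also have "\<dots> = real n * (c / real (n + 1)) powr (1 / p)"
      using c by (simp add: powr_divide)
    finally show ?thesis using that n1 by blast
  qed
  define \<kappa> where "\<kappa> = (c / real (n + 1)) powr (1 / p)"
  define \<kappa>2 where "\<kappa>2 = (2 / (\<theta> * real (n + 1))) powr (1 / p)"
  have \<kappa>: "\<kappa> > 0" "\<kappa>2 > 0" using c \<theta> by (auto simp: \<kappa>_def \<kappa>2_def)
  define k where "k = max \<kappa>2 1"
  have k: "k \<ge> 1" "\<kappa>2 \<le> k" by (auto simp: k_def)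
  obtain D where D: "D > 0" "\<And>x y r s. 0 < r \<Longrightarrow> 0 < s \<Longrightarrow> s \<le> k * r \<Longrightarrow>
      \<rho> x y \<le> k * r \<Longrightarrow> measure \<mu> (\<B> y s) \<le> D * measure \<mu> (\<B> x r)"
    using doubling_general[of k] by blast
  show ?thesis
  proof (rule exI[of _ \<kappa>], rule conjI[OF \<kappa>(1)],
      rule exI[of _ "E ^ n * C * (D * k powr p) powr q"], rule conjI, goal_cases)
    case 1
    show ?case using E C by simp
  next
    case 2
    show ?case
    proof (intro allI impI)
      fix x l y z a b assume l: "0 < l" and yz: "y \<in> \<B> x l" "z \<in> \<B> x l"
        and T: "2 * \<gamma> * l powr p \<le> b - a" "b - a \<le> 2 * l powr p"
      define N where "N = real (n + 1)"
      have N: "N > 0" by (simp add: N_def)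
      have \<kappa>N: "\<kappa> = (c / N) powr (1 / p)" "\<kappa>2 = (2 / (\<theta> * N)) powr (1 / p)"
        by (simp_all only: \<kappa>_def \<kappa>2_def N_def)
      have T0: "0 < b - a"
      proof -
        have "0 < 2 * \<gamma> * l powr p" using \<gamma> l by simp
        then show ?thesis using T by linarith
      qed
      \<comment> \<open>Chosen so that \<open>N\<close> lags of length
        \<open>\<theta> * r powr p\<close> add up to exactly \<open>b - a\<close>. The two bounds on
        \<open>b - a\<close> place \<open>r\<close> between \<open>\<kappa> * l\<close> and
        \<open>\<kappa>2 * l\<close>.\<close>
      define r where "r = ((b - a) / (N * \<theta>)) powr (1 / p)"
      have r: "0 < r" using T0 N \<theta> by (simp add: r_def)
      have rp: "r powr p = (b - a) / (N * \<theta>)"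
        using T0 N \<theta> p_gt_1 by (simp add: r_def powr_powr)
      have "\<kappa> * l = (c / N * l powr p) powr (1 / p)"
        using c l N p_gt_1 unfolding \<kappa>N by (subst powr_mult) (auto simp: powr_powr)
      also have "\<dots> \<le> r"
        unfolding r_def
      proof (intro powr_mono2)
        have "c / N * l powr p = (2 * \<gamma> * l powr p) / (N * \<theta>)" by (simp add: c_def)
        also have "\<dots> \<le> (b - a) / (N * \<theta>)" using T N \<theta> by (intro divide_right_mono) auto
        finally show "c / N * l powr p \<le> (b - a) / (N * \<theta>)" .
      qed (use c N p_gt_1 in auto)
      finally have r1: "\<kappa> * l \<le> r" .
      have "r \<le> (2 / (\<theta> * N) * l powr p) powr (1 / p)"
        unfolding r_def
      proof (intro powr_mono2)
        have "(b - a) / (N * \<theta>) \<le> (2 * l powr p) / (N * \<theta>)" using T N \<theta> by (intro divide_right_mono) auto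
        then show "(b - a) / (N * \<theta>) \<le> 2 / (\<theta> * N) * l powr p" by (simp add: mult.commute)
      qed (use T0 N \<theta> p_gt_1 in auto)
      also have "\<dots> = \<kappa>2 * l"
        using \<theta> l N p_gt_1 unfolding \<kappa>N by (subst powr_mult) (auto simp: powr_powr)
      also have "\<dots> \<le> k * l" using k l by (intro mult_right_mono) auto
      finally have r2: "r \<le> k * l" .
      define s where "s = \<kappa> * l / (2 * K0 * K1)"
      have s: "0 < s" using \<kappa> l K0 K1 by (simp add: s_def)
      have "A \<le> real n * \<kappa>" using n by (simp add: \<kappa>_def)
      have "\<rho> y z \<le> 2 * K0 * l" using rho_in_ball[OF yz] by simp
      also have "\<dots> = A * (l / (2 * K0 * K1))" using K0 K1 by (simp add: A_def power2_eq_square)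
      also have "\<dots> \<le> (real n * \<kappa>) * (l / (2 * K0 * K1))"
        using \<open>A \<le> real n * \<kappa>\<close> l K0 K1 by (intro mult_right_mono) auto
      also have "\<dots> = real n * s" by (simp add: s_def)
      finally obtain xs where xs: "xs 0 = y" "xs n = z" "\<And>i. i < n \<Longrightarrow> \<rho> (xs i) (xs (Suc i)) \<le> K1 * s"
        using K1(2)[OF n(1) s] by blast
      have "K1 * s = \<kappa> * l / (2 * K0)" using K1 K0 by (simp add: s_def)
      also have "\<dots> \<le> r / (2 * K0)" using r1 K0 by (intro divide_right_mono) auto
      finally have steps: "\<rho> (xs i) (xs (Suc i)) \<le> r / (2 * K0)" if "i < n" for i
        using xs(3)[OF that] by simp
      have W: "measure wm (box y r a (\<eta> * r powr p))
        \<le> E ^ n * measure wm (box z r (a + real n * (\<theta> * r powr p)) (\<eta> * r powr p))"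
        using chain[of r n xs a, OF r steps] unfolding xs by simp
      \<comment> \<open>Of the \<open>N = n + 1\<close> lags, \<open>n\<close> carry
        \<open>\<omega>\<close> from \<open>y\<close> to \<open>z\<close>; the last one stays at
        \<open>z\<close> and passes from \<open>\<omega>\<close> to \<open>\<sigma>\<close>.\<close>
      have b: "a + real n * (\<theta> * r powr p) + \<theta> * r powr p = b"
      proof -
        have "a + real n * (\<theta> * r powr p) + \<theta> * r powr p = a + N * \<theta> * r powr p"
          by (simp add: N_def algebra_simps)
        then show ?thesis unfolding rp using N \<theta> by simp
      qed
      have last: "Aq (box z r (a + real n * (\<theta> * r powr p)) (\<eta> * r powr p)) (box z r b (\<eta> * r powr p)) (C * vol z r powr q)"
        using C(2)[OF r, of z "a + real n * (\<theta> * r powr p)"] unfolding b .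
      have "Aq (box y r a (\<eta> * r powr p)) (box z r b (\<eta> * r powr p)) (E ^ n * (C * vol z r powr q))"
        unfolding Aq_def
      proof (intro conjI)
        let ?S = "measure sm (box z r b (\<eta> * r powr p)) powr (q - 1)"
        have "measure wm (box y r a (\<eta> * r powr p)) * ?S
          \<le> E ^ n * measure wm (box z r (a + real n * (\<theta> * r powr p)) (\<eta> * r powr p)) * ?S"
          by (intro mult_right_mono W) auto
        also have "\<dots> = E ^ n * (measure wm (box z r (a + real n * (\<theta> * r powr p)) (\<eta> * r powr p)) * ?S)"
          by simp
        also have "\<dots> \<le> E ^ n * (C * vol z r powr q)"
          using last E by (intro mult_left_mono) (auto simp: Aq_def)
        finally show "measure wm (box y r a (\<eta> * r powr p)) * ?S \<le> E ^ n * (C * vol z r powr q)" .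
      qed (use last lagged_finite[OF r] in \<open>auto simp: Aq_def\<close>)
      then show "Aq (box y (\<kappa> * l) a (\<eta> * (\<kappa> * l) powr p)) (box z (\<kappa> * l) b (\<eta> * (\<kappa> * l) powr p))
          (E ^ n * C * (D * k powr p) powr q * vol x l powr q)"
      \<comment> \<open>The radius \<open>r\<close> depends on \<open>b - a\<close>; shrinking the
        boxes to radius \<open>\<kappa> * l\<close> makes the conclusion uniform.\<close>
      proof (rule Aq_mono)
        have "(\<kappa> * l) powr p \<le> r powr p" using r1 \<kappa> l p_gt_1 by (intro powr_mono2) auto
        then have "\<eta> * (\<kappa> * l) powr p \<le> \<eta> * r powr p" using \<eta> by (intro mult_left_mono) auto
        then show "box y (\<kappa> * l) a (\<eta> * (\<kappa> * l) powr p) \<subseteq> box y r a (\<eta> * r powr p)"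
          "box z (\<kappa> * l) b (\<eta> * (\<kappa> * l) powr p) \<subseteq> box z r b (\<eta> * r powr p)"
          using r1 by (simp_all add: box_mono ball_mono)
        have "vol z r \<le> (D * measure \<mu> (\<B> x l)) * (k * l) powr p"
          unfolding vol_def
        proof (intro mult_mono D(2) powr_mono2)
          have "l \<le> k * l" using k l by simp
          moreover have "\<rho> x z < l" using yz by (simp add: mem_ball)
          ultimately show "\<rho> x z \<le> k * l" by linarith
        qed (use l r r2 p_gt_1 D in auto)
        also have "\<dots> = D * k powr p * vol x l" using k l by (simp add: vol_def powr_mult)
        finally have "vol z r powr q \<le> (D * k powr p * vol x l) powr q"
          using q_gt_1 vol_pos[OF r, of z] by (intro powr_mono2) auto
        also have "\<dots> = (D * k powr p) powr q * vol x l powr q"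
          using D vol_pos[OF l, of x] by (simp add: powr_mult)
        finally have "E ^ n * C * vol z r powr q \<le> E ^ n * C * ((D * k powr p) powr q * vol x l powr q)"
          using E C by (intro mult_left_mono) auto
        then show "E ^ n * (C * vol z r powr q) \<le> E ^ n * C * (D * k powr p) powr q * vol x l powr q"
          by (simp add: mult.assoc)
      qed (use r \<kappa> l in \<open>auto simp: box_sets\<close>)
    qed
  qed
qed

text \<open>Pigeonholing \<open>\<omega>\<close> in the lower half and \<open>\<sigma>\<close> in
  the upper half leaves one small box in each, and \<open>lagged_two_points\<close> joins these
  two.\<close>

lemma lagged_imp_A_plus:
  assumes \<theta>: "0 < \<theta>" and \<gamma>: "0 < \<gamma>" "\<gamma> < 1"
  shows "\<omega> \<in> A_plus \<rho> \<mu> p q \<gamma>"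
proof -
  obtain \<kappa> C where \<kappa>: "\<kappa> > 0" and C: "C \<ge> 0" and tp: "\<And>x l y z a b. 0 < l \<Longrightarrow> y \<in> \<B> x l \<Longrightarrow> z \<in> \<B> x l \<Longrightarrow>
     2 * \<gamma> * l powr p \<le> b - a \<Longrightarrow> b - a \<le> 2 * l powr p \<Longrightarrow>
     Aq (box y (\<kappa> * l) a (\<eta> * (\<kappa> * l) powr p)) (box z (\<kappa> * l) b (\<eta> * (\<kappa> * l) powr p))
       (C * vol x l powr q)"
    using lagged_two_points[OF \<theta> \<gamma>(1)] by blast
  define \<eta>' where "\<eta>' = \<eta> * \<kappa> powr p"
  have \<eta>': "\<eta>' > 0" using \<eta> \<kappa> by (simp add: \<eta>'_def)
  from box_pigeonhole[OF \<kappa> \<eta>'] obtain M where M: "M > 0"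
    "\<And>\<nu> x l a h. sets \<nu> = sets lam \<Longrightarrow> 0 < l \<Longrightarrow> 0 < h \<Longrightarrow> h \<le> l powr p \<Longrightarrow>
     (\<exists>y b. y \<in> \<B> x l \<and> \<bar>b - a\<bar> < h \<and>
        emeasure \<nu> (box x l a h) \<le> ennreal M * emeasure \<nu> (box y (\<kappa> * l) b (\<eta>' * l powr p)))"
    by blast
  show ?thesis
  proof (subst A_plus_iff, use \<gamma> in simp, use \<gamma> in simp,
      intro exI[of _ "M * M powr (q - 1) * C"] conjI allI impI)
    show "0 \<le> M * M powr (q - 1) * C" using M C by simp
    fix x t l assume l: "(0::real) < l"
    let ?h = "(1 - \<gamma>) / 2 * l powr p"
    let ?U = "cyl_minus \<rho> p \<gamma> x t l" and ?V = "cyl_plus \<rho> p \<gamma> x t l"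
    have h: "0 < ?h" "?h \<le> l powr p" using \<gamma> l by (auto simp: field_simps)
    obtain y a where y: "y \<in> \<B> x l" "\<bar>a - (t - (1 + \<gamma>) / 2 * l powr p)\<bar> < ?h"
      "emeasure wm ?U \<le> ennreal M * emeasure wm (box y (\<kappa> * l) a (\<eta>' * l powr p))"
      using M(2)[OF sets_wm l h, of x "t - (1 + \<gamma>) / 2 * l powr p"] unfolding cyl_minus_box by blast
    obtain z b where z: "z \<in> \<B> x l" "\<bar>b - (t + (1 + \<gamma>) / 2 * l powr p)\<bar> < ?h"
      "emeasure sm ?V \<le> ennreal M * emeasure sm (box z (\<kappa> * l) b (\<eta>' * l powr p))"
      using M(2)[OF sets_sm l h, of x "t + (1 + \<gamma>) / 2 * l powr p"] unfolding cyl_plus_box by blast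
    have e: "\<eta> * (\<kappa> * l) powr p = \<eta>' * l powr p"
      using \<kappa> l by (simp add: \<eta>'_def powr_mult)
    define U where "U = box y (\<kappa> * l) a (\<eta>' * l powr p)"
    define V where "V = box z (\<kappa> * l) b (\<eta>' * l powr p)"
    have "Aq U V (C * vol x l powr q)"
      unfolding U_def V_def e[symmetric]
    proof (rule tp[OF l y(1) z(1)])
      \<comment> \<open>The centres of the halves are \<open>(1 + \<gamma>) * l powr p\<close>
        apart, and \<open>a\<close> and \<open>b\<close> each deviate by less than
        \<open>(1 - \<gamma>) / 2 * l powr p\<close>.\<close>
      show "2 * \<gamma> * l powr p \<le> b - a" "b - a \<le> 2 * l powr p"
        using y(2) z(2) by (auto simp: field_simps abs_if split: if_splits)
    qed
    then have UV: "emeasure wm U < \<infinity>" "emeasure sm V < \<infinity>"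
      "measure wm U * measure sm V powr (q - 1) \<le> C * vol x l powr q" by (auto simp: Aq_def)
    have eU: "emeasure wm U = ennreal (measure wm U)" and eV: "emeasure sm V = ennreal (measure sm V)"
      using UV by (auto intro!: emeasure_eq_ennreal_measure)
    have U: "emeasure wm ?U \<le> ennreal (M * measure wm U)" and V: "emeasure sm ?V \<le> ennreal (M * measure sm V)"
      using y(3) z(3) M(1) unfolding U_def[symmetric] V_def[symmetric] eU eV by (simp_all add: ennreal_mult')
    have mU: "measure wm ?U \<le> M * measure wm U"
      using enn2real_mono[OF U] M(1) by (simp add: measure_def)
    have mV: "measure sm ?V \<le> M * measure sm V"
      using enn2real_mono[OF V] M(1) by (simp add: measure_def)
    show "Aq ?U ?V (M * M powr (q - 1) * C * vol x l powr q)"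
      unfolding Aq_def
    proof (intro conjI)
      have "measure wm ?U * measure sm ?V powr (q - 1) \<le> (M * measure wm U) * (M * measure sm V) powr (q - 1)"
        using mU mV M(1) q_gt_1 by (intro mult_mono powr_mono2) auto
      also have "\<dots> = M * M powr (q - 1) * (measure wm U * measure sm V powr (q - 1))"
        using M(1) by (simp add: powr_mult)
      also have "\<dots> \<le> M * M powr (q - 1) * (C * vol x l powr q)"
        using UV M by (intro mult_left_mono) auto
      finally show "measure wm ?U * measure sm ?V powr (q - 1) \<le> M * M powr (q - 1) * C * vol x l powr q"
        by (simp add: mult.assoc)
    qed (use U V in \<open>auto simp: less_top[symmetric] top_unique\<close>)
  qed
qed

end

end

subsection \<open>Necessity of the Muckenhoupt condition\<close>

locale dyadic_parabolic_weight = parabolic_weight \<rho> K0 \<mu> p q \<omega>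
  for \<rho> :: "'a \<Rightarrow> 'a \<Rightarrow> real" and K0 :: real and \<mu> :: "'a measure"
    and p q :: real and \<omega> :: "'a \<times> real \<Rightarrow> real" +
  fixes \<delta> c0 C0 :: real and K :: nat
    and idx :: "nat \<Rightarrow> int \<Rightarrow> 'i set"
    and ctr :: "nat \<Rightarrow> int \<Rightarrow> 'i \<Rightarrow> 'a"
    and cube :: "nat \<Rightarrow> int \<Rightarrow> 'i \<Rightarrow> 'a set"
  assumes \<delta>: "0 < \<delta>" "\<delta> < 1" and c0: "0 < c0" and C0: "c0 \<le> C0"
    and dyadic: "adjacent_dyadic_systems \<rho> K0 \<mu> \<delta> c0 C0 K idx ctr cube"
begin

definition c1 :: real where "c1 = c0 / (3 * K0\<^sup>2)"
definition C1 :: real where "C1 = 2 * K0 * C0"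
definition len :: "int \<Rightarrow> real" where "len k = \<delta> powi k"
definition dur :: "int \<Rightarrow> real" where "dur k = len k powr p"

lemma c1: "0 < c1" and C1: "0 < C1"
  using c0 C0 K0 by (auto simp: c1_def C1_def)

lemma len_pos: "0 < len k" and dur_pos: "0 < dur k"
  using \<delta> by (auto simp: len_def dur_def)

lemma dur_antimono: "k \<le> l \<Longrightarrow> dur l \<le> dur k"
  unfolding dur_def len_def using \<delta> p_gt_1 by (intro powr_mono2 power_int_decreasing) auto

lemma rect_plus_eq:
  "rect_plus p \<delta> cube \<gamma> \<tau> k \<alpha> t = cube \<tau> k \<alpha> \<times> {t + \<gamma> * dur k<..<t + dur k}"
proof -
  have "\<delta> powr (of_int k * p) = dur k"
    using \<delta> by (simp add: dur_def len_def powr_powr flip: powr_real_of_int')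
  then show ?thesis by (simp add: rect_plus_def)
qed

section \<open>Position and size of the dyadic cubes\<close>

lemma cube_props:
  assumes "\<tau> \<in> {1..K}"
  shows cube_sets: "\<alpha> \<in> idx \<tau> k \<Longrightarrow> cube \<tau> k \<alpha> \<in> sets \<mu>"
    and ctr_sep: "\<alpha> \<in> idx \<tau> k \<Longrightarrow> \<beta> \<in> idx \<tau> k \<Longrightarrow> \<alpha> \<noteq> \<beta> \<Longrightarrow> c0 * len k \<le> \<rho> (ctr \<tau> k \<alpha>) (ctr \<tau> k \<beta>)"
    and cube_nested: "k \<le> l \<Longrightarrow> \<alpha> \<in> idx \<tau> k \<Longrightarrow> \<beta> \<in> idx \<tau> l \<Longrightarrow>
      cube \<tau> l \<beta> \<subseteq> cube \<tau> k \<alpha> \<or> cube \<tau> l \<beta> \<inter> cube \<tau> k \<alpha> = {}"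
    and ball_subset_cube: "\<alpha> \<in> idx \<tau> k \<Longrightarrow> \<B> (ctr \<tau> k \<alpha>) (c1 * len k) \<subseteq> cube \<tau> k \<alpha>"
    and cube_subset_ball: "\<alpha> \<in> idx \<tau> k \<Longrightarrow> cube \<tau> k \<alpha> \<subseteq> \<B> (ctr \<tau> k \<alpha>) (C1 * len k)"
  using dyadic assms unfolding adjacent_dyadic_systems_def Let_def c1_def C1_def len_def by auto

lemma ball_in_cube:
  "\<exists>Cs>0. \<forall>x r. 0 < r \<longrightarrow> (\<exists>\<tau>\<in>{1..K}. \<exists>k. \<exists>\<alpha>\<in>idx \<tau> k.
     \<B> x r \<subseteq> cube \<tau> k \<alpha> \<and> qdiam \<rho> (cube \<tau> k \<alpha>) \<le> ennreal (Cs * r))"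
  using dyadic unfolding adjacent_dyadic_systems_def Let_def by auto

lemma far_point: "\<exists>y. l \<le> \<rho> x y"
proof (rule ccontr)
  assume "\<not> ?thesis"
  then have "\<rho> x y < l" for y by (auto simp: not_le)
  then have "\<rho> y z \<le> 2 * K0 * l" for y z
    using rho_in_ball[of y x l z] by (auto simp: mem_ball less_imp_le)
  then have "qdiam \<rho> UNIV \<le> ennreal (2 * K0 * l)"
    unfolding qdiam_def by (intro SUP_least ennreal_leI) auto
  then show False using qdiam_UNIV by (simp add: top_unique)
qed

text \<open>Walk from \<open>x\<close> to a point outside \<open>\<B> x l\<close> in steps of at
  most \<open>l / (2 * K0)\<close>. The last point before the first exit cannot be close to
  \<open>x\<close>, by the quasi-triangle inequality. Thus the diameter of a ball is comparable to
  its radius.\<close>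

lemma point_at_scale:
  assumes l: "0 < l"
  shows "\<exists>y. l / (2 * K0) \<le> \<rho> x y \<and> \<rho> x y < l"
proof -
  obtain K1 where K1: "0 < K1" "\<And>y z s n. 1 \<le> n \<Longrightarrow> 0 < s \<Longrightarrow> \<rho> y z \<le> real n * s \<Longrightarrow>
     \<exists>xs. xs 0 = y \<and> xs n = z \<and> (\<forall>i<n. \<rho> (xs i) (xs (Suc i)) \<le> K1 * s)"
    by (fact geodesic_chain)
  obtain y where y: "l \<le> \<rho> x y" using far_point by blast
  define s where "s = l / (2 * K0 * K1)"
  have s: "0 < s" using l K0 K1 by (simp add: s_def)
  obtain n :: nat where n: "max 1 (\<rho> x y / s) \<le> real n" using real_arch_simple by blast
  then have "1 \<le> n" "\<rho> x y \<le> real n * s" using s by (auto simp: field_simps)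
  then obtain xs where xs: "xs 0 = x" "xs n = y" "\<And>i. i < n \<Longrightarrow> \<rho> (xs i) (xs (Suc i)) \<le> K1 * s"
    using K1(2)[OF _ s] by blast
  define m where "m = (LEAST i. l \<le> \<rho> x (xs i))"
  have m: "l \<le> \<rho> x (xs m)" "m \<le> n"
    unfolding m_def using y xs(2) by (auto intro: LeastI Least_le)
  have "m \<noteq> 0" using m(1) l xs(1) by (metis not_le rho_refl)
  then obtain i where i: "m = Suc i" by (cases m) auto
  have lt: "\<rho> x (xs i) < l" using not_less_Least[of i "\<lambda>i. l \<le> \<rho> x (xs i)"] i by (simp add: m_def)
  have "K1 * s = l / (2 * K0)" using K1 by (simp add: s_def)
  then have "l \<le> K0 * (\<rho> x (xs i) + l / (2 * K0))"
    using m i rho_tri[of x "xs m" "xs i"] xs(3)[of i] K0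
    by (smt (verit) Suc_le_lessD mult_left_mono)
  then have "l / (2 * K0) \<le> \<rho> x (xs i)" using K0 by (simp add: field_simps)
  then show ?thesis using lt by blast
qed

text \<open>The adjacent systems bound only the diameter of the cube, not its generation.
  \<open>point_at_scale\<close> translates: a far point of \<open>\<B> x l\<close> gives the lower
  bound on \<open>len k\<close>, a far point of the ball inside the cube gives the upper
  bound.\<close>

lemma cube_scale:
  "\<exists>A>0. \<exists>B>0. \<forall>x l. 0 < l \<longrightarrow> (\<exists>\<tau>\<in>{1..K}. \<exists>k. \<exists>\<alpha>\<in>idx \<tau> k.
     \<B> x l \<subseteq> cube \<tau> k \<alpha> \<and> A * l \<le> len k \<and> len k \<le> B * l)"
proof -
  obtain Cs where Cs: "Cs > 0" "\<And>x r. 0 < r \<Longrightarrow> (\<exists>\<tau>\<in>{1..K}. \<exists>k. \<exists>\<alpha>\<in>idx \<tau> k.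
     \<B> x r \<subseteq> cube \<tau> k \<alpha> \<and> qdiam \<rho> (cube \<tau> k \<alpha>) \<le> ennreal (Cs * r))"
    using ball_in_cube by blast
  show ?thesis
  proof (rule exI[of _ "1 / (4 * K0\<^sup>2 * C1)"], rule conjI, use K0 C1 in simp,
      rule exI[of _ "2 * K0 * Cs / c1"], rule conjI, use K0 c1 Cs in simp, intro allI impI)
    fix x l assume l: "(0::real) < l"
    obtain \<tau> k \<alpha> where \<tau>: "\<tau> \<in> {1..K}" "\<alpha> \<in> idx \<tau> k" "\<B> x l \<subseteq> cube \<tau> k \<alpha>"
      "qdiam \<rho> (cube \<tau> k \<alpha>) \<le> ennreal (Cs * l)"
      using Cs(2)[OF l, of x] by blast
    obtain y where y: "l / (2 * K0) \<le> \<rho> x y" "\<rho> x y < l" using point_at_scale[OF l] by blast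
    have "x \<in> cube \<tau> k \<alpha>" "y \<in> cube \<tau> k \<alpha>" using \<tau>(3) y l by (auto simp: mem_ball subset_iff)
    then have "\<rho> x y < 2 * K0 * (C1 * len k)"
      using cube_subset_ball[OF \<tau>(1,2)] by (intro rho_in_ball) auto
    then have "l / (2 * K0) < 2 * K0 * (C1 * len k)" using y by simp
    then have 1: "1 / (4 * K0\<^sup>2 * C1) * l \<le> len k"
      using K0 C1 by (simp add: field_simps power2_eq_square)
    have "0 < c1 * len k" using c1 len_pos by simp
    then obtain w where w: "c1 * len k / (2 * K0) \<le> \<rho> (ctr \<tau> k \<alpha>) w" "\<rho> (ctr \<tau> k \<alpha>) w < c1 * len k"
      using point_at_scale by blast
    have "ctr \<tau> k \<alpha> \<in> cube \<tau> k \<alpha>" "w \<in> cube \<tau> k \<alpha>"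
      using ball_subset_cube[OF \<tau>(1,2)] w c1 len_pos[of k] by (auto simp: mem_ball subset_iff)
    then have "ennreal (\<rho> (ctr \<tau> k \<alpha>) w) \<le> qdiam \<rho> (cube \<tau> k \<alpha>)"
      unfolding qdiam_def by (intro SUP_upper2[of "ctr \<tau> k \<alpha>"] SUP_upper2[of w]) auto
    also note \<tau>(4)
    finally have "\<rho> (ctr \<tau> k \<alpha>) w \<le> Cs * l"
      using Cs(1) l by (subst (asm) ennreal_le_iff) auto
    then have "c1 * len k / (2 * K0) \<le> Cs * l" using w by simp
    then have 2: "len k \<le> 2 * K0 * Cs / c1 * l"
      using K0 c1 by (simp add: field_simps)
    show "\<exists>\<tau>\<in>{1..K}. \<exists>k. \<exists>\<alpha>\<in>idx \<tau> k.
        \<B> x l \<subseteq> cube \<tau> k \<alpha> \<and> 1 / (4 * K0\<^sup>2 * C1) * l \<le> len k \<and> len k \<le> 2 * K0 * Cs / c1 * l"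
      using \<tau> 1 2 by blast
  qed
qed

lemma rect_plus_sets:
  "\<tau> \<in> {1..K} \<Longrightarrow> \<alpha> \<in> idx \<tau> k \<Longrightarrow> rect_plus p \<delta> cube \<gamma> \<tau> k \<alpha> t \<in> sets lam"
  unfolding rect_plus_eq by (intro times_sets cube_sets)

lemma emeasure_cube:
  assumes "\<tau> \<in> {1..K}" "\<alpha> \<in> idx \<tau> k"
  shows "emeasure \<mu> (cube \<tau> k \<alpha>) = ennreal (measure \<mu> (cube \<tau> k \<alpha>))"
    and "0 < measure \<mu> (cube \<tau> k \<alpha>)"
proof -
  have "emeasure \<mu> (cube \<tau> k \<alpha>) \<le> emeasure \<mu> (\<B> (ctr \<tau> k \<alpha>) (C1 * len k))"
    using cube_subset_ball[OF assms] C1 len_pos by (intro emeasure_mono ball_sets) auto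
  also have "\<dots> < \<infinity>" using C1 len_pos by (intro emeasure_ball_finite) auto
  finally show 1: "emeasure \<mu> (cube \<tau> k \<alpha>) = ennreal (measure \<mu> (cube \<tau> k \<alpha>))"
    by (intro emeasure_eq_ennreal_measure) auto
  have "0 < emeasure \<mu> (\<B> (ctr \<tau> k \<alpha>) (c1 * len k))"
    using c1 len_pos by (intro emeasure_ball_pos) auto
  also have "\<dots> \<le> emeasure \<mu> (cube \<tau> k \<alpha>)"
    using ball_subset_cube[OF assms] cube_sets[OF assms] by (intro emeasure_mono) auto
  finally show "0 < measure \<mu> (cube \<tau> k \<alpha>)" unfolding 1 by simp
qed

lemma emeasure_cube_times:
  assumes "\<tau> \<in> {1..K}" "\<alpha> \<in> idx \<tau> k" "a \<le> b"
  shows "emeasure lam (cube \<tau> k \<alpha> \<times> {a<..<b}) = ennreal (measure \<mu> (cube \<tau> k \<alpha>) * (b - a))"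
  using assms by (simp add: emeasure_times cube_sets emeasure_cube ennreal_mult')

section \<open>Testing the weak type inequality\<close>

lemma ennpowr_le_imp:
  assumes le: "ennreal \<xi> * ennpowr x (1 / q) \<le> ennreal C * ennpowr (ennreal y) (1 / q)"
    and "0 < \<xi>" "0 \<le> C" "0 \<le> y"
  shows "x < \<infinity>" and "\<xi> powr q * enn2real x \<le> C powr q * y"
proof -
  have R: "ennreal C * ennpowr (ennreal y) (1 / q) = ennreal (C * y powr (1 / q))"
    using assms by (simp add: ennpowr_ennreal ennreal_mult')
  show x: "x < \<infinity>"
  proof (rule ccontr)
    assume "\<not> x < \<infinity>"
    then show False using le assms(2) unfolding R
      by (simp add: not_less top_unique ennpowr_def ennreal_mult_top)
  qed
  then obtain r where r: "x = ennreal r" "0 \<le> r" by (cases x) auto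
  have "ennreal (\<xi> * r powr (1 / q)) \<le> ennreal (C * y powr (1 / q))"
    using le assms r unfolding R by (simp add: ennpowr_ennreal ennreal_mult')
  then have "\<xi> * r powr (1 / q) \<le> C * y powr (1 / q)"
    using assms by (subst (asm) ennreal_le_iff) auto
  then have "(\<xi> * r powr (1 / q)) powr q \<le> (C * y powr (1 / q)) powr q"
    using assms q_gt_1 by (intro powr_mono2) auto
  then show "\<xi> powr q * enn2real x \<le> C powr q * y"
    using assms r q_gt_1 by (simp add: powr_mult powr_powr)
qed

text \<open>For \<open>f\<close> equal to a truncation of \<open>\<sigma>\<close> on
  \<open>V\<close>, the maximal function is at least the integral of \<open>f\<close> divided by
  \<open>m\<close> on all of \<open>U\<close>, while the \<open>q\<close>-th power of the norm of
  \<open>f\<close> is at most the same integral. Truncation keeps that integral finite, so it may be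
  cancelled before passing to the limit.\<close>

lemma weak_bound_test:
  assumes C: "0 \<le> C"
    and bound: "\<And>f. f \<in> Lq_space \<mu> q \<omega> \<Longrightarrow>
      weak_Lq_norm \<mu> q \<omega> (max_fun \<mu> p \<delta> K idx cube \<gamma> f) \<le> ennreal C * Lq_norm \<mu> q \<omega> f"
    and U: "U \<in> sets lam" "0 < emeasure lam U"
    and V: "V \<in> sets lam" "0 < emeasure lam V" "emeasure lam V < \<infinity>"
    and m: "0 < m"
    and rect: "\<And>x t. (x, t) \<in> U \<Longrightarrow> \<exists>\<tau>\<in>{1..K}. \<exists>k. \<exists>\<alpha>\<in>idx \<tau> k. x \<in> cube \<tau> k \<alpha> \<and>
       V \<subseteq> rect_plus p \<delta> cube \<gamma> \<tau> k \<alpha> t \<and> emeasure lam (rect_plus p \<delta> cube \<gamma> \<tau> k \<alpha> t) \<le> ennreal m"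
  shows "Aq U V ((2 * m * C) powr q)"
proof -
  define f where "f n z = indicator V z * min (sig z) (real n)" for n :: nat and z
  have f_nn: "0 \<le> f n z" for n z by (simp add: f_def sig_nonneg)
  have f_meas [measurable]: "f n \<in> borel_measurable lam" for n
    unfolding f_def using V(1) by measurable
  define In where "In n = (\<integral>\<^sup>+z. ennreal (f n z) \<partial>lam)" for n
  have In_fin: "In n < \<infinity>" for n
  proof -
    have "In n \<le> (\<integral>\<^sup>+z. ennreal (real n) * indicator V z \<partial>lam)"
      unfolding In_def f_def by (intro nn_integral_mono) (auto simp: indicator_def intro!: ennreal_leI)
    also have "\<dots> = ennreal (real n) * emeasure lam V" using V(1) by (simp add: nn_integral_cmult_indicator)
    also have "\<dots> < \<infinity>" using V(3) by (simp add: ennreal_mult_less_top)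
    finally show ?thesis .
  qed
  \<comment> \<open>At \<open>n = 0\<close> the truncation vanishes; this is why the uniform bound
    later goes through \<open>Suc n\<close>.\<close>
  have In_pos: "0 < In n" if "1 \<le> n" for n
  proof (rule ccontr)
    assume "\<not> 0 < In n"
    then have "AE z in lam. f n z = 0"
      unfolding In_def using f_nn by (simp add: nn_integral_0_iff_AE antisym_conv)
    with sig_pos have "AE z in lam. z \<notin> V"
      by eventually_elim (use that in \<open>auto simp: f_def indicator_def min_def split: if_splits\<close>)
    then have "emeasure lam V = 0" using V(1) by (subst (asm) AE_iff_measurable[OF V(1)]) auto
    then show False using V(2) by simp
  qed
  define y where "y n = (\<integral>\<^sup>+z. ennreal (\<bar>f n z\<bar> powr q * \<omega> z) \<partial>lam)" for n
  \<comment> \<open>Since \<open>f n\<close> is at most \<open>\<sigma>\<close>, the factor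
    \<open>f n z powr (q - 1) * \<omega> z\<close> is at most 1 where \<open>f n\<close> is
    positive.\<close>
  have y_le: "y n \<le> In n" for n
    unfolding y_def In_def
  proof (rule nn_integral_mono_AE, use omega_pos in eventually_elim)
    case (elim z)
    show ?case
    proof (cases "f n z = 0")
      case False
      then have pos: "0 < f n z" using f_nn[of n z] by simp
      have e: "(1 - conj_exponent q) * (q - 1) = -1"
        using q_gt_1 by (simp add: conj_exponent_def field_simps)
      have "f n z powr (q - 1) \<le> sig z powr (q - 1)"
        using pos q_gt_1 by (intro powr_mono2) (auto simp: f_def indicator_def sig_nonneg)
      also have "\<dots> = \<omega> z powr (-1)" unfolding sig_def powr_powr e ..
      finally have "f n z powr (q - 1) * \<omega> z \<le> 1" using elim by (simp add: powr_minus field_simps)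
      then have "f n z * (f n z powr (q - 1) * \<omega> z) \<le> f n z * 1"
        using pos by (intro mult_left_mono) auto
      then have "\<bar>f n z\<bar> powr q * \<omega> z \<le> f n z" using pos by (simp add: powr_diff)
      then show ?thesis by (rule ennreal_leI)
    qed simp
  qed
  have key: "emeasure wm U < \<infinity> \<and>
      measure wm U * enn2real (In n) powr (q - 1) \<le> (2 * m * C) powr q" if n: "1 \<le> n" for n
  proof -
    define J where "J = enn2real (In n)"
    have J: "In n = ennreal J" "0 < J"
      using In_fin[of n] In_pos[OF n] by (auto simp: J_def enn2real_positive_iff)
    \<comment> \<open>Half of the lower bound \<open>J / m\<close>, because the level set is defined
      by a strict inequality.\<close>
    define \<xi> where "\<xi> = J / (2 * m)"
    have \<xi>: "0 < \<xi>" using J m by (simp add: \<xi>_def)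
    have "f n \<in> Lq_space \<mu> q \<omega>"
      using In_fin[of n] y_le[of n]
      by (auto simp: Lq_space_def Lq_norm_def y_def ennpowr_def less_top[symmetric] top_unique)
    note b = bound[OF this]
    have sub: "U \<subseteq> {z. max_fun \<mu> p \<delta> K idx cube \<gamma> (f n) z > ennreal \<xi>}"
    proof
      fix z assume z: "z \<in> U"
      obtain x t where xt: "z = (x, t)" by (cases z)
      obtain \<tau> k \<alpha> where r: "\<tau> \<in> {1..K}" "\<alpha> \<in> idx \<tau> k" "x \<in> cube \<tau> k \<alpha>"
        "V \<subseteq> rect_plus p \<delta> cube \<gamma> \<tau> k \<alpha> t" "emeasure lam (rect_plus p \<delta> cube \<gamma> \<tau> k \<alpha> t) \<le> ennreal m"
        using rect z xt by blast
      let ?P = "rect_plus p \<delta> cube \<gamma> \<tau> k \<alpha> t"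
      have "ennreal \<xi> < ennreal (J / m)" using J m by (simp add: \<xi>_def ennreal_less_iff field_simps)
      also have "\<dots> = In n / ennreal m" using J m by (simp add: divide_ennreal)
      also have "In n = (\<integral>\<^sup>+z\<in>?P. ennreal \<bar>f n z\<bar> \<partial>lam)"
        unfolding In_def using r(4) by (intro nn_integral_cong) (auto simp: f_def indicator_def sig_nonneg)
      also have "\<dots> / ennreal m \<le> avg lam ?P (\<lambda>z. ennreal \<bar>f n z\<bar>)"
        unfolding avg_def using r(5) by (intro divide_left_mono_ennreal)
      also have "\<dots> \<le> max_fun \<mu> p \<delta> K idx cube \<gamma> (f n) (x, t)"
        unfolding max_fun_def using r by (auto intro!: SUP_upper2[of "(\<tau>, k, \<alpha>)"])
      finally show "z \<in> {z. max_fun \<mu> p \<delta> K idx cube \<gamma> (f n) z > ennreal \<xi>}" by (simp add: xt)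
    qed
    have "ennreal \<xi> * ennpowr (emeasure wm U) (1 / q)
      \<le> ennreal \<xi> * ennpowr (weighted_measure \<mu> \<omega> {z. max_fun \<mu> p \<delta> K idx cube \<gamma> (f n) z > ennreal \<xi>}) (1 / q)"
      unfolding emeasure_wm[OF U(1)] weighted_measure_def using sub q_gt_1
      by (intro mult_left_mono ennpowr_mono nn_integral_mono) (auto simp: indicator_def)
    also have "\<dots> \<le> weak_Lq_norm \<mu> q \<omega> (max_fun \<mu> p \<delta> K idx cube \<gamma> (f n))"
      unfolding weak_Lq_norm_def using \<xi> by (intro SUP_upper2[of \<xi>]) auto
    also note b
    also have "ennreal C * Lq_norm \<mu> q \<omega> (f n) \<le> ennreal C * ennpowr (ennreal J) (1 / q)"
      unfolding Lq_norm_def y_def[symmetric] J(1)[symmetric]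
      using y_le q_gt_1 by (intro mult_left_mono ennpowr_mono) auto
    finally have *: "ennreal \<xi> * ennpowr (emeasure wm U) (1 / q) \<le> ennreal C * ennpowr (ennreal J) (1 / q)" .
    from ennpowr_le_imp[OF * \<xi> C] J have fin: "emeasure wm U < \<infinity>"
      and le: "\<xi> powr q * measure wm U \<le> C powr q * J" by (auto simp: measure_def)
    have "\<xi> powr q = J * J powr (q - 1) / (2 * m) powr q"
      using J m by (simp add: \<xi>_def powr_divide powr_diff)
    with le have "J * (J powr (q - 1) * measure wm U) \<le> J * (C powr q * (2 * m) powr q)"
      using m by (simp add: pos_divide_le_eq mult_ac)
    then have "J powr (q - 1) * measure wm U \<le> C powr q * (2 * m) powr q"
      using J by simp
    then show ?thesis using fin C m by (simp add: J_def powr_mult mult_ac)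
  qed
  have W: "emeasure wm U < \<infinity>" using key[of 1] by simp
  have "0 < measure wm U"
    using wm_pos[OF U] W by (simp add: measure_def enn2real_positive_iff)
  note W = W this
  \<comment> \<open>\<open>key\<close> solved for \<open>In n\<close>. The bound does not depend on
    \<open>n\<close>, so monotone convergence gives finiteness of the \<open>\<sigma>\<close>-mass
    of \<open>V\<close>.\<close>
  define B where "B = ((2 * m * C) powr q / measure wm U) powr (1 / (q - 1))"
  have In_le: "In n \<le> ennreal B" for n
  proof -
    have "In n \<le> In (Suc n)"
      unfolding In_def f_def by (intro nn_integral_mono ennreal_leI mult_left_mono) auto
    also have "\<dots> = ennreal (enn2real (In (Suc n)))" using In_fin by simp
    also have "\<dots> \<le> ennreal B"
    proof (rule ennreal_leI)
      have "enn2real (In (Suc n)) powr (q - 1) \<le> (2 * m * C) powr q / measure wm U"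
        using key[of "Suc n"] W by (simp add: field_simps)
      then have "(enn2real (In (Suc n)) powr (q - 1)) powr (1 / (q - 1)) \<le> B"
        unfolding B_def using q_gt_1 by (intro powr_mono2) auto
      then show "enn2real (In (Suc n)) \<le> B" using q_gt_1 by (simp add: powr_powr)
    qed
    finally show ?thesis .
  qed
  have "emeasure sm V = (\<integral>\<^sup>+z. (SUP n. ennreal (f n z)) \<partial>lam)"
    unfolding emeasure_sm[OF V(1)]
  proof (rule nn_integral_cong)
    fix z
    show "ennreal (sig z) * indicator V z = (SUP n. ennreal (f n z))"
    proof (rule antisym)
      obtain n :: nat where "sig z \<le> real n" using real_arch_simple by blast
      then show "ennreal (sig z) * indicator V z \<le> (SUP n. ennreal (f n z))"
        by (intro SUP_upper2[of n]) (auto simp: f_def indicator_def min_def)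
      show "(SUP n. ennreal (f n z)) \<le> ennreal (sig z) * indicator V z"
        by (intro SUP_least) (auto simp: f_def indicator_def intro!: ennreal_leI)
    qed
  qed
  also have "\<dots> = (SUP n. In n)"
    unfolding In_def
  proof (rule nn_integral_monotone_convergence_SUP)
    show "incseq (\<lambda>n z. ennreal (f n z))"
      by (intro incseq_SucI le_funI) (auto simp: f_def indicator_def intro!: ennreal_leI)
  qed measurable
  also have "\<dots> \<le> ennreal B" by (intro SUP_least In_le)
  finally have S: "emeasure sm V \<le> ennreal B" .
  have B: "0 \<le> B" by (simp add: B_def)
  have "measure sm V \<le> B" using enn2real_mono[OF S] B by (simp add: measure_def)
  then have "measure wm U * measure sm V powr (q - 1) \<le> measure wm U * B powr (q - 1)"
    using q_gt_1 by (intro mult_left_mono powr_mono2) auto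
  also have "\<dots> = (2 * m * C) powr q"
    using q_gt_1 W by (simp add: B_def powr_powr)
  finally show ?thesis using W S by (auto simp: Aq_def less_top[symmetric] top_unique)
qed

lemma weak_bound_imp_short_lags:
  assumes \<gamma>: "0 < \<gamma>" "\<gamma> < 1"
    and bounded: "bounded_Lq_weak_Lq \<mu> q \<omega> (max_fun \<mu> p \<delta> K idx cube \<gamma>)"
  shows "\<exists>\<eta>>0. \<exists>A>0. \<exists>B>0. \<exists>C\<ge>0. \<forall>x l. 0 < l \<longrightarrow> (\<exists>L. A * l powr p \<le> L \<and> L \<le> B * l powr p \<and>
     (\<forall>a \<theta>. (1 + 3 * \<gamma>) / 4 \<le> \<theta> \<longrightarrow> \<theta> \<le> (3 + \<gamma>) / 4 \<longrightarrow>
       Aq (box x l a (\<eta> * l powr p)) (box x l (a + \<theta> * L) (\<eta> * l powr p)) (C * vol x l powr q)))"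
proof -
  obtain Cw :: real where "\<forall>f\<in>Lq_space \<mu> q \<omega>.
      weak_Lq_norm \<mu> q \<omega> (max_fun \<mu> p \<delta> K idx cube \<gamma> f) \<le> ennreal Cw * Lq_norm \<mu> q \<omega> f"
    using bounded unfolding bounded_Lq_weak_Lq_def by blast
  \<comment> \<open>\<open>ennreal\<close> sends negative reals to 0, so the constant may be taken
    nonnegative.\<close>
  moreover have "ennreal Cw = ennreal (max 0 Cw)"
    by (cases "0 \<le> Cw") (auto simp: ennreal_neg max_def)
  ultimately have Cw: "weak_Lq_norm \<mu> q \<omega> (max_fun \<mu> p \<delta> K idx cube \<gamma> f) \<le> ennreal (max 0 Cw) * Lq_norm \<mu> q \<omega> f"
    if "f \<in> Lq_space \<mu> q \<omega>" for f using that by simp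
  obtain A B where A: "A > 0" and B: "B > 0" and sc: "\<And>x l. 0 < l \<Longrightarrow> (\<exists>\<tau>\<in>{1..K}. \<exists>k. \<exists>\<alpha>\<in>idx \<tau> k.
     \<B> x l \<subseteq> cube \<tau> k \<alpha> \<and> A * l \<le> len k \<and> len k \<le> B * l)"
    using cube_scale by blast
  define \<kappa> where "\<kappa> = C1 * B"
  have \<kappa>: "\<kappa> > 0" using C1 B by (simp add: \<kappa>_def)
  obtain D where D: "D > 0" "\<And>x y r s. 0 < r \<Longrightarrow> 0 < s \<Longrightarrow> s \<le> \<kappa> * r \<Longrightarrow>
      \<rho> x y \<le> \<kappa> * r \<Longrightarrow> measure \<mu> (\<B> y s) \<le> D * measure \<mu> (\<B> x r)"
    using doubling_general[of \<kappa>] by blast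
  \<comment> \<open>The half-height is then at most \<open>(1 - \<gamma>) / 8 * L\<close>. Moving
    the base point within the first box and the height of the second cost this twice, which the
    margin \<open>(1 - \<gamma>) / 4 * L\<close> allows.\<close>
  define \<eta> where "\<eta> = (1 - \<gamma>) / 8 * A powr p"
  have \<eta>: "\<eta> > 0" using A \<gamma> by (simp add: \<eta>_def)
  show ?thesis
  proof (rule exI[of _ \<eta>], rule conjI[OF \<eta>], rule exI[of _ "A powr p"], rule conjI, use A in simp,
      rule exI[of _ "B powr p"], rule conjI, use B in simp,
      rule exI[of _ "(2 * (D * B powr p) * max 0 Cw) powr q"], rule conjI, simp, intro allI impI)
    fix x l assume l: "(0::real) < l"
    obtain \<tau> k \<alpha> where t: "\<tau> \<in> {1..K}" "\<alpha> \<in> idx \<tau> k" "\<B> x l \<subseteq> cube \<tau> k \<alpha>"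
      "A * l \<le> len k" "len k \<le> B * l" using sc[OF l] by blast
    let ?L = "dur k" and ?h = "\<eta> * l powr p"
    have L1: "A powr p * l powr p \<le> ?L"
      unfolding dur_def using powr_mono2[OF _ _ t(4), of p] A l p_gt_1 by (simp add: powr_mult)
    have L2: "?L \<le> B powr p * l powr p"
      unfolding dur_def using powr_mono2[OF _ _ t(5), of p] B l p_gt_1 len_pos[of k]
      by (simp add: powr_mult)
    have h: "0 < ?h" "?h \<le> (1 - \<gamma>) / 8 * ?L"
    proof -
      show "0 < ?h" using \<eta> l by simp
      show "?h \<le> (1 - \<gamma>) / 8 * ?L"
        using mult_left_mono[OF L1, of "(1 - \<gamma>) / 8"] \<gamma> by (simp add: \<eta>_def mult.assoc)
    qed
    have mu: "measure \<mu> (cube \<tau> k \<alpha>) \<le> D * measure \<mu> (\<B> x l)"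
    proof -
      have le: "C1 * len k \<le> \<kappa> * l" using t(5) C1 by (simp add: \<kappa>_def)
      have "x \<in> \<B> x l" using l by (simp add: mem_ball)
      then have "\<rho> (ctr \<tau> k \<alpha>) x < C1 * len k"
        using t(3) cube_subset_ball[OF t(1,2)] by (auto simp: mem_ball subset_iff)
      then have "\<rho> x (ctr \<tau> k \<alpha>) \<le> \<kappa> * l" using le by (simp add: rho_sym)
      then have "measure \<mu> (\<B> (ctr \<tau> k \<alpha>) (C1 * len k)) \<le> D * measure \<mu> (\<B> x l)"
        using le l C1 len_pos by (intro D) auto
      moreover have "measure \<mu> (cube \<tau> k \<alpha>) \<le> measure \<mu> (\<B> (ctr \<tau> k \<alpha>) (C1 * len k))"
        using cube_subset_ball[OF t(1,2)] cube_sets[OF t(1,2)] C1 len_pos emeasure_ball_finite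
        by (intro measure_mono_fmeasurable) (auto simp: fmeasurable_def)
      ultimately show ?thesis by simp
    qed
    define m where "m = D * B powr p * vol x l"
    have m: "0 < m" using D B vol_pos[OF l] by (simp add: m_def)
    show "\<exists>L. A powr p * l powr p \<le> L \<and> L \<le> B powr p * l powr p \<and>
     (\<forall>a \<theta>. (1 + 3 * \<gamma>) / 4 \<le> \<theta> \<longrightarrow> \<theta> \<le> (3 + \<gamma>) / 4 \<longrightarrow>
       Aq (box x l a ?h) (box x l (a + \<theta> * L) ?h)
        ((2 * (D * B powr p) * max 0 Cw) powr q * vol x l powr q))"
    proof (rule exI[of _ ?L], intro conjI L1 L2 allI impI)
      fix a \<theta> assume \<theta>: "(1 + 3 * \<gamma>) / 4 \<le> \<theta>" "\<theta> \<le> (3 + \<gamma>) / 4"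
      have \<theta>L: "(1 + 3 * \<gamma>) / 4 * ?L \<le> \<theta> * ?L" "\<theta> * ?L \<le> (3 + \<gamma>) / 4 * ?L"
        using \<theta> dur_pos[of k] by (auto intro!: mult_right_mono)
      have bx: "box x l b ?h \<in> sets lam" "0 < emeasure lam (box x l b ?h)"
        "emeasure lam (box x l b ?h) < \<infinity>" for b
        using box_sets[OF l] emeasure_box_pos[OF l h(1)] emeasure_box[OF l h(1)] by (simp_all only:) simp
      have "Aq (box x l a ?h) (box x l (a + \<theta> * ?L) ?h) ((2 * m * max 0 Cw) powr q)"
      proof (rule weak_bound_test[OF _ Cw])
        fix x' s assume xs: "(x', s) \<in> box x l a ?h"
        then have x': "x' \<in> \<B> x l" and s: "a - ?h < s" "s < a + ?h" by (auto simp: box_def)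
        have sub: "box x l (a + \<theta> * ?L) ?h \<subseteq> rect_plus p \<delta> cube \<gamma> \<tau> k \<alpha> s"
          unfolding box_def rect_plus_eq
        proof (intro Sigma_mono t(3))
          have "s + \<gamma> * ?L \<le> a + \<theta> * ?L - ?h" "a + \<theta> * ?L + ?h \<le> s + ?L"
            using s h(2) \<theta>L by (auto simp: field_simps)
          then show "{a + \<theta> * ?L - ?h<..<a + \<theta> * ?L + ?h} \<subseteq> {s + \<gamma> * ?L<..<s + ?L}" by auto
        qed
        have "\<gamma> * ?L \<le> ?L" using \<gamma> dur_pos[of k] by simp
        then have "emeasure lam (rect_plus p \<delta> cube \<gamma> \<tau> k \<alpha> s)
            = ennreal (measure \<mu> (cube \<tau> k \<alpha>) * (s + ?L - (s + \<gamma> * ?L)))"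
          unfolding rect_plus_eq using t by (intro emeasure_cube_times) auto
        also have "\<dots> \<le> ennreal m"
        proof (rule ennreal_leI)
          have "s + ?L - (s + \<gamma> * ?L) \<le> ?L" using \<gamma> dur_pos[of k] by simp
          then have "s + ?L - (s + \<gamma> * ?L) \<le> B powr p * l powr p" using L2 by simp
          then have "measure \<mu> (cube \<tau> k \<alpha>) * (s + ?L - (s + \<gamma> * ?L))
            \<le> (D * measure \<mu> (\<B> x l)) * (B powr p * l powr p)"
            using mu D \<open>\<gamma> * ?L \<le> ?L\<close> by (intro mult_mono) auto
          then show "measure \<mu> (cube \<tau> k \<alpha>) * (s + ?L - (s + \<gamma> * ?L)) \<le> m"
            by (simp add: m_def vol_def mult_ac)
        qed
        finally show "\<exists>\<tau>\<in>{1..K}. \<exists>k. \<exists>\<alpha>\<in>idx \<tau> k. x' \<in> cube \<tau> k \<alpha> \<and>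
            box x l (a + \<theta> * ?L) ?h \<subseteq> rect_plus p \<delta> cube \<gamma> \<tau> k \<alpha> s \<and>
            emeasure lam (rect_plus p \<delta> cube \<gamma> \<tau> k \<alpha> s) \<le> ennreal m"
          using t x' sub by blast
      qed (use bx m in auto)
      moreover have "(2 * m * max 0 Cw) powr q = (2 * (D * B powr p) * max 0 Cw) powr q * vol x l powr q"
        using D B vol_pos[OF l, of x] by (simp add: m_def flip: powr_mult) (simp add: mult_ac)
      ultimately show "Aq (box x l a ?h) (box x l (a + \<theta> * ?L) ?h)
        ((2 * (D * B powr p) * max 0 Cw) powr q * vol x l powr q)" by simp
    qed
  qed
qed

text \<open>
  The dyadic generation, hence the lag \<open>\<theta> L\<close>, is dictated by the cube containing \<open>B(x, l)\<close>.
  Iterating within that cube, with \<open>\<theta>\<close> adjusted, produces one lag proportional to \<open>l\<^sup>p\<close>.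
\<close>

lemma weak_bound_imp_lagged:
  assumes \<gamma>: "0 < \<gamma>" "\<gamma> < 1"
    and bounded: "bounded_Lq_weak_Lq \<mu> q \<omega> (max_fun \<mu> p \<delta> K idx cube \<gamma>)"
  shows "\<exists>\<theta>>0. \<exists>\<eta>>0. lagged \<theta> \<eta>"
proof -
  define \<theta>0 where "\<theta>0 = (1 + 3 * \<gamma>) / 4"
  define \<theta>1 where "\<theta>1 = (3 + \<gamma>) / 4"
  have \<theta>01: "0 < \<theta>0" "\<theta>0 < \<theta>1" using \<gamma> by (auto simp: \<theta>0_def \<theta>1_def)
  obtain \<eta> A B C where \<eta>: "\<eta> > 0" and A: "A > 0" and B: "B > 0" and C: "C \<ge> 0" and
    lags: "\<And>x l. 0 < l \<Longrightarrow> (\<exists>L. A * l powr p \<le> L \<and> L \<le> B * l powr p \<and>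
     (\<forall>a \<theta>. \<theta>0 \<le> \<theta> \<longrightarrow> \<theta> \<le> \<theta>1 \<longrightarrow>
       Aq (box x l a (\<eta> * l powr p)) (box x l (a + \<theta> * L) (\<eta> * l powr p)) (C * vol x l powr q)))"
    using weak_bound_imp_short_lags[OF assms] unfolding \<theta>0_def \<theta>1_def by blast
  define E where "E = max 1 (C * (2 * (1 / (2 * \<eta>))) powr q)"
  have E: "1 \<le> E" by (simp add: E_def)
  \<comment> \<open>A number \<open>v \<ge> \<theta>0 * \<theta>1 / (\<theta>1 - \<theta>0)\<close>
    lies in \<open>[N * \<theta>0, N * \<theta>1]\<close> for \<open>N\<close> the ceiling of
    \<open>v / \<theta>1\<close>. The factor \<open>B\<close> brings
    \<open>v = \<Theta> * l powr p / L\<close> above this threshold for every admissible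
    \<open>L\<close>.\<close>
  define \<Theta> where "\<Theta> = B * \<theta>0 * \<theta>1 / (\<theta>1 - \<theta>0)"
  have \<Theta>: "\<Theta> > 0" using B \<theta>01 by (simp add: \<Theta>_def)
  define M where "M = nat \<lceil>\<Theta> / A / \<theta>1\<rceil>"
  have "lagged \<Theta> \<eta>"
    unfolding lagged_def
  proof (intro exI[of _ "E ^ M * C"] conjI allI impI)
    show "0 \<le> E ^ M * C" using E C by simp
    fix x a l assume l: "(0::real) < l"
    have lp: "0 < l powr p" using l by simp
    obtain L where L: "A * l powr p \<le> L" "L \<le> B * l powr p" and
      lag: "\<And>a \<theta>. \<theta>0 \<le> \<theta> \<Longrightarrow> \<theta> \<le> \<theta>1 \<Longrightarrow>
       Aq (box x l a (\<eta> * l powr p)) (box x l (a + \<theta> * L) (\<eta> * l powr p)) (C * vol x l powr q)"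
      using lags[OF l] by blast
    let ?b = "\<lambda>a. box x l a (\<eta> * l powr p)"
    have L0: "0 < L" using L(1) A lp by (smt (verit) mult_pos_pos)
    define v where "v = \<Theta> * l powr p / L"
    have v: "0 < v" using \<Theta> lp L0 by (simp add: v_def)
    have "\<Theta> * l powr p / (B * l powr p) \<le> v"
      unfolding v_def using L L0 \<Theta> lp by (intro divide_left_mono) auto
    then have v1: "\<theta>0 * \<theta>1 / (\<theta>1 - \<theta>0) \<le> v" using B lp by (simp add: \<Theta>_def)
    have "v \<le> \<Theta> * l powr p / (A * l powr p)"
      unfolding v_def using L L0 \<Theta> lp A by (intro divide_left_mono) auto
    then have v2: "v \<le> \<Theta> / A" using lp by simp
    \<comment> \<open>One less than the number \<open>N\<close> of lags: the last lag is kept for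
      the passage from \<open>\<omega>\<close> to \<open>\<sigma>\<close>.\<close>
    define n where "n = nat \<lceil>v / \<theta>1\<rceil> - 1"
    define N where "N = real (Suc n)"
    have "0 < v / \<theta>1" using v \<theta>01 by simp
    then have n: "real n < v / \<theta>1" "v / \<theta>1 \<le> N" unfolding n_def N_def by linarith+
    have "v / \<theta>1 \<le> \<Theta> / A / \<theta>1" using v2 \<theta>01 by (intro divide_right_mono) auto
    then have nM: "n \<le> M" using n(1) unfolding M_def by linarith
    define \<theta> where "\<theta> = v / N"
    have N: "0 < N" "N = real n + 1" by (auto simp: N_def)
    have \<theta>: "\<theta>0 \<le> \<theta>" "\<theta> \<le> \<theta>1"
    proof -
      have "\<theta>0 * \<theta>1 \<le> v * (\<theta>1 - \<theta>0)" using v1 \<theta>01 by (simp add: pos_divide_le_eq)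
      moreover have "\<theta>0 * (N * \<theta>1) \<le> \<theta>0 * (v + \<theta>1)"
        using n(1) \<theta>01 N by (intro mult_left_mono) (auto simp: field_simps)
      ultimately have "(\<theta>0 * N) * \<theta>1 \<le> v * \<theta>1" by (simp add: algebra_simps)
      then have "\<theta>0 * N \<le> v" using \<theta>01 by simp
      then show "\<theta>0 \<le> \<theta>" using N by (simp add: \<theta>_def field_simps)
      show "\<theta> \<le> \<theta>1" using n(2) N \<theta>01 by (simp add: \<theta>_def field_simps)
    qed
    note lag = lag[OF \<theta>]
    have fin: "emeasure wm (?b a) < \<infinity>" for a using lag by (auto simp: Aq_def)
    have h: "0 < \<eta> * l powr p" using \<eta> lp by simp
    have step: "measure wm (?b a) \<le> E * measure wm (?b (a + \<theta> * L))" for a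
    proof -
      have "measure wm (?b a) \<le> C * (2 * (1 / (2 * \<eta>))) powr q * measure wm (?b (a + \<theta> * L))"
        using l h \<eta> C fin vol_pos[OF l, of x]
        by (intro Aq_absorb[OF lag] measure_box_pos) (auto simp: box_sets measure_box vol_def)
      also have "\<dots> \<le> E * measure wm (?b (a + \<theta> * L))"
        by (intro mult_right_mono) (auto simp: E_def)
      finally show ?thesis .
    qed
    have chain: "measure wm (?b a) \<le> E ^ j * measure wm (?b (a + real j * (\<theta> * L)))" for j
    proof (induction j)
      case (Suc j)
      have "E ^ j * measure wm (?b (a + real j * (\<theta> * L)))
        \<le> E ^ j * (E * measure wm (?b (a + real j * (\<theta> * L) + \<theta> * L)))"
        using E by (intro mult_left_mono step) auto
      with Suc show ?case by (simp add: algebra_simps)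
    qed simp
    have "N * (\<theta> * L) = \<Theta> * l powr p" using N L0 by (simp add: \<theta>_def v_def)
    then have last_lag: "a + real n * (\<theta> * L) + \<theta> * L = a + \<Theta> * l powr p"
      using N by (simp add: algebra_simps)
    have last: "Aq (?b (a + real n * (\<theta> * L))) (?b (a + \<Theta> * l powr p)) (C * vol x l powr q)"
      using lag[of "a + real n * (\<theta> * L)"] unfolding last_lag .
    let ?S = "measure sm (?b (a + \<Theta> * l powr p)) powr (q - 1)"
    have "measure wm (?b a) * ?S \<le> (E ^ n * measure wm (?b (a + real n * (\<theta> * L)))) * ?S"
      by (intro mult_right_mono chain) auto
    also have "\<dots> \<le> E ^ n * (C * vol x l powr q)"
      using last E by (auto simp: Aq_def mult.assoc intro!: mult_left_mono)
    also have "\<dots> \<le> E ^ M * (C * vol x l powr q)"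
      using nM E C by (intro mult_right_mono power_increasing) auto
    finally show "Aq (?b a) (?b (a + \<Theta> * l powr p)) (E ^ M * C * vol x l powr q)"
      using last fin by (auto simp: Aq_def mult.assoc)
  qed
  then show ?thesis using \<Theta> \<eta> by blast
qed

subsection \<open>The weak type inequality\<close>

text \<open>Slab and front are separated by a time gap \<open>\<gamma> / 2 * dur k\<close>, so both
  fit into the halves of one cylinder centred in the gap. The ball covering the cube makes this
  cylinder taller than the rectangle, so its lag must be smaller than \<open>\<gamma>\<close>: the
  condition is needed for other lags.\<close>

lemma A_plus_rect:
  assumes \<gamma>: "0 < \<gamma>" "\<gamma> < 1"
    and Ap: "\<And>\<gamma>. 0 < \<gamma> \<Longrightarrow> \<gamma> < 1 \<Longrightarrow> \<omega> \<in> A_plus \<rho> \<mu> p q \<gamma>"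
  shows "\<exists>C\<ge>0. \<forall>\<tau>\<in>{1..K}. \<forall>k t. \<forall>\<alpha>\<in>idx \<tau> k.
    Aq (cube \<tau> k \<alpha> \<times> {t - \<gamma> / 2 * dur k<..<t + \<gamma> / 2 * dur k}) (rect_plus p \<delta> cube \<gamma> \<tau> k \<alpha> t)
      (C * measure lam (rect_plus p \<delta> cube \<gamma> \<tau> k \<alpha> t) powr q)"
proof -
  define b where "b = max C1 2"
  have b: "C1 \<le> b" "2 \<le> b" by (auto simp: b_def)
  define H where "H = b powr p"
  have H: "2 \<le> H"
  proof -
    have "2 powr 1 \<le> b powr 1" using b by (intro powr_mono2) auto
    also have "\<dots> \<le> b powr p" using b p_gt_1 by (intro powr_mono) auto
    finally show ?thesis by (simp add: H_def)
  qed
  \<comment> \<open>The cylinder has time scale \<open>H * dur k\<close>, so its lag on either side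
    of the centre is \<open>\<gamma> / 4 * dur k\<close>, half of the gap.\<close>
  define \<gamma>' where "\<gamma>' = \<gamma> / (4 * H)"
  have \<gamma>': "0 < \<gamma>'" "\<gamma>' < 1" using \<gamma> H by (auto simp: \<gamma>'_def field_simps)
  obtain C where C: "C \<ge> 0" "\<And>x t l. 0 < l \<Longrightarrow>
      Aq (cyl_minus \<rho> p \<gamma>' x t l) (cyl_plus \<rho> p \<gamma>' x t l) (C * vol x l powr q)"
    using Ap[OF \<gamma>'] A_plus_iff[of \<gamma>'] \<gamma>' by auto
  define \<kappa> where "\<kappa> = b / c1"
  have \<kappa>: "0 < \<kappa>" using b c1 by (simp add: \<kappa>_def)
  obtain D where D: "D > 0" "\<And>x y r s. 0 < r \<Longrightarrow> 0 < s \<Longrightarrow> s \<le> \<kappa> * r \<Longrightarrow>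
      \<rho> x y \<le> \<kappa> * r \<Longrightarrow> measure \<mu> (\<B> y s) \<le> D * measure \<mu> (\<B> x r)"
    using doubling_general[of \<kappa>] by blast
  define E where "E = D * H / (1 - \<gamma>)"
  have E: "0 \<le> E" using D H \<gamma> by (simp add: E_def)
  show ?thesis
  proof (rule exI[of _ "C * E powr q"], intro conjI ballI allI)
    show "0 \<le> C * E powr q" using C by simp
    fix \<tau> k t \<alpha> assume \<tau>: "\<tau> \<in> {1..K}" and \<alpha>: "\<alpha> \<in> idx \<tau> k"
    let ?Q = "cube \<tau> k \<alpha>" and ?L = "dur k" and ?z = "ctr \<tau> k \<alpha>" and ?P = "rect_plus p \<delta> cube \<gamma> \<tau> k \<alpha> t"
    define l where "l = b * len k"
    have l: "0 < l" using b len_pos[of k] by (simp add: l_def)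
    have lp: "l powr p = H * ?L" using b len_pos[of k] by (simp add: l_def H_def dur_def powr_mult)
    have Q: "?Q \<subseteq> \<B> ?z l"
      using cube_subset_ball[OF \<tau> \<alpha>] b len_pos[of k] ball_mono[of "C1 * len k" l ?z]
      by (auto simp: l_def)
    have mP: "measure lam ?P = measure \<mu> ?Q * ((1 - \<gamma>) * ?L)"
      unfolding rect_plus_eq using \<gamma> dur_pos[of k] cube_sets[OF \<tau> \<alpha>]
      by (subst measure_times) (auto simp: algebra_simps)
    have "measure \<mu> (\<B> ?z l) \<le> D * measure \<mu> (\<B> ?z (c1 * len k))"
      using l c1 len_pos[of k] \<kappa> by (intro D(2)) (auto simp: l_def \<kappa>_def)
    also have "\<dots> \<le> D * measure \<mu> ?Q"
      using D ball_subset_cube[OF \<tau> \<alpha>] cube_sets[OF \<tau> \<alpha>] emeasure_cube[OF \<tau> \<alpha>] c1 len_pos[of k]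
      by (intro mult_left_mono measure_mono_fmeasurable) (auto simp: fmeasurable_def)
    finally have "vol ?z l \<le> D * measure \<mu> ?Q * (H * ?L)"
      unfolding vol_def lp using H dur_pos[of k] by (intro mult_right_mono) auto
    also have "\<dots> = E * measure lam ?P" unfolding mP E_def using \<gamma> by simp
    finally have "vol ?z l powr q \<le> (E * measure lam ?P) powr q"
      using vol_pos[OF l, of ?z] q_gt_1 by (intro powr_mono2) auto
    also have "\<dots> = E powr q * measure lam ?P powr q" using E by (simp add: powr_mult)
    finally have le: "C * vol ?z l powr q \<le> C * E powr q * measure lam ?P powr q"
      using C(1) by (simp add: mult.assoc mult_left_mono)
    have sets: "cyl_minus \<rho> p \<gamma>' ?z s l \<in> sets lam" "cyl_plus \<rho> p \<gamma>' ?z s l \<in> sets lam" for s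
      using l by (auto simp: cyl_minus_box cyl_plus_box box_sets)
    have g: "\<gamma>' * (H * ?L) = \<gamma> / 4 * ?L" using H by (simp add: \<gamma>'_def)
    have HL: "2 * ?L \<le> H * ?L" "0 < ?L" "\<gamma> * ?L < ?L" "0 < \<gamma> * ?L" using H dur_pos[of k] \<gamma> by auto
    \<comment> \<open>The middle of the gap between \<open>t + \<gamma> / 2 * ?L\<close> and
      \<open>t + \<gamma> * ?L\<close>.\<close>
    define s where "s = t + 3 / 4 * (\<gamma> * ?L)"
    show "Aq (?Q \<times> {t - \<gamma> / 2 * ?L<..<t + \<gamma> / 2 * ?L}) ?P (C * E powr q * measure lam ?P powr q)"
    proof (rule Aq_mono[OF C(2)[OF l, of ?z s] sets(1) sets(2) _ _ _ _ le])
      show "?Q \<times> {t - \<gamma> / 2 * ?L<..<t + \<gamma> / 2 * ?L} \<in> sets lam" by (intro times_sets cube_sets[OF \<tau> \<alpha>])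
      show "?P \<in> sets lam" by (rule rect_plus_sets[OF \<tau> \<alpha>])
      show "?Q \<times> {t - \<gamma> / 2 * ?L<..<t + \<gamma> / 2 * ?L} \<subseteq> cyl_minus \<rho> p \<gamma>' ?z s l"
        unfolding cyl_minus_def lp g s_def
        by (intro Sigma_mono Q subsetI) (simp only: greaterThanLessThan_iff, use HL in linarith)
      show "?P \<subseteq> cyl_plus \<rho> p \<gamma>' ?z s l"
        unfolding cyl_plus_def rect_plus_eq lp g s_def
        by (intro Sigma_mono Q subsetI) (simp only: greaterThanLessThan_iff, use HL in linarith)
    qed
  qed
qed

text \<open>Centres of one generation are separated, so by \<open>packing\<close> only finitely many
  lie in each ball around a fixed point.\<close>

lemma countable_idx:
  assumes \<tau>: "\<tau> \<in> {1..K}"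
  shows "countable (idx \<tau> k)"
proof -
  fix x0 :: 'a
  define A where "A n = {\<alpha> \<in> idx \<tau> k. \<rho> x0 (ctr \<tau> k \<alpha>) < real (Suc n)}" for n
  have fin: "finite (A n)" for n
  proof -
    have "0 < c0 * len k / real (Suc n)" using c0 len_pos by simp
    from packing[OF this] obtain M :: nat where "\<forall>x l F. 0 < l \<longrightarrow> finite F \<longrightarrow> F \<subseteq> \<B> x l \<longrightarrow>
     (\<forall>y\<in>F. \<forall>z\<in>F. y \<noteq> z \<longrightarrow> c0 * len k / real (Suc n) * l \<le> \<rho> y z) \<longrightarrow> card F \<le> M" ..
    note M = this[rule_format]
    have "card F \<le> M" if F: "F \<subseteq> A n" "finite F" for F
    proof -
      have sep: "c0 * len k \<le> \<rho> (ctr \<tau> k \<alpha>) (ctr \<tau> k \<beta>)" if "\<alpha> \<in> F" "\<beta> \<in> F" "\<alpha> \<noteq> \<beta>" for \<alpha> \<beta>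
        using ctr_sep[OF \<tau>] that F by (auto simp: A_def)
      have inj: "inj_on (ctr \<tau> k) F"
      proof (rule inj_onI, rule ccontr)
        fix \<alpha> \<beta> assume "\<alpha> \<in> F" "\<beta> \<in> F" "ctr \<tau> k \<alpha> = ctr \<tau> k \<beta>" "\<alpha> \<noteq> \<beta>"
        with sep[of \<alpha> \<beta>] have "c0 * len k \<le> 0" by simp
        then show False using c0 len_pos[of k] by (simp add: mult_le_0_iff)
      qed
      have "card (ctr \<tau> k ` F) \<le> M"
      proof (rule M[of "real (Suc n)" _ x0])
        show "ctr \<tau> k ` F \<subseteq> \<B> x0 (real (Suc n))" using F by (auto simp: A_def mem_ball)
        fix y z assume "y \<in> ctr \<tau> k ` F" "z \<in> ctr \<tau> k ` F" "y \<noteq> z"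
        then show "c0 * len k / real (Suc n) * real (Suc n) \<le> \<rho> y z" using sep by fastforce
      qed (use F in auto)
      then show ?thesis using inj by (simp add: card_image)
    qed
    then show ?thesis using finite_if_finite_subsets_card_bdd[of "A n" M] by blast
  qed
  have "idx \<tau> k \<subseteq> (\<Union>n. A n)"
  proof
    fix \<alpha> assume "\<alpha> \<in> idx \<tau> k"
    moreover obtain n :: nat where "\<rho> x0 (ctr \<tau> k \<alpha>) < real n" using reals_Archimedean2 by blast
    ultimately show "\<alpha> \<in> (\<Union>n. A n)" by (auto simp: A_def intro!: exI[of _ n])
  qed
  then show ?thesis
    using fin by (meson countable_UN countable_finite countable_subset countableI_type)
qed

section \<open>The weak type estimate within one dyadic system\<close>

context
  fixes \<gamma> C :: real and f :: "'a \<times> real \<Rightarrow> real" and \<tau> :: nat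
begin

definition fm :: "('a \<times> real) measure" where
  "fm = density lam (\<lambda>z. ennreal \<bar>f z\<bar>)"

definition fqm :: "('a \<times> real) measure" where
  "fqm = density lam (\<lambda>z. ennreal (\<bar>f z\<bar> powr q * \<omega> z))"

text \<open>The parabolic rectangle with its time interval scaled by \<open>c\<close> about the
  centre; \<open>slab 1\<close> is the rectangle itself.\<close>

definition slab :: "real \<Rightarrow> int \<times> 'i \<times> real \<Rightarrow> ('a \<times> real) set" where
  "slab c = (\<lambda>(k, \<alpha>, t). cube \<tau> k \<alpha> \<times> {t - c * dur k<..<t + c * dur k})"

definition front :: "int \<times> 'i \<times> real \<Rightarrow> ('a \<times> real) set" where
  "front = (\<lambda>(k, \<alpha>, t). rect_plus p \<delta> cube \<gamma> \<tau> k \<alpha> t)"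

lemma sets_fm [simp, measurable_cong]: "sets fm = sets lam"
  and sets_fqm [simp, measurable_cong]: "sets fqm = sets lam"
  by (simp_all add: fm_def fqm_def)

context
  assumes \<gamma>: "0 < \<gamma>" "\<gamma> < 1" and C: "0 \<le> C"
    and Aq_rect: "\<And>\<tau> k t \<alpha>. \<tau> \<in> {1..K} \<Longrightarrow> \<alpha> \<in> idx \<tau> k \<Longrightarrow>
      Aq (cube \<tau> k \<alpha> \<times> {t - \<gamma> / 2 * dur k<..<t + \<gamma> / 2 * dur k}) (rect_plus p \<delta> cube \<gamma> \<tau> k \<alpha> t)
        (C * measure lam (rect_plus p \<delta> cube \<gamma> \<tau> k \<alpha> t) powr q)"
    and f [measurable]: "f \<in> borel_measurable lam"
    and \<tau>: "\<tau> \<in> {1..K}"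
begin

lemma slab_sets: "fst (snd i) \<in> idx \<tau> (fst i) \<Longrightarrow> slab c i \<in> sets lam"
  unfolding slab_def by (cases i) (auto intro!: times_sets cube_sets[OF \<tau>])

lemma front_sets: "fst (snd i) \<in> idx \<tau> (fst i) \<Longrightarrow> front i \<in> sets lam"
  unfolding front_def by (cases i) (auto intro!: rect_plus_sets[OF \<tau>])

lemma emeasure_front:
  assumes "\<alpha> \<in> idx \<tau> k"
  shows "emeasure lam (front (k, \<alpha>, t)) = ennreal ((1 - \<gamma>) * (measure \<mu> (cube \<tau> k \<alpha>) * dur k))"
proof -
  have "t + dur k - (t + \<gamma> * dur k) = (1 - \<gamma>) * dur k" by (simp add: algebra_simps)
  moreover have "t + \<gamma> * dur k \<le> t + dur k" using \<gamma> dur_pos[of k] by simp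
  ultimately show ?thesis
    using emeasure_cube_times[OF \<tau> assms] by (simp add: front_def rect_plus_eq mult_ac)
qed

lemma emeasure_slab:
  assumes "\<alpha> \<in> idx \<tau> k" "0 \<le> c"
  shows "emeasure lam (slab c (k, \<alpha>, t)) = ennreal (2 * c * (measure \<mu> (cube \<tau> k \<alpha>) * dur k))"
proof -
  have "t - c * dur k \<le> t + c * dur k" using assms dur_pos[of k] by simp
  then show ?thesis
    using emeasure_cube_times[OF \<tau> assms(1)] by (simp add: slab_def mult_ac)
qed

context
  assumes fq_finite: "emeasure fqm UNIV < \<infinity>"
begin

lemma fqm_finite: "E \<in> sets lam \<Longrightarrow> emeasure fqm E < \<infinity>"
  using emeasure_mono[of E UNIV fqm] fq_finite sets.top[of lam] by (simp add: le_less_trans)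

lemma hoelder_f:
  assumes "E \<in> sets lam" "emeasure sm E < \<infinity>"
  shows "emeasure fm E < \<infinity>"
    and "measure fm E powr q \<le> 2 powr q * measure sm E powr (q - 1) * measure fqm E"
  using hoelder[OF f assms] fqm_finite[OF assms(1)] by (auto simp: fm_def fqm_def)

lemma sm_front_finite: "fst (snd i) \<in> idx \<tau> (fst i) \<Longrightarrow> emeasure sm (front i) < \<infinity>"
  using Aq_rect[OF \<tau>] by (cases i) (auto simp: front_def Aq_def)

lemma fm_front_finite: "fst (snd i) \<in> idx \<tau> (fst i) \<Longrightarrow> emeasure fm (front i) < \<infinity>"
  using hoelder_f(1) front_sets sm_front_finite by blast

text \<open>
  After a Vitali selection the slabs are disjoint while the
  fronts may overlap. The upper bound on the averages lets the total mass of the smaller fronts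
  meeting \<open>front i\<close> be compared with the volume of their disjoint slabs, so most of the mass of
  \<open>f\<close> in \<open>front i\<close> lies where few smaller fronts overlap.
\<close>

lemma weak_type_finite:
  fixes \<xi> :: real and F :: "(int \<times> 'i \<times> real) set"
  assumes \<xi>: "0 < \<xi>" and F: "finite F"
    and idx: "\<And>i. i \<in> F \<Longrightarrow> fst (snd i) \<in> idx \<tau> (fst i)"
    and lower: "\<And>i. i \<in> F \<Longrightarrow> ennreal \<xi> * emeasure lam (front i) \<le> emeasure fm (front i)"
    and upper: "\<And>i. i \<in> F \<Longrightarrow> emeasure fm (front i) \<le> ennreal (2 * \<xi>) * emeasure lam (front i)"
  shows "emeasure wm (\<Union>i\<in>F. slab (\<gamma> / 6) i)
    \<le> ennreal (C * 4 powr q * (48 / \<gamma>) / \<xi> powr q * measure fqm UNIV)"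
proof -
  \<comment> \<open>Vitali enlargement triples the height, and \<open>3 * c = \<gamma> / 2\<close>
    is the slab for which \<open>Aq_rect\<close> is available.\<close>
  define c where "c = \<gamma> / 6"
  have c: "0 < c" "c \<le> 1" using \<gamma> by (auto simp: c_def)
  define vl where "vl i = measure \<mu> (cube \<tau> (fst i) (fst (snd i))) * dur (fst i)" for i :: "int \<times> 'i \<times> real"
  have vl_pos: "0 < vl i" if "i \<in> F" for i
    using emeasure_cube(2)[OF \<tau> idx[OF that]] dur_pos by (simp add: vl_def)
  have front: "emeasure lam (front i) = ennreal ((1 - \<gamma>) * vl i)" if "i \<in> F" for i
    using emeasure_front idx[OF that] by (cases i) (auto simp: vl_def)
  have slab: "emeasure lam (slab c i) = ennreal (2 * c * vl i)" if "i \<in> F" for i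
    using emeasure_slab[of _ _ c] c idx[OF that] by (cases i) (auto simp: vl_def)
  define g where "g i = measure fm (front i)" for i
  have g: "emeasure fm (front i) = ennreal (g i)" if "i \<in> F" for i
    unfolding g_def using fm_front_finite[OF idx[OF that]] by (intro emeasure_eq_ennreal_measure) auto
  have g_lower: "\<xi> * ((1 - \<gamma>) * vl i) \<le> g i" if "i \<in> F" for i
    using lower[OF that] \<xi> \<gamma> vl_pos[OF that] unfolding front[OF that] g[OF that]
    by (subst (asm) ennreal_mult'[symmetric], simp, subst (asm) ennreal_le_iff) (auto simp: g_def)
  have g_upper: "g i \<le> 2 * \<xi> * ((1 - \<gamma>) * vl i)" if "i \<in> F" for i
    using upper[OF that] \<xi> \<gamma> vl_pos[OF that] unfolding front[OF that] g[OF that]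
    by (subst (asm) ennreal_mult'[symmetric], simp, subst (asm) ennreal_le_iff) auto
  from finite_vitali_selection[OF F, of "slab c" fst] obtain G where sel_G: "G \<subseteq> F \<and>
      (\<forall>i\<in>G. \<forall>j\<in>G. i \<noteq> j \<longrightarrow> slab c i \<inter> slab c j = {}) \<and>
      (\<forall>i\<in>F. slab c i \<noteq> {} \<longrightarrow> (\<exists>j\<in>G. slab c i \<inter> slab c j \<noteq> {} \<and> fst j \<le> fst i))" ..
  note G = conjunct1[OF sel_G]
    and disj = conjunct1[OF conjunct2[OF sel_G], rule_format]
    and sel = conjunct2[OF conjunct2[OF sel_G], rule_format]
  have finG: "finite G" using F G finite_subset by blast
  have GF: "i \<in> F" if "i \<in> G" for i using G that by blast
  have slab_F: "slab c' i \<in> sets lam" and front_F: "front i \<in> sets lam" if "i \<in> F" for i c'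
    using slab_sets[OF idx[OF that]] front_sets[OF idx[OF that]] by blast+
  have nested: "cube \<tau> (fst i) (fst (snd i)) \<subseteq> cube \<tau> (fst j) (fst (snd j))"
    if "i \<in> F" "j \<in> F" "fst j \<le> fst i" "x \<in> cube \<tau> (fst i) (fst (snd i))" "x \<in> cube \<tau> (fst j) (fst (snd j))"
    for i j x
    using cube_nested[OF \<tau> that(3) idx[OF that(2)] idx[OF that(1)]] that(4,5) by blast
  have cover: "(\<Union>i\<in>F. slab c i) \<subseteq> (\<Union>j\<in>G. slab (\<gamma> / 2) j)"
  proof
    fix w assume "w \<in> (\<Union>i\<in>F. slab c i)"
    then obtain i where i: "i \<in> F" "w \<in> slab c i" by blast
    then have "slab c i \<noteq> {}" by blast
    from sel[OF i(1) this] obtain j where j': "j \<in> G" "slab c i \<inter> slab c j \<noteq> {}" "fst j \<le> fst i"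
      by (elim bexE conjE)
    from j'(2) obtain v where "v \<in> slab c i" "v \<in> slab c j" by auto
    note j = j'(1) this j'(3)
    obtain k \<alpha> t where i_eq: "i = (k, \<alpha>, t)" by (cases i)
    obtain k' \<beta> s where j_eq: "j = (k', \<beta>, s)" by (cases j)
    have sub: "cube \<tau> k \<alpha> \<subseteq> cube \<tau> k' \<beta>"
      using nested[OF i(1) GF[OF j(1)] j(4), of "fst v"] j(2,3) by (auto simp: i_eq j_eq slab_def)
    have "c * dur k \<le> c * dur k'" using j(4) c dur_antimono[of k' k] by (simp add: i_eq j_eq)
    moreover have "\<gamma> / 2 * dur k' = 3 * (c * dur k')" by (simp add: c_def)
    moreover have "snd w < t + c * dur k" "t - c * dur k < snd w" "snd v < t + c * dur k" "t - c * dur k < snd v"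
      "snd v < s + c * dur k'" "s - c * dur k' < snd v"
      using i(2) j(2,3) by (auto simp: i_eq j_eq slab_def)
    ultimately have "s - \<gamma> / 2 * dur k' < snd w" "snd w < s + \<gamma> / 2 * dur k'" by linarith+
    then have "w \<in> slab (\<gamma> / 2) j" using i(2) sub by (auto simp: i_eq j_eq slab_def)
    then show "w \<in> (\<Union>j\<in>G. slab (\<gamma> / 2) j)" using j(1) by blast
  qed
  \<comment> \<open>The same generation counts, so \<open>i\<close> itself is included.\<close>
  define smaller where "smaller i = {j \<in> G. fst i \<le> fst j}" for i :: "int \<times> 'i \<times> real"
  have smaller: "finite (smaller i)" "smaller i \<subseteq> G" for i :: "int \<times> 'i \<times> real" using finG by (auto simp: smaller_def)
  have mass: "(\<Sum>j\<in>smaller i. emeasure fm (front j \<inter> front i)) \<le> ennreal (4 / c * g i)" if i: "i \<in> G" for i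
  proof -
    obtain k \<alpha> t where i_eq: "i = (k, \<alpha>, t)" by (cases i)
    \<comment> \<open>For \<open>j\<close> in \<open>T\<close> the cube is nested in that of
      \<open>i\<close>, and the slab lies in \<open>slab 2 i\<close>. The upper bound on averages
      turns front masses into volumes of disjoint slabs, whose sum is at most
      \<open>4 * vl i\<close>; the lower bound for \<open>i\<close> turns this back into
      mass.\<close>
    define T where "T = {j \<in> smaller i. front j \<inter> front i \<noteq> {}}"
    have T: "finite T" "T \<subseteq> G" using finG by (auto simp: T_def smaller_def)
    have "(\<Sum>j\<in>smaller i. emeasure fm (front j \<inter> front i)) = (\<Sum>j\<in>T. emeasure fm (front j \<inter> front i))"
      using smaller by (intro sum.mono_neutral_right) (auto simp: T_def)
    also have "\<dots> \<le> (\<Sum>j\<in>T. ennreal (\<xi> * (1 - \<gamma>) / c) * emeasure lam (slab c j))"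
    proof (rule sum_mono)
      fix j assume "j \<in> T"
      then have j: "j \<in> F" using T G by blast
      have "emeasure fm (front j \<inter> front i) \<le> emeasure fm (front j)"
        using front_sets[OF idx[OF j]] by (intro emeasure_mono) auto
      also have "\<dots> = ennreal (g j)" by (rule g[OF j])
      also have "\<dots> \<le> ennreal (\<xi> * (1 - \<gamma>) / c * (2 * c * vl j))"
        using g_upper[OF j] c by (intro ennreal_leI) (simp add: mult_ac)
      also have "\<dots> = ennreal (\<xi> * (1 - \<gamma>) / c) * emeasure lam (slab c j)"
        unfolding slab[OF j] using \<xi> \<gamma> c by (intro ennreal_mult') auto
      finally show "emeasure fm (front j \<inter> front i) \<le> ennreal (\<xi> * (1 - \<gamma>) / c) * emeasure lam (slab c j)" .
    qed
    also have "\<dots> = ennreal (\<xi> * (1 - \<gamma>) / c) * (\<Sum>j\<in>T. emeasure lam (slab c j))"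
      by (simp add: sum_distrib_left)
    also have "(\<Sum>j\<in>T. emeasure lam (slab c j)) = emeasure lam (\<Union>j\<in>T. slab c j)"
    proof (rule sum_emeasure)
      show "slab c ` T \<subseteq> sets lam" using T(2) GF slab_F by blast
      show "disjoint_family_on (slab c) T" unfolding disjoint_family_on_def using T(2) disj by blast
    qed (rule T(1))
    also have "\<dots> \<le> emeasure lam (slab 2 i)"
    proof (rule emeasure_mono)
      show "slab 2 i \<in> sets lam" by (rule slab_F[OF GF[OF i]])
      show "(\<Union>j\<in>T. slab c j) \<subseteq> slab 2 i"
      proof
        fix w assume "w \<in> (\<Union>j\<in>T. slab c j)"
        then obtain j where j: "j \<in> T" "w \<in> slab c j" by blast
        obtain k' \<beta> s where j_eq: "j = (k', \<beta>, s)" by (cases j)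
        obtain v where v: "v \<in> front j" "v \<in> front i" using j(1) by (auto simp: T_def)
        have kk: "k \<le> k'" using j(1) by (auto simp: T_def smaller_def i_eq j_eq)
        have jF: "j \<in> F" using j(1) T G by blast
        have sub: "cube \<tau> k' \<beta> \<subseteq> cube \<tau> k \<alpha>"
          using nested[OF jF GF[OF i], of "fst v"] v kk by (auto simp: i_eq j_eq front_def rect_plus_eq)
        have "dur k' \<le> dur k" by (rule dur_antimono[OF kk])
        moreover have "c * dur k' \<le> 1 * dur k'" using c dur_pos[of k'] by (intro mult_right_mono) auto
        moreover have "0 < \<gamma> * dur k'" "0 < \<gamma> * dur k" using \<gamma> dur_pos by auto
        moreover have "snd v < s + dur k'" "s + \<gamma> * dur k' < snd v" "snd v < t + dur k" "t + \<gamma> * dur k < snd v"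
          using v by (auto simp: i_eq j_eq front_def rect_plus_eq)
        moreover have "snd w < s + c * dur k'" "s - c * dur k' < snd w" using j(2) by (auto simp: j_eq slab_def)
        ultimately have "t - 2 * dur k < snd w" "snd w < t + 2 * dur k" by linarith+
        then show "w \<in> slab 2 i" using j(2) sub by (auto simp: i_eq j_eq slab_def)
      qed
    qed
    also have "emeasure lam (slab 2 i) = ennreal (4 * vl i)"
      using emeasure_slab[of _ _ 2] idx[OF GF[OF i]] by (cases i) (auto simp: vl_def)
    also have "ennreal (\<xi> * (1 - \<gamma>) / c) * ennreal (4 * vl i) = ennreal (4 / c * (\<xi> * ((1 - \<gamma>) * vl i)))"
      using \<xi> \<gamma> c by (subst ennreal_mult'[symmetric]) (auto simp: mult_ac)
    also have "\<dots> \<le> ennreal (4 / c * g i)"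
      using g_lower[OF GF[OF i]] c by (intro ennreal_leI mult_left_mono) auto
    finally show ?thesis by this (auto intro!: mult_left_mono)
  qed
  define ov where "ov i z = (\<Sum>j\<in>smaller i. indicator (front j) z :: real)" for i z
  \<comment> \<open>By \<open>mass\<close> the average overlap over \<open>front i\<close> with
    respect to \<open>fm\<close> is at most \<open>4 / c\<close>. Twice this value as threshold
    leaves at least half of the mass in the core, by Markov's inequality.\<close>
  define core where "core i = {z \<in> front i. ov i z \<le> 8 / c}" for i
  have front_smaller: "front j \<in> sets lam" if "j \<in> smaller i" for i j
    using that smaller(2) GF front_F by blast
  have ov_meas: "ov i \<in> borel_measurable lam" if "i \<in> G" for i
    unfolding ov_def by (intro borel_measurable_sum borel_measurable_indicator) (rule front_smaller)
  have core_sets: "core i \<in> sets lam" if "i \<in> G" for i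
  proof -
    have "core i = front i \<inter> {z \<in> space lam. ov i z \<le> 8 / c}" by (auto simp: core_def)
    also have "\<dots> \<in> sets lam"
      using front_F[OF GF[OF that]] ov_meas[OF that] by (intro sets.Int borel_measurable_le) auto
    finally show ?thesis .
  qed
  have core_mass: "g i \<le> 2 * measure fm (core i)" if i: "i \<in> G" for i
  proof -
    have fs: "front i \<in> sets lam" by (rule front_F[OF GF[OF i]])
    have Int_sets: "front j \<inter> front i \<in> sets fm" if "j \<in> smaller i" for j
      using front_smaller[OF that] fs by (simp add: sets.Int)
    define N where "N = front i - core i"
    have N: "N \<in> sets lam" using fs core_sets[OF i] by (auto simp: N_def)
    have Nfin: "emeasure fm N < \<infinity>"
      using emeasure_mono[of N "front i" fm] fs g[OF GF[OF i]] by (auto simp: N_def le_less_trans)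
    have "ennreal (8 / c) * emeasure fm N = (\<integral>\<^sup>+z. ennreal (8 / c) * indicator N z \<partial>fm)"
      using N by (simp add: nn_integral_cmult_indicator)
    also have "\<dots> \<le> (\<integral>\<^sup>+z. (\<Sum>j\<in>smaller i. indicator (front j \<inter> front i) z) \<partial>fm)"
    proof (rule nn_integral_mono)
      fix z
      show "ennreal (8 / c) * indicator N z \<le> (\<Sum>j\<in>smaller i. indicator (front j \<inter> front i) z)"
      proof (cases "z \<in> N")
        case True
        then have z: "z \<in> front i" "8 / c \<le> ov i z" by (auto simp: N_def core_def)
        have "ennreal (8 / c) \<le> ennreal (ov i z)" using z by (intro ennreal_leI) auto
        also have "\<dots> = (\<Sum>j\<in>smaller i. ennreal (indicator (front j) z))"
          unfolding ov_def by (intro sum_ennreal[symmetric]) auto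
        also have "\<dots> = (\<Sum>j\<in>smaller i. indicator (front j \<inter> front i) z)"
          using z by (intro sum.cong) (auto simp: indicator_def)
        finally show ?thesis using True by simp
      qed simp
    qed
    also have "\<dots> = (\<Sum>j\<in>smaller i. \<integral>\<^sup>+z. indicator (front j \<inter> front i) z \<partial>fm)"
      by (intro nn_integral_sum borel_measurable_indicator Int_sets)
    also have "\<dots> = (\<Sum>j\<in>smaller i. emeasure fm (front j \<inter> front i))"
      by (intro sum.cong nn_integral_indicator Int_sets refl)
    also have "\<dots> \<le> ennreal (4 / c * g i)" by (rule mass[OF i])
    also have "emeasure fm N = ennreal (measure fm N)"
      using Nfin by (intro emeasure_eq_ennreal_measure) auto
    finally have "ennreal (8 / c) * ennreal (measure fm N) \<le> ennreal (4 / c * g i)" .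
    then have "ennreal (8 / c * measure fm N) \<le> ennreal (4 / c * g i)"
      using c by (subst ennreal_mult') auto
    then have "8 / c * measure fm N \<le> 4 / c * g i"
      using c by (subst (asm) ennreal_le_iff) (auto simp: g_def)
    then have "2 * measure fm N \<le> g i" using c by (simp add: field_simps)
    moreover have "measure fm N = g i - measure fm (core i)"
      unfolding N_def g_def using fs core_sets[OF i] g[OF GF[OF i]]
      by (intro measure_Diff) (auto simp: core_def)
    ultimately show ?thesis by simp
  qed
  \<comment> \<open>Among the cores containing \<open>z\<close>, take one of least generation: all
    the others are counted in its own overlap function, which is bounded on its core.\<close>
  have core_overlap: "(\<Sum>i\<in>G. indicator (core i) z) \<le> (ennreal (8 / c))" for z
  proof -
    define Gz where "Gz = {i \<in> G. z \<in> core i}"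
    have finGz: "finite Gz" using finG by (simp add: Gz_def)
    have sum: "(\<Sum>i\<in>G. indicator (core i) z :: ennreal) = of_nat (card Gz)"
    proof -
      have "(\<Sum>i\<in>G. indicator (core i) z :: ennreal) = (\<Sum>i\<in>G. if z \<in> core i then 1 else 0)"
        by (intro sum.cong) (auto simp: indicator_def)
      also have "\<dots> = (\<Sum>i\<in>Gz. 1)"
        unfolding Gz_def by (rule sum.inter_filter[OF finG, symmetric])
      finally show ?thesis by simp
    qed
    show ?thesis
    proof (cases "Gz = {}")
      case False
      define i0 where "i0 = arg_min_on fst Gz"
      have i0: "i0 \<in> Gz" "\<And>j. j \<in> Gz \<Longrightarrow> fst i0 \<le> fst j"
        unfolding i0_def using finGz False by (auto intro: arg_min_if_finite(1) arg_min_least)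
      have "Gz \<subseteq> {j \<in> smaller i0. z \<in> front j}" using i0(2) by (auto simp: Gz_def smaller_def core_def)
      then have "card Gz \<le> card {j \<in> smaller i0. z \<in> front j}"
        using smaller by (intro card_mono) auto
      then have "real (card Gz) \<le> real (card {j \<in> smaller i0. z \<in> front j})" by simp
      also have "\<dots> = ov i0 z"
      proof -
        have "ov i0 z = (\<Sum>j\<in>smaller i0. if z \<in> front j then 1 else 0)"
          unfolding ov_def by (intro sum.cong) (auto simp: indicator_def)
        also have "\<dots> = (\<Sum>j\<in>{j \<in> smaller i0. z \<in> front j}. 1)"
          by (rule sum.inter_filter[OF smaller(1), symmetric])
        finally show ?thesis by simp
      qed
      also have "\<dots> \<le> 8 / c" using i0(1) by (auto simp: Gz_def core_def)
      finally show ?thesis unfolding sum by (simp add: ennreal_of_nat_eq_real_of_nat ennreal_leI)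
    qed (simp add: sum)
  qed
  \<comment> \<open>Hoelder is applied on the core, but its \<open>\<sigma>\<close>-mass is enlarged
    to that of the front so that it cancels against \<open>Aq_rect\<close>. One factor
    \<open>2 powr q\<close> comes from \<open>core_mass\<close>, the other from Hoelder.\<close>
  have each: "emeasure wm (slab (\<gamma> / 2) i) \<le> ennreal (C * 4 powr q / \<xi> powr q) * emeasure fqm (core i)"
    if i: "i \<in> G" for i
  proof -
    have iF: "i \<in> F" by (rule GF[OF i])
    obtain k \<alpha> t where i_eq: "i = (k, \<alpha>, t)" by (cases i)
    have fs: "front i \<in> sets lam" by (rule front_F[OF iF])
    have cs: "core i \<in> sets lam" "core i \<subseteq> front i" using core_sets[OF i] by (auto simp: core_def)
    have Sfin: "emeasure sm (front i) < \<infinity>" using sm_front_finite idx iF by blast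
    have Scfin: "emeasure sm (core i) < \<infinity>"
      using emeasure_mono[of "core i" "front i" sm] cs fs Sfin by (auto simp: le_less_trans)
    have Sc: "measure sm (core i) \<le> measure sm (front i)"
      using cs fs Sfin by (intro measure_mono_fmeasurable) (auto simp: fmeasurable_def)
    have A: "Aq (slab (\<gamma> / 2) i) (front i) (C * measure lam (front i) powr q)"
      using Aq_rect[OF \<tau>, of \<alpha> k t] idx[OF iF] by (simp add: i_eq slab_def front_def)
    define W where "W = measure wm (slab (\<gamma> / 2) i)"
    define S where "S = measure sm (front i)"
    define Y where "Y = measure fqm (core i)"
    have lamf: "measure lam (front i) = (1 - \<gamma>) * vl i"
      using front[OF iF] \<gamma> vl_pos[OF iF] by (simp add: measure_def)
    have "0 < emeasure lam (front i)" using front[OF iF] \<gamma> vl_pos[OF iF] by simp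
    then have "0 < S"
      using sm_pos[OF fs] Sfin by (simp add: S_def measure_def enn2real_positive_iff)
    have m: "0 \<le> measure fm (core i)" by simp
    have "\<xi> * measure lam (front i) \<le> 2 * measure fm (core i)"
      using g_lower[OF iF] core_mass[OF i] by (simp add: lamf)
    then have "(\<xi> * measure lam (front i)) powr q \<le> (2 * measure fm (core i)) powr q"
      using \<xi> q_gt_1 by (intro powr_mono2) auto
    also have "\<dots> = 2 powr q * measure fm (core i) powr q" by (simp add: powr_mult)
    also have "\<dots> \<le> 2 powr q * (2 powr q * measure sm (core i) powr (q - 1) * Y)"
      unfolding Y_def using hoelder_f(2)[OF cs(1) Scfin] by (intro mult_left_mono) auto
    also have "\<dots> \<le> 2 powr q * (2 powr q * S powr (q - 1) * Y)"
      unfolding S_def using Sc q_gt_1 by (intro mult_left_mono mult_right_mono powr_mono2) (auto simp: Y_def)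
    also have "\<dots> = 4 powr q * Y * S powr (q - 1)"
      using powr_mult[of 2 2 q] by simp
    finally have *: "\<xi> powr q * measure lam (front i) powr q \<le> 4 powr q * Y * S powr (q - 1)"
      using \<xi> by (simp add: powr_mult)
    have "\<xi> powr q * (W * S powr (q - 1)) \<le> \<xi> powr q * (C * measure lam (front i) powr q)"
      using A by (intro mult_left_mono) (auto simp: Aq_def W_def S_def)
    also have "\<dots> = C * (\<xi> powr q * measure lam (front i) powr q)" by simp
    also have "\<dots> \<le> C * (4 powr q * Y * S powr (q - 1))" using * C by (intro mult_left_mono)
    finally have "(\<xi> powr q * W) * S powr (q - 1) \<le> (C * 4 powr q * Y) * S powr (q - 1)"
      by (simp add: mult_ac)
    then have "\<xi> powr q * W \<le> C * 4 powr q * Y" using \<open>0 < S\<close> by simp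
    then have WY: "W \<le> C * 4 powr q / \<xi> powr q * Y" using \<xi> by (simp add: field_simps)
    have "emeasure wm (slab (\<gamma> / 2) i) = ennreal W"
      unfolding W_def using A by (intro emeasure_eq_ennreal_measure) (auto simp: Aq_def)
    also have "\<dots> \<le> ennreal (C * 4 powr q / \<xi> powr q * Y)" using WY by (rule ennreal_leI)
    also have "\<dots> = ennreal (C * 4 powr q / \<xi> powr q) * ennreal Y"
      using C by (intro ennreal_mult) (auto simp: Y_def)
    also have "ennreal Y = emeasure fqm (core i)"
      unfolding Y_def using fqm_finite[OF cs(1)] by (intro emeasure_eq_ennreal_measure[symmetric]) auto
    finally show ?thesis .
  qed
  have "emeasure wm (\<Union>i\<in>F. slab c i) \<le> emeasure wm (\<Union>j\<in>G. slab (\<gamma> / 2) j)"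
    by (intro emeasure_mono cover) (simp only: sets_wm, intro sets.finite_UN finG slab_F GF)
  also have "\<dots> \<le> (\<Sum>i\<in>G. emeasure wm (slab (\<gamma> / 2) i))"
    by (intro emeasure_subadditive_finite finG) (simp add: image_subset_iff slab_F GF)
  also have "\<dots> \<le> (\<Sum>i\<in>G. ennreal (C * 4 powr q / \<xi> powr q) * emeasure fqm (core i))"
    by (intro sum_mono each)
  also have "\<dots> = ennreal (C * 4 powr q / \<xi> powr q) * (\<Sum>i\<in>G. emeasure fqm (core i))"
    by (simp add: sum_distrib_left)
  \<comment> \<open>Bounded overlap of the cores takes the place of disjointness;
    \<open>8 / c = 48 / \<gamma>\<close>.\<close>
  also have "\<dots> \<le> ennreal (C * 4 powr q / \<xi> powr q) * (ennreal (8 / c) * emeasure fqm UNIV)"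
  proof (rule mult_left_mono)
    have "(\<Sum>i\<in>G. emeasure fqm (core i)) = (\<Sum>i\<in>G. \<integral>\<^sup>+z. indicator (core i) z \<partial>fqm)"
      using core_sets by (intro sum.cong) auto
    also have "\<dots> = (\<integral>\<^sup>+z. (\<Sum>i\<in>G. indicator (core i) z) \<partial>fqm)"
      using core_sets by (intro nn_integral_sum[symmetric] borel_measurable_indicator) auto
    also have "\<dots> \<le> (\<integral>\<^sup>+z. ennreal (8 / c) \<partial>fqm)" by (intro nn_integral_mono core_overlap)
    also have "\<dots> = ennreal (8 / c) * emeasure fqm UNIV" by (simp add: fqm_def)
    finally show "(\<Sum>i\<in>G. emeasure fqm (core i)) \<le> ennreal (8 / c) * emeasure fqm UNIV" .
  qed simp
  also have "emeasure fqm UNIV = ennreal (measure fqm UNIV)"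
    using fq_finite by (intro emeasure_eq_ennreal_measure) auto
  also have "ennreal (C * 4 powr q / \<xi> powr q) * (ennreal (8 / c) * ennreal (measure fqm UNIV))
      = ennreal (C * 4 powr q * (48 / \<gamma>) / \<xi> powr q * measure fqm UNIV)"
    using C c \<gamma> by (simp add: c_def mult_ac flip: ennreal_mult')
  finally show ?thesis by (simp add: c_def)
qed

text \<open>
  Only one time per cell of length \<open>\<gamma>/6 dur k\<close> is needed, so countably many slabs cover.
\<close>

lemma weak_type_level:
  fixes \<xi> :: real
  assumes \<xi>: "0 < \<xi>"
  shows "\<exists>E\<in>sets lam. emeasure wm E \<le> ennreal (C * 4 powr q * (48 / \<gamma>) / \<xi> powr q * measure fqm UNIV) \<and>
    (\<forall>k \<alpha> t x. \<alpha> \<in> idx \<tau> k \<longrightarrow> x \<in> cube \<tau> k \<alpha> \<longrightarrow>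
      ennreal \<xi> * emeasure lam (front (k, \<alpha>, t)) \<le> emeasure fm (front (k, \<alpha>, t)) \<longrightarrow>
      emeasure fm (front (k, \<alpha>, t)) \<le> ennreal (2 * \<xi>) * emeasure lam (front (k, \<alpha>, t)) \<longrightarrow> (x, t) \<in> E)"
proof -
  define X where "X = {i. fst (snd i) \<in> idx \<tau> (fst i) \<and>
      ennreal \<xi> * emeasure lam (front i) \<le> emeasure fm (front i) \<and>
      emeasure fm (front i) \<le> ennreal (2 * \<xi>) * emeasure lam (front i)}"
  define key :: "int \<times> 'i \<times> real \<Rightarrow> int \<times> 'i \<times> int"
    where "key = (\<lambda>(k, \<alpha>, t). (k, \<alpha>, \<lfloor>t / (\<gamma> / 6 * dur k)\<rfloor>))"
  \<comment> \<open>Representatives are taken from \<open>X\<close> itself, so they satisfy the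
    bounds required by \<open>weak_type_finite\<close>.\<close>
  define rep where "rep u = (SOME i. i \<in> X \<and> key i = u)" for u :: "int \<times> 'i \<times> int"
  define D where "D = rep ` (key ` X)"
  have rep: "rep u \<in> X \<and> key (rep u) = u" if "u \<in> key ` X" for u
    unfolding rep_def by (rule someI_ex) (use that in blast)
  have D: "D \<subseteq> X" using rep unfolding D_def by blast
  have "key ` X \<subseteq> (SIGMA k:UNIV. idx \<tau> k \<times> UNIV)" by (auto simp: X_def key_def)
  moreover have "countable (SIGMA k:UNIV. idx \<tau> k \<times> (UNIV :: int set))"
    using countable_idx[OF \<tau>] by (intro countable_SIGMA) auto
  ultimately have "countable (key ` X)" by (rule countable_subset)
  then have cnt: "countable D" unfolding D_def by (rule countable_image)
  define E where "E = (\<Union>i\<in>D. slab (\<gamma> / 6) i)"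
  have slabs: "slab (\<gamma> / 6) i \<in> sets lam" if "i \<in> D" for i
    using that D by (intro slab_sets) (auto simp: X_def)
  show ?thesis
  proof (rule bexI[of _ E], intro conjI allI impI)
    show "E \<in> sets lam" unfolding E_def by (rule sets.countable_UN''[OF cnt slabs])
    show "emeasure wm E \<le> ennreal (C * 4 powr q * (48 / \<gamma>) / \<xi> powr q * measure fqm UNIV)"
      unfolding E_def
    proof (rule emeasure_countable_UN_le[OF cnt])
      fix F assume F: "finite F" "F \<subseteq> D"
      then have "F \<subseteq> X" using D by blast
      with F(1) show "emeasure wm (\<Union>i\<in>F. slab (\<gamma> / 6) i)
          \<le> ennreal (C * 4 powr q * (48 / \<gamma>) / \<xi> powr q * measure fqm UNIV)"
        unfolding X_def by (intro weak_type_finite \<xi>) blast+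
    qed (use slabs in auto)
    fix k \<alpha> t x
    assume a: "\<alpha> \<in> idx \<tau> k" "x \<in> cube \<tau> k \<alpha>"
      "ennreal \<xi> * emeasure lam (front (k, \<alpha>, t)) \<le> emeasure fm (front (k, \<alpha>, t))"
      "emeasure fm (front (k, \<alpha>, t)) \<le> ennreal (2 * \<xi>) * emeasure lam (front (k, \<alpha>, t))"
    then have iX: "(k, \<alpha>, t) \<in> X" by (simp add: X_def)
    define j where "j = rep (key (k, \<alpha>, t))"
    have j: "j \<in> D" "key j = key (k, \<alpha>, t)"
      unfolding D_def j_def using rep[of "key (k, \<alpha>, t)"] iX by blast+
    obtain s where s: "j = (k, \<alpha>, s)" "\<lfloor>s / (\<gamma> / 6 * dur k)\<rfloor> = \<lfloor>t / (\<gamma> / 6 * dur k)\<rfloor>"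
      using j(2) by (cases j) (auto simp: key_def)
    define d where "d = \<gamma> / 6 * dur k"
    have d: "0 < d" using \<gamma> dur_pos by (simp add: d_def)
    have "\<bar>s / d - t / d\<bar> < 1" using s(2) unfolding d_def[symmetric] by linarith
    then have "\<bar>s - t\<bar> < d" using d by (simp add: abs_less_iff field_simps flip: diff_divide_distrib)
    then have "t \<in> {s - d<..<s + d}" by auto
    then have "(x, t) \<in> slab (\<gamma> / 6) j" using a(2) unfolding s(1) slab_def d_def by simp
    then show "(x, t) \<in> E" using j(1) by (auto simp: E_def)
  qed
qed

end

end

end

text \<open>The estimate at height \<open>2 ^ n * \<xi>\<close> gains the factor
  \<open>(2 ^ n) powr q\<close>, which is at least \<open>2 ^ n\<close>. The levels therefore sum to
  at most twice the bound at \<open>n = 0\<close>, and the systems contribute the factor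
  \<open>K\<close>.\<close>

lemma A_plus_imp_weak_bound:
  assumes \<gamma>: "0 < \<gamma>" "\<gamma> < 1"
    and Ap: "\<And>\<gamma>. 0 < \<gamma> \<Longrightarrow> \<gamma> < 1 \<Longrightarrow> \<omega> \<in> A_plus \<rho> \<mu> p q \<gamma>"
  shows "bounded_Lq_weak_Lq \<mu> q \<omega> (max_fun \<mu> p \<delta> K idx cube \<gamma>)"
proof -
  obtain C where C: "0 \<le> C" and Aq_rect: "\<And>\<tau> k t \<alpha>. \<tau> \<in> {1..K} \<Longrightarrow> \<alpha> \<in> idx \<tau> k \<Longrightarrow>
      Aq (cube \<tau> k \<alpha> \<times> {t - \<gamma> / 2 * dur k<..<t + \<gamma> / 2 * dur k}) (rect_plus p \<delta> cube \<gamma> \<tau> k \<alpha> t)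
        (C * measure lam (rect_plus p \<delta> cube \<gamma> \<tau> k \<alpha> t) powr q)"
    using A_plus_rect[OF \<gamma> Ap] by auto
  define A where "A = C * 4 powr q * (48 / \<gamma>)"
  have A: "0 \<le> A" using C \<gamma> by (simp add: A_def)
  define B where "B = real K * (2 * A)"
  have B: "0 \<le> B" using A by (simp add: B_def)
  have main: "weak_Lq_norm \<mu> q \<omega> (max_fun \<mu> p \<delta> K idx cube \<gamma> f) \<le> ennreal (B powr (1 / q)) * Lq_norm \<mu> q \<omega> f"
    if f: "f \<in> Lq_space \<mu> q \<omega>" for f
  proof -
    have f_meas [measurable]: "f \<in> borel_measurable lam" using f by (simp add: Lq_space_def)
    have fq: "emeasure (fqm f) UNIV = (\<integral>\<^sup>+z. ennreal (\<bar>f z\<bar> powr q * \<omega> z) \<partial>lam)"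
      using sets.top[of lam] unfolding fqm_def by (subst emeasure_density) auto
    have fin: "emeasure (fqm f) UNIV < \<infinity>"
      using f unfolding fq by (auto simp: Lq_space_def Lq_norm_def ennpowr_def less_top split: if_splits)
    define y where "y = measure (fqm f) UNIV"
    have y: "0 \<le> y" "emeasure (fqm f) UNIV = ennreal y"
      using fin by (auto simp: y_def intro!: emeasure_eq_ennreal_measure)
    have norm: "Lq_norm \<mu> q \<omega> f = ennreal (y powr (1 / q))"
      unfolding Lq_norm_def fq[symmetric] y(2) using y(1) by (rule ennpowr_ennreal)
    have level: "\<exists>E\<in>sets lam. emeasure wm E \<le> ennreal (A / \<xi> powr q * y) \<and>
      (\<forall>k \<alpha> t x. \<alpha> \<in> idx \<tau> k \<longrightarrow> x \<in> cube \<tau> k \<alpha> \<longrightarrow>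
        ennreal \<xi> * emeasure lam (front \<gamma> \<tau> (k, \<alpha>, t)) \<le> emeasure (fm f) (front \<gamma> \<tau> (k, \<alpha>, t)) \<longrightarrow>
        emeasure (fm f) (front \<gamma> \<tau> (k, \<alpha>, t)) \<le> ennreal (2 * \<xi>) * emeasure lam (front \<gamma> \<tau> (k, \<alpha>, t)) \<longrightarrow>
        (x, t) \<in> E)" if "\<tau> \<in> {1..K}" "0 < \<xi>" for \<tau> \<xi>
      using weak_type_level[OF \<gamma> C Aq_rect f_meas that(1) fin that(2)] unfolding A_def y_def .
    have est: "weighted_measure \<mu> \<omega> {z. max_fun \<mu> p \<delta> K idx cube \<gamma> f z > ennreal \<xi>}
        \<le> ennreal (B / \<xi> powr q * y)" if \<xi>: "0 < \<xi>" for \<xi>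
    proof -
      have "\<forall>\<tau> n. \<exists>E. \<tau> \<in> {1..K} \<longrightarrow> E \<in> sets lam \<and> emeasure wm E \<le> ennreal (A / (2 ^ n * \<xi>) powr q * y) \<and>
       (\<forall>k \<alpha> t x. \<alpha> \<in> idx \<tau> k \<longrightarrow> x \<in> cube \<tau> k \<alpha> \<longrightarrow>
        ennreal (2 ^ n * \<xi>) * emeasure lam (front \<gamma> \<tau> (k, \<alpha>, t)) \<le> emeasure (fm f) (front \<gamma> \<tau> (k, \<alpha>, t)) \<longrightarrow>
        emeasure (fm f) (front \<gamma> \<tau> (k, \<alpha>, t)) \<le> ennreal (2 * (2 ^ n * \<xi>)) * emeasure lam (front \<gamma> \<tau> (k, \<alpha>, t)) \<longrightarrow>
        (x, t) \<in> E)" (is "\<forall>\<tau> n. \<exists>E. ?P \<tau> n E")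
      proof (intro allI)
        fix \<tau> :: nat and n :: nat
        show "\<exists>E. ?P \<tau> n E"
        proof (cases "\<tau> \<in> {1..K}")
          case True
          have "0 < 2 ^ n * \<xi>" using \<xi> by simp
          from level[OF True this] obtain E where "E \<in> sets lam" "emeasure wm E \<le> ennreal (A / (2 ^ n * \<xi>) powr q * y) \<and>
            (\<forall>k \<alpha> t x. \<alpha> \<in> idx \<tau> k \<longrightarrow> x \<in> cube \<tau> k \<alpha> \<longrightarrow>
             ennreal (2 ^ n * \<xi>) * emeasure lam (front \<gamma> \<tau> (k, \<alpha>, t)) \<le> emeasure (fm f) (front \<gamma> \<tau> (k, \<alpha>, t)) \<longrightarrow>
             emeasure (fm f) (front \<gamma> \<tau> (k, \<alpha>, t)) \<le> ennreal (2 * (2 ^ n * \<xi>)) * emeasure lam (front \<gamma> \<tau> (k, \<alpha>, t)) \<longrightarrow>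
             (x, t) \<in> E)" ..
          then show ?thesis by (intro exI[of _ E] impI conjI) simp_all
        qed (intro exI[of _ "{}"] impI, simp)
      qed
      then obtain E where "\<forall>\<tau> n. ?P \<tau> n (E \<tau> n)" unfolding choice_iff by (elim exE) (rule that)
      note E = this[rule_format]
      have E_sets: "E \<tau> n \<in> sets lam" and E_le: "emeasure wm (E \<tau> n) \<le> ennreal (A / (2 ^ n * \<xi>) powr q * y)"
        if "\<tau> \<in> {1..K}" for \<tau> n
        using E[of \<tau> n, OF that] by blast+
      define U where "U \<tau> = (\<Union>n. E \<tau> n)" for \<tau>
      have U_sets: "U \<tau> \<in> sets lam" if "\<tau> \<in> {1..K}" for \<tau>
        unfolding U_def using E_sets[OF that] by auto
      have U_le: "emeasure wm (U \<tau>) \<le> ennreal (2 * A / \<xi> powr q * y)" if \<tau>: "\<tau> \<in> {1..K}" for \<tau>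
      proof -
        define a where "a = A / \<xi> powr q * y"
        have a: "0 \<le> a" using A y by (simp add: a_def)
        have le: "emeasure wm (E \<tau> n) \<le> ennreal (a * (1 / 2) ^ n)" for n
        proof -
          have "(2::real) ^ n = (2 ^ n) powr 1" by simp
          also have "\<dots> \<le> (2 ^ n) powr q" using q_gt_1 by (intro powr_mono) auto
          finally have *: "(2::real) ^ n \<le> (2 ^ n) powr q" .
          have "A / (2 ^ n * \<xi>) powr q * y = a / (2 ^ n) powr q"
            using \<xi> by (simp add: a_def powr_mult)
          also have "\<dots> \<le> a / 2 ^ n" using a * by (intro divide_left_mono) auto
          finally have "A / (2 ^ n * \<xi>) powr q * y \<le> a * (1 / 2) ^ n" by (simp add: power_divide)
          then show ?thesis using E_le[OF \<tau>, of n] by (meson ennreal_leI order_trans)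
        qed
        have "emeasure wm (U \<tau>) \<le> (\<Sum>n. emeasure wm (E \<tau> n))"
          unfolding U_def using E_sets[OF \<tau>] by (intro emeasure_subadditive_countably) auto
        also have "\<dots> \<le> (\<Sum>n. ennreal (a * (1 / 2) ^ n))" by (intro suminf_le le) auto
        also have "\<dots> = ennreal (a * 2)"
        proof (rule suminf_ennreal_eq)
          show "(\<lambda>n. a * (1 / 2) ^ n) sums (a * 2)"
            using sums_mult[OF geometric_sums[of "1 / 2 :: real"], of a] by simp
        qed (use a in simp)
        finally show ?thesis by (simp add: a_def mult_ac)
      qed
      have sub: "{z. max_fun \<mu> p \<delta> K idx cube \<gamma> f z > ennreal \<xi>} \<subseteq> (\<Union>\<tau>\<in>{1..K}. U \<tau>)"
      proof
        fix z assume "z \<in> {z. max_fun \<mu> p \<delta> K idx cube \<gamma> f z > ennreal \<xi>}"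
        moreover obtain x t where z: "z = (x, t)" by (cases z)
        ultimately obtain \<tau> k \<alpha> where \<tau>: "\<tau> \<in> {1..K}" and \<alpha>: "\<alpha> \<in> idx \<tau> k" "x \<in> cube \<tau> k \<alpha>"
          and gt: "ennreal \<xi> < avg lam (rect_plus p \<delta> cube \<gamma> \<tau> k \<alpha> t) (\<lambda>z. ennreal \<bar>f z\<bar>)"
          unfolding max_fun_def by (auto simp: less_SUP_iff)
        let ?P = "front \<gamma> \<tau> (k, \<alpha>, t)"
        have P_eq: "?P = rect_plus p \<delta> cube \<gamma> \<tau> k \<alpha> t" by (simp add: front_def)
        have P_sets: "?P \<in> sets lam" unfolding P_eq by (rule rect_plus_sets[OF \<tau> \<alpha>(1)])
        define m where "m = (1 - \<gamma>) * (measure \<mu> (cube \<tau> k \<alpha>) * dur k)"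
        have m: "0 < m" using \<gamma> emeasure_cube(2)[OF \<tau> \<alpha>(1)] dur_pos by (simp add: m_def)
        have em: "emeasure lam ?P = ennreal m"
          using emeasure_front[OF \<gamma> C Aq_rect f_meas \<tau> \<alpha>(1)] by (simp add: m_def)
        define g where "g = measure (fm f) ?P"
        have "emeasure (fm f) ?P < \<infinity>"
          using fm_front_finite[OF \<gamma> C Aq_rect f_meas \<tau> fin, of "(k, \<alpha>, t)"] \<alpha>(1) by simp
        then have g: "emeasure (fm f) ?P = ennreal g" unfolding g_def by (intro emeasure_eq_ennreal_measure) auto
        have int: "(\<integral>\<^sup>+z\<in>?P. ennreal \<bar>f z\<bar> \<partial>lam) = emeasure (fm f) ?P"
          using P_sets unfolding fm_def by (subst emeasure_density) auto
        have "avg lam ?P (\<lambda>z. ennreal \<bar>f z\<bar>) = ennreal (g / m)"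
          unfolding avg_def em int g using m by (intro divide_ennreal) (auto simp: g_def)
        with gt have gm: "\<xi> < g / m" unfolding P_eq[symmetric] using \<xi> by (simp add: ennreal_less_iff)
        obtain N :: nat where "g / m / \<xi> < 2 ^ N" using real_arch_pow[of 2 "g / m / \<xi>"] by auto
        then have "g / m < 2 ^ N * \<xi>" using \<xi> by (simp only: pos_divide_less_eq)
        moreover have "0 < 2 ^ N * \<xi>" using \<xi> by simp
        ultimately have ex: "g / m \<le> 2 * (2 ^ N * \<xi>)" by linarith
        \<comment> \<open>Minimality gives the lower bound \<open>2 ^ n * \<xi>\<close> when
          \<open>n > 0\<close>; for \<open>n = 0\<close> it is the assumption that the average
          exceeds \<open>\<xi>\<close>. Such an \<open>n\<close> exists because the average is
          finite.\<close>
        define n where "n = (LEAST n. g / m \<le> 2 * (2 ^ n * \<xi>))"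
        have n1: "g / m \<le> 2 * (2 ^ n * \<xi>)" unfolding n_def using ex by (rule LeastI)
        have n2: "2 ^ n * \<xi> \<le> g / m"
        proof (cases n)
          case 0
          then show ?thesis using gm by simp
        next
          case (Suc j)
          then have "\<not> g / m \<le> 2 * (2 ^ j * \<xi>)"
            using not_less_Least[of j "\<lambda>n. g / m \<le> 2 * (2 ^ n * \<xi>)"] by (simp add: n_def)
          then show ?thesis using Suc by simp
        qed
        have "ennreal (2 ^ n * \<xi>) * emeasure lam ?P \<le> emeasure (fm f) ?P"
          unfolding em g using n2 m \<xi> by (simp add: pos_le_divide_eq ennreal_leI flip: ennreal_mult')
        moreover have "emeasure (fm f) ?P \<le> ennreal (2 * (2 ^ n * \<xi>)) * emeasure lam ?P"
          unfolding em g using n1 m \<xi> by (simp add: pos_divide_le_eq ennreal_leI flip: ennreal_mult')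
        ultimately have "(x, t) \<in> E \<tau> n" using E[of \<tau> n, OF \<tau>] \<alpha> by blast
        then show "z \<in> (\<Union>\<tau>\<in>{1..K}. U \<tau>)" using \<tau> z by (auto simp: U_def)
      qed
      have UU: "(\<Union>\<tau>\<in>{1..K}. U \<tau>) \<in> sets lam" using U_sets by (intro sets.finite_UN) auto
      have "weighted_measure \<mu> \<omega> {z. max_fun \<mu> p \<delta> K idx cube \<gamma> f z > ennreal \<xi>}
        \<le> emeasure wm (\<Union>\<tau>\<in>{1..K}. U \<tau>)"
        unfolding weighted_measure_def emeasure_wm[OF UU] using sub
        by (intro nn_integral_mono) (auto simp: indicator_def)
      also have "\<dots> \<le> (\<Sum>\<tau>\<in>{1..K}. emeasure wm (U \<tau>))"
        using U_sets by (intro emeasure_subadditive_finite) auto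
      also have "\<dots> \<le> (\<Sum>\<tau>\<in>{1..K}. ennreal (2 * A / \<xi> powr q * y))" by (intro sum_mono U_le)
      also have "\<dots> = ennreal (\<Sum>\<tau>\<in>{1..K}. 2 * A / \<xi> powr q * y)"
        using A y by (intro sum_ennreal) auto
      also have "(\<Sum>\<tau>\<in>{1..K}. 2 * A / \<xi> powr q * y) = B / \<xi> powr q * y" by (simp add: B_def)
      finally show ?thesis .
    qed
    show ?thesis
      unfolding weak_Lq_norm_def
    proof (rule SUP_least)
      fix \<xi> :: real assume "\<xi> \<in> {0<..}"
      then have \<xi>: "0 < \<xi>" by simp
      have "ennreal \<xi> * ennpowr (weighted_measure \<mu> \<omega> {z. max_fun \<mu> p \<delta> K idx cube \<gamma> f z > ennreal \<xi>}) (1 / q)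
        \<le> ennreal \<xi> * ennpowr (ennreal (B / \<xi> powr q * y)) (1 / q)"
        using est[OF \<xi>] q_gt_1 by (intro mult_left_mono ennpowr_mono) auto
      also have "\<dots> = ennreal (\<xi> * (B / \<xi> powr q * y) powr (1 / q))"
        using B y \<xi> by (simp add: ennpowr_ennreal ennreal_mult)
      also have "\<xi> * (B / \<xi> powr q * y) powr (1 / q) = B powr (1 / q) * y powr (1 / q)"
        using B y \<xi> q_gt_1 by (simp add: powr_mult powr_divide powr_powr)
      also have "ennreal \<dots> = ennreal (B powr (1 / q)) * Lq_norm \<mu> q \<omega> f"
        unfolding norm by (intro ennreal_mult) auto
      finally show "ennreal \<xi> * ennpowr (weighted_measure \<mu> \<omega> {z. max_fun \<mu> p \<delta> K idx cube \<gamma> f z > ennreal \<xi>}) (1 / q)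
        \<le> ennreal (B powr (1 / q)) * Lq_norm \<mu> q \<omega> f" .
    qed
  qed
  then show ?thesis unfolding bounded_Lq_weak_Lq_def by blast
qed

end

theorem theorem5p10:
  fixes \<rho> :: "'a \<Rightarrow> 'a \<Rightarrow> real" and \<mu> :: "'a measure"
    and K0 p q \<delta> c0 C0 :: real and K :: nat
    and I :: "nat \<Rightarrow> int \<Rightarrow> 'i set"
    and z :: "nat \<Rightarrow> int \<Rightarrow> 'i \<Rightarrow> 'a"
    and Q :: "nat \<Rightarrow> int \<Rightarrow> 'i \<Rightarrow> 'a set"
    and \<omega> :: "'a \<times> real \<Rightarrow> real"
  assumes "homogeneous_type \<rho> K0 \<mu>"
    and "basic_assumptions \<rho> \<mu>"
    and "monotone_geodesic \<rho>"
    and "1 < p"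
    and "basic_assumptions (par_dist \<rho> p) (par_measure \<mu>)"
    and "0 < \<delta>" "\<delta> < 1" "96 * K0 ^ 6 * \<delta> \<le> 1"
    and "0 < c0" "c0 \<le> C0" "12 * K0 ^ 3 * C0 * \<delta> \<le> c0"
    and "adjacent_dyadic_systems \<rho> K0 \<mu> \<delta> c0 C0 K I z Q"
    and "1 < q"
    and "weight \<rho> \<mu> p \<omega>"
  shows "((\<exists>\<gamma>\<in>{0<..<1}. \<omega> \<in> A_plus \<rho> \<mu> p q \<gamma>) \<longleftrightarrow>
          (\<forall>\<gamma>\<in>{0<..<1}. \<omega> \<in> A_plus \<rho> \<mu> p q \<gamma>)) \<and>
         ((\<forall>\<gamma>\<in>{0<..<1}. \<omega> \<in> A_plus \<rho> \<mu> p q \<gamma>) \<longleftrightarrow>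
          (\<exists>\<gamma>\<in>{0<..<1}. bounded_Lq_weak_Lq \<mu> q \<omega> (max_fun \<mu> p \<delta> K I Q \<gamma>))) \<and>
         ((\<exists>\<gamma>\<in>{0<..<1}. bounded_Lq_weak_Lq \<mu> q \<omega> (max_fun \<mu> p \<delta> K I Q \<gamma>)) \<longleftrightarrow>
          (\<forall>\<gamma>\<in>{0<..<1}. bounded_Lq_weak_Lq \<mu> q \<omega> (max_fun \<mu> p \<delta> K I Q \<gamma>)))"
proof -
  interpret dyadic_parabolic_weight \<rho> K0 \<mu> p q \<omega> \<delta> c0 C0 K I z Q
    using assms by unfold_locales
  have lag: "\<omega> \<in> A_plus \<rho> \<mu> p q \<gamma>" if "0 < \<theta>" "0 < \<eta>" "lagged \<theta> \<eta>" "0 < \<gamma>" "\<gamma> < 1" for \<theta> \<eta> \<gamma>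
    using lagged_imp_A_plus that by blast
  have i_ii: "\<omega> \<in> A_plus \<rho> \<mu> p q \<gamma>" if "\<gamma>' \<in> {0<..<1}" "\<omega> \<in> A_plus \<rho> \<mu> p q \<gamma>'" "\<gamma> \<in> {0<..<1}" for \<gamma> \<gamma>'
    using that lag[OF _ _ A_plus_imp_lagged[of \<gamma>'], of \<gamma>] by simp
  have iii_ii: "\<omega> \<in> A_plus \<rho> \<mu> p q \<gamma>"
    if "\<gamma>' \<in> {0<..<1}" "bounded_Lq_weak_Lq \<mu> q \<omega> (max_fun \<mu> p \<delta> K I Q \<gamma>')" "\<gamma> \<in> {0<..<1}" for \<gamma> \<gamma>'
    using that weak_bound_imp_lagged[of \<gamma>'] lag by (metis greaterThanLessThan_iff)
  have ii_iv: "bounded_Lq_weak_Lq \<mu> q \<omega> (max_fun \<mu> p \<delta> K I Q \<gamma>)"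
    if "\<forall>\<gamma>\<in>{0<..<1}. \<omega> \<in> A_plus \<rho> \<mu> p q \<gamma>" "\<gamma> \<in> {0<..<1}" for \<gamma>
    using that by (intro A_plus_imp_weak_bound) auto
  \<comment> \<open>A witness that the range of lags is nonempty, so that "for all" implies "for
    some".\<close>
  have half: "1 / 2 \<in> {0<..<(1::real)}" by simp
  show ?thesis
    using i_ii iii_ii ii_iv half by meson
qed

end
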